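(* Let $n\geq 1$ be an integer and let $L>0$. Let $\nu_n:\mathrm{pow}(\mathbb{R}^{n\times n})\to\mathbb{R}_+$ be an $L$-stable $n$-valuation, and let $\Phi^{\nu_n}$ be the filtration functor induced by $\nu_n$. Then for all finite metric spaces $X,Y$ and all integers $k\geq 0$, $$ d_{\mathrm{B}}\left( \mathrm{dgm}_{k}^{\Phi^{\nu_n}}(X),\mathrm{dgm}_{k}^{\Phi^{\nu_n}}(Y) \right)\leq 2L\cdot d_{\mathrm{GH}}(X,Y). $$
   Context: $\mathbb{R}_+=[0,\infty)$. For a set $S$, $\mathrm{pow}(S)$ denotes the set of all finite non-empty subsets of $S$. $\mathcal{M}$ is the collection of all finite (non-empty) metric spaces; $d_{\mathrm{GH}}$ is the Gromov-Hausdorff distance, $d_{\mathrm{GH}}(X,Y)=\frac12\min_R \max_{(x,y),(x',y')\in R}|d_X(x,x')-d_Y(y,y')|$, with $R$ ranging over all correspondences (relations $R\subset X\times Y$ whose projections onto $X$ and $Y$ are surjective). For a metric space $(X,d_X)$, the $n$-th curvature set is $\mathrm{K}_n(X)=\{(d_X(x_i,x_j))_{i,j=1}^n : x_1,\dots,x_n\in X\}\subset\mathbb{R}^{n\times n}$. For $\sigma\in\mathrm{pow}(X)$, $\iota_X(\sigma)$ is $\sigma$ with the restricted metric. $\mathbb{R}^{n\times n}$ is endowed with the $\ell_\infty$ distance and $d_{\mathrm{H}}$ is the corresponding Hausdorff distance. An $n$-valuation is a map $\nu_n:\mathrm{pow}(\mathbb{R}^{n\times n})\to\mathbb{R}_+$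 with $\nu_n(A)\geq\nu_n(B)$ whenever $B\subset A$. It is $L$-stable if $|\nu_n(A)-\nu_n(B)|\leq L\cdot d_{\mathrm{H}}(A,B)$ for all $A,B\in\mathrm{pow}(\mathbb{R}^{n\times n})$. A filtration on a finite set $X$ is a map $\phi_X:\mathrm{pow}(X)\to\mathbb{R}_+$ with $\phi_X(\tau)\leq\phi_X(\sigma)$ for all $\tau\subset\sigma$. A filtration functor $\Phi$ assigns to each $X\in\mathcal{M}$ a filtration $\Phi_X$ on $X$. The filtration functor induced by $\nu_n$ is $\Phi^{\nu_n}_X(\sigma)=\nu_n(\mathrm{K}_n(\iota_X(\sigma)))$ for $\sigma\in\mathrm{pow}(X)$. For a filtration functor $\Phi$, $\mathrm{dgm}_k^\Phi(X)$ is the persistence diagram (barcode) of the persistent vector space obtained by applying the $k$-th simplicial homology functor with coefficients in a fixed field to the nested simplicial complexes $\Phi_X[t]=\{\sigma\in\mathrm{pow}(X):\Phi_X(\sigma)\leq t\}$, $t\geq0$, and inclusion maps. $d_{\mathrm{B}}$ is the bottleneck distance between persistence diagrams. *)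

theory Defs
  imports
    "HOL-Analysis.Analysis"
    "HOL-Algebra.AbelCoset"
    "HOL-Algebra.Module"
begin

section \<open>Finite metric spaces\<close>

definition pow_ne :: "'a set \<Rightarrow> 'a set set" where
  "pow_ne S = Fpow S - {{}}"

definition finite_metric_space :: "'a metric \<Rightarrow> bool" where
  "finite_metric_space X \<longleftrightarrow> finite (mspace X) \<and> mspace X \<noteq> {}"

definition correspondence :: "'a set \<Rightarrow> 'b set \<Rightarrow> ('a \<times> 'b) set \<Rightarrow> bool" where
  "correspondence A B R \<longleftrightarrow> R \<subseteq> A \<times> B \<and> fst ` R = A \<and> snd ` R = B"

definition distortion :: "'a metric \<Rightarrow> 'b metric \<Rightarrow> ('a \<times> 'b) set \<Rightarrow> real" where
  "distortion X Y R =
     (MAX (x, y)\<in>R. MAX (x', y')\<in>R. \<bar>mdist X x x' - mdist Y y y'\<bar>)"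

definition gromov_hausdorff :: "'a metric \<Rightarrow> 'b metric \<Rightarrow> real" where
  "gromov_hausdorff X Y =
     (1/2) * (MIN R\<in>{R. correspondence (mspace X) (mspace Y) R}. distortion X Y R)"

section \<open>Curvature sets and valuations\<close>

text \<open>The size \<open>n \<ge> 1\<close> of the matrices is the cardinality of the finite index type \<open>'n\<close>.\<close>

definition curvature_set :: "'a metric \<Rightarrow> (real^'n^'n) set" where
  "curvature_set X =
     {(\<chi> i j. mdist X (x i) (x j)) | x :: 'n \<Rightarrow> 'a. range x \<subseteq> mspace X}"

text \<open>The metric on matrices is the entrywise maximum; the class instance \<open>dist\<close> is Euclidean.\<close>

definition linf_dist :: "real^'n^'n \<Rightarrow> real^'n^'n \<Rightarrow> real" where
  "linf_dist A B = (MAX (i, j)\<in>UNIV. \<bar>A $ i $ j - B $ i $ j\<bar>)"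

text \<open>Hausdorff distance between finite non-empty sets.\<close>

definition hausdorff_dist :: "('a \<Rightarrow> 'a \<Rightarrow> real) \<Rightarrow> 'a set \<Rightarrow> 'a set \<Rightarrow> real" where
  "hausdorff_dist d A B = max (MAX a\<in>A. MIN b\<in>B. d a b) (MAX b\<in>B. MIN a\<in>A. d a b)"

definition valuation :: "((real^'n^'n) set \<Rightarrow> real) \<Rightarrow> bool" where
  "valuation \<nu> \<longleftrightarrow>
     (\<forall>A\<in>pow_ne UNIV. 0 \<le> \<nu> A) \<and>
     (\<forall>A\<in>pow_ne UNIV. \<forall>B\<in>pow_ne UNIV. B \<subseteq> A \<longrightarrow> \<nu> A \<ge> \<nu> B)"

definition stable_valuation :: "real \<Rightarrow> ((real^'n^'n) set \<Rightarrow> real) \<Rightarrow> bool" where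
  "stable_valuation L \<nu> \<longleftrightarrow>
     (\<forall>A\<in>pow_ne UNIV. \<forall>B\<in>pow_ne UNIV. \<bar>\<nu> A - \<nu> B\<bar> \<le> L * hausdorff_dist linf_dist A B)"

section \<open>Filtrations\<close>

definition filtration :: "'a set \<Rightarrow> ('a set \<Rightarrow> real) \<Rightarrow> bool" where
  "filtration S \<phi> \<longleftrightarrow>
     (\<forall>\<sigma>\<in>pow_ne S. 0 \<le> \<phi> \<sigma>) \<and>
     (\<forall>\<sigma>\<in>pow_ne S. \<forall>\<tau>\<in>pow_ne S. \<tau> \<subseteq> \<sigma> \<longrightarrow> \<phi> \<tau> \<le> \<phi> \<sigma>)"

definition induced_filtration ::
    "((real^'n^'n) set \<Rightarrow> real) \<Rightarrow> 'a metric \<Rightarrow> 'a set \<Rightarrow> real" where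
  "induced_filtration \<nu> X \<sigma> = \<nu> (curvature_set (submetric X \<sigma>))"

definition sublevel :: "'a set \<Rightarrow> ('a set \<Rightarrow> real) \<Rightarrow> real \<Rightarrow> 'a set set" where
  "sublevel S \<phi> t = {\<sigma> \<in> pow_ne S. \<phi> \<sigma> \<le> t}"

lemma curvature_set_submetric:
  assumes "\<sigma> \<in> pow_ne (mspace X)"
  shows "(curvature_set (submetric X \<sigma>) :: (real^'n^'n) set) \<in> pow_ne UNIV"
proof -
  from assms have fin: "finite \<sigma>" and ne: "\<sigma> \<noteq> {}" and sub: "\<sigma> \<inter> mspace X = \<sigma>"
    by (auto simp: pow_ne_def Fpow_def)
  have eq: "curvature_set (submetric X \<sigma>) =
      (\<lambda>x :: 'n \<Rightarrow> 'a. (\<chi> i j. mdist X (x i) (x j)) :: real^'n^'n) ` {x. range x \<subseteq> \<sigma>}"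
    by (auto simp: curvature_set_def sub)
  have "{x :: 'n \<Rightarrow> 'a. range x \<subseteq> \<sigma>} = UNIV \<rightarrow>\<^sub>E \<sigma>"
    by (auto simp: PiE_UNIV_domain)
  then have "finite {x :: 'n \<Rightarrow> 'a. range x \<subseteq> \<sigma>}"
    using fin by (simp add: finite_PiE)
  moreover have "{x :: 'n \<Rightarrow> 'a. range x \<subseteq> \<sigma>} \<noteq> {}"
    using ne by (auto intro!: exI[of _ "\<lambda>_. SOME a. a \<in> \<sigma>"] simp: some_in_eq)
  ultimately show ?thesis
    unfolding eq pow_ne_def Fpow_def by auto
qed

lemma filtration_induced_filtration:
  assumes "valuation (\<nu> :: (real^'n^'n) set \<Rightarrow> real)"
  shows "filtration (mspace X) (induced_filtration \<nu> X)"
proof -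
  have "curvature_set (submetric X \<tau>) \<subseteq> (curvature_set (submetric X \<sigma>) :: (real^'n^'n) set)"
    if "\<tau> \<subseteq> \<sigma>" for \<sigma> \<tau>
    unfolding curvature_set_def mspace_submetric mdist_submetric
    using that by (intro Collect_mono ex_mono impI conjI) auto
  then show ?thesis
    using assms curvature_set_submetric
    unfolding filtration_def induced_filtration_def valuation_def by (metis (no_types, lifting))
qed

section \<open>Vector spaces and persistent vector spaces\<close>

text \<open>
  A vector space over the field \<open>'f\<close> is an algebraic module over \<open>field_ring\<close>; the fields
  \<open>mult\<close> and \<open>one\<close> of the record play no role and are left \<^const>\<open>undefined\<close>.
\<close>

definition field_ring :: "'f::field ring" where
  "field_ring = \<lparr>carrier = UNIV, mult = (*), one = 1, zero = 0, add = (+)\<rparr>"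

definition linear_maps :: "('f, 'v) module \<Rightarrow> ('f, 'w) module \<Rightarrow> ('v \<Rightarrow> 'w) set" where
  "linear_maps V W = {f \<in> carrier V \<rightarrow> carrier W.
     (\<forall>x\<in>carrier V. \<forall>y\<in>carrier V. f (x \<oplus>\<^bsub>V\<^esub> y) = f x \<oplus>\<^bsub>W\<^esub> f y) \<and>
     (\<forall>r. \<forall>x\<in>carrier V. f (r \<odot>\<^bsub>V\<^esub> x) = r \<odot>\<^bsub>W\<^esub> f x)}"

definition quotient_space :: "('f, 'v) module \<Rightarrow> 'v set \<Rightarrow> ('f, 'v set) module" where
  "quotient_space V N =
     \<lparr>carrier = a_rcosets\<^bsub>V\<^esub> N, mult = undefined, one = undefined, zero = N,
      add = (\<lambda>A B. A <+>\<^bsub>V\<^esub> B),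
      smult = (\<lambda>r A. \<Union>a\<in>A. N +>\<^bsub>V\<^esub> (r \<odot>\<^bsub>V\<^esub> a))\<rparr>"

locale persistent_vector_space =
  fixes V :: "real \<Rightarrow> ('f::field, 'v) module"
    and \<theta> :: "real \<Rightarrow> real \<Rightarrow> 'v \<Rightarrow> 'v"
  assumes vector_space: "0 \<le> t \<Longrightarrow> Module.module field_ring (V t)"
    and linear: "\<lbrakk>0 \<le> s; s \<le> t\<rbrakk> \<Longrightarrow> \<theta> s t \<in> linear_maps (V s) (V t)"
    and refl: "\<lbrakk>0 \<le> t; x \<in> carrier (V t)\<rbrakk> \<Longrightarrow> \<theta> t t x = x"
    and comp: "\<lbrakk>0 \<le> r; r \<le> s; s \<le> t; x \<in> carrier (V r)\<rbrakk> \<Longrightarrow> \<theta> s t (\<theta> r s x) = \<theta> r t x"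

section \<open>Barcodes\<close>

text \<open>
  A bar \<open>(b, d)\<close> stands for the half-open interval from \<open>b\<close> (included) to \<open>d\<close> (excluded, possibly
  infinite). Only such intervals occur here: for finite \<open>X\<close> the sublevel complexes form a
  right-continuous step function of \<open>t\<close>.
\<close>

type_synonym bar = "real \<times> ereal"

definition in_bar :: "real \<Rightarrow> bar \<Rightarrow> bool" where
  "in_bar t I \<longleftrightarrow> fst I \<le> t \<and> ereal t < snd I"

text \<open>
  The direct sum of the interval modules of a list of bars: at \<open>t\<close> it has one copy of \<open>'f\<close> for each
  bar containing \<open>t\<close>. From \<open>s\<close> to \<open>t\<close> a summand is mapped by the identity if both \<open>s\<close> and \<open>t\<close> lie
  in its bar, and by zero otherwise.
\<close>

definition interval_sum :: "bar list \<Rightarrow> real \<Rightarrow> ('f::field, nat \<Rightarrow> 'f) module" where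
  "interval_sum Is t =
     \<lparr>carrier = {c. \<forall>i. c i \<noteq> 0 \<longrightarrow> i < length Is \<and> in_bar t (Is ! i)},
      mult = undefined, one = undefined, zero = (\<lambda>_. 0),
      add = (\<lambda>c c' i. c i + c' i),
      smult = (\<lambda>r c i. r * c i)\<rparr>"

definition interval_sum_map ::
    "bar list \<Rightarrow> real \<Rightarrow> real \<Rightarrow> (nat \<Rightarrow> 'f::field) \<Rightarrow> (nat \<Rightarrow> 'f)" where
  "interval_sum_map Is s t c =
     (\<lambda>i. if i < length Is \<and> in_bar s (Is ! i) \<and> in_bar t (Is ! i) then c i else 0)"

definition is_barcode ::
    "(real \<Rightarrow> ('f::field, 'v) module) \<Rightarrow> (real \<Rightarrow> real \<Rightarrow> 'v \<Rightarrow> 'v) \<Rightarrow> bar multiset \<Rightarrow> bool" where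
  "is_barcode V \<theta> D \<longleftrightarrow>
     (\<exists>Is. mset Is = D \<and> (\<forall>(b, d)\<in>set Is. 0 \<le> b \<and> ereal b < d) \<and>
       (\<exists>\<Psi>. (\<forall>t\<ge>0. \<Psi> t \<in> linear_maps (V t) (interval_sum Is t) \<and>
                     bij_betw (\<Psi> t) (carrier (V t)) (carrier (interval_sum Is t :: ('f, _) module))) \<and>
            (\<forall>s t. 0 \<le> s \<longrightarrow> s \<le> t \<longrightarrow>
               (\<forall>x\<in>carrier (V s). \<Psi> t (\<theta> s t x) = interval_sum_map Is s t (\<Psi> s x)))))"

definition barcode ::
    "(real \<Rightarrow> ('f::field, 'v) module) \<Rightarrow> (real \<Rightarrow> real \<Rightarrow> 'v \<Rightarrow> 'v) \<Rightarrow> bar multiset" where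
  "barcode V \<theta> = (THE D. is_barcode V \<theta> D)"

section \<open>Simplicial homology with field coefficients\<close>

text \<open>
  Oriented chains: a \<open>k\<close>-chain is a function on orderings \<open>[v\<^sub>0, \<dots>, v\<^sub>k]\<close> of the \<open>k\<close>-simplices of \<open>K\<close>
  that changes by the sign of the permutation when the vertices are reordered. (Simplices are the
  non-empty members of \<open>K\<close>; in characteristic 2 the sign is irrelevant.) The oriented simplex
  \<open>[v\<^sub>0, \<dots>, v\<^sub>k]\<close> is the chain with value \<open>sign p\<close> on the reordering of \<open>[v\<^sub>0, \<dots>, v\<^sub>k]\<close> by \<open>p\<close> and
  value 0 elsewhere.
\<close>

definition chains :: "nat \<Rightarrow> 'a set set \<Rightarrow> ('a list \<Rightarrow> 'f::field) set" where
  "chains k K = {c.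
     (\<forall>vs. c vs \<noteq> 0 \<longrightarrow> distinct vs \<and> length vs = Suc k \<and> set vs \<in> K) \<and>
     (\<forall>vs p. p permutes {..<length vs} \<longrightarrow> c (permute_list p vs) = of_int (sign p) * c vs)}"

text \<open>
  The usual boundary \<open>\<partial>[v\<^sub>0, \<dots>, v\<^sub>k] = \<Sum>i. (-1)\<^sup>i [v\<^sub>0, \<dots>, v\<^sub>i\<^sub>-\<^sub>1, v\<^sub>i\<^sub>+\<^sub>1, \<dots>, v\<^sub>k]\<close>, extended linearly: the
  coefficient of \<open>\<partial>c\<close> at \<open>vs\<close> collects the coefficients of \<open>c\<close> at all \<open>v # vs\<close>, since moving
  \<open>v\<^sub>i\<close> to the front is a permutation of sign \<open>(-1)\<^sup>i\<close>. Homology is unreduced, so the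
  boundary of a 0-chain is zero. The sum is finite for chains of a finite complex.
\<close>

definition boundary :: "('a list \<Rightarrow> 'f::field) \<Rightarrow> 'a list \<Rightarrow> 'f" where
  "boundary c vs = (if vs = [] then 0 else \<Sum>v | c (v # vs) \<noteq> 0. c (v # vs))"

definition cycles :: "nat \<Rightarrow> 'a set set \<Rightarrow> ('a list \<Rightarrow> 'f::field) set" where
  "cycles k K = {c \<in> chains k K. boundary c = (\<lambda>_. 0)}"

definition boundaries :: "nat \<Rightarrow> 'a set set \<Rightarrow> ('a list \<Rightarrow> 'f::field) set" where
  "boundaries k K = boundary ` chains (Suc k) K"

definition cycle_space :: "nat \<Rightarrow> 'a set set \<Rightarrow> ('f::field, 'a list \<Rightarrow> 'f) module" where
  "cycle_space k K =
     \<lparr>carrier = cycles k K, mult = undefined, one = undefined, zero = (\<lambda>_. 0),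
      add = (\<lambda>c c' vs. c vs + c' vs),
      smult = (\<lambda>r c vs. r * c vs)\<rparr>"

definition homology :: "nat \<Rightarrow> 'a set set \<Rightarrow> ('f::field, ('a list \<Rightarrow> 'f) set) module" where
  "homology k K = quotient_space (cycle_space k K) (boundaries k K)"

text \<open>The map induced by an inclusion \<open>K \<subseteq> K'\<close>, sending the class of \<open>z\<close> in \<open>K\<close> to its class in \<open>K'\<close>.\<close>

definition homology_map ::
    "nat \<Rightarrow> 'a set set \<Rightarrow> ('a list \<Rightarrow> 'f::field) set \<Rightarrow> ('a list \<Rightarrow> 'f) set" where
  "homology_map k K' A = (\<Union>z\<in>A. boundaries k K' +>\<^bsub>cycle_space k K'\<^esub> z)"

section \<open>Persistence diagrams and the bottleneck distance\<close>

text \<open>The type argument records the coefficient field.\<close>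

definition dgm ::
    "'f::field itself \<Rightarrow> nat \<Rightarrow> ('a metric \<Rightarrow> 'a set \<Rightarrow> real) \<Rightarrow> 'a metric \<Rightarrow> bar multiset" where
  "dgm _ k \<Phi> X =
     (let K = sublevel (mspace X) (\<Phi> X)
      in barcode (\<lambda>t. homology k (K t) :: ('f, ('a list \<Rightarrow> 'f) set) module)
                 (\<lambda>s t. homology_map k (K t)))"

text \<open>
  The \<open>\<ell>\<^sub>\<infinity>\<close> distance on the extended plane. Two infinite death times are at distance 0; this
  case is separate because \<open>\<infinity> - \<infinity> = \<infinity>\<close> in \<^typ>\<open>ereal\<close>.
\<close>

definition bar_dist :: "bar \<Rightarrow> bar \<Rightarrow> ereal" where
  "bar_dist I J =
     max (ereal \<bar>fst I - fst J\<bar>) (if snd I = snd J then 0 else \<bar>snd I - snd J\<bar>)"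

text \<open>\<open>\<ell>\<^sub>\<infinity>\<close> distance to the diagonal.\<close>

definition diag_dist :: "bar \<Rightarrow> ereal" where
  "diag_dist I = (snd I - ereal (fst I)) / 2"

definition partial_matching :: "bar multiset \<Rightarrow> bar multiset \<Rightarrow> (bar \<times> bar) multiset \<Rightarrow> bool" where
  "partial_matching A B M \<longleftrightarrow> image_mset fst M \<subseteq># A \<and> image_mset snd M \<subseteq># B"

definition matching_cost :: "bar multiset \<Rightarrow> bar multiset \<Rightarrow> (bar \<times> bar) multiset \<Rightarrow> ereal" where
  "matching_cost A B M =
     Max ({0} \<union> (\<lambda>(I, J). bar_dist I J) ` set_mset M
              \<union> diag_dist ` set_mset (A - image_mset fst M)
              \<union> diag_dist ` set_mset (B - image_mset snd M))"

definition bottleneck_dist :: "bar multiset \<Rightarrow> bar multiset \<Rightarrow> ereal" where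
  "bottleneck_dist A B = (INF M\<in>{M. partial_matching A B M}. matching_cost A B M)"

section \<open>Homology of a filtration is a persistent vector space\<close>

lemma cring_field_ring: "cring (field_ring :: 'f::field ring)"
proof -
  have "\<exists>y. x + y = 0" for x :: 'f using add.right_inverse by blast
  then show ?thesis
    unfolding field_ring_def by unfold_locales (auto simp: algebra_simps Units_def)
qed

lemma module_quotient_space:
  fixes V :: "('f::field, 'v) module"
  assumes V: "Module.module field_ring V" and N: "additive_subgroup N V"
    and sm: "\<And>r x. x \<in> N \<Longrightarrow> r \<odot>\<^bsub>V\<^esub> x \<in> N"
  shows "Module.module field_ring (quotient_space V N)"
    and "\<And>r x. x \<in> carrier V \<Longrightarrow>
           r \<odot>\<^bsub>quotient_space V N\<^esub> (N +>\<^bsub>V\<^esub> x) = N +>\<^bsub>V\<^esub> (r \<odot>\<^bsub>V\<^esub> x)"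
proof -
  interpret V: Module.module field_ring V by (rule V)
  interpret N: abelian_subgroup N V
    by (rule abelian_subgroupI3) (use N V.abelian_group_axioms in auto)
  have cl [simp]: "r \<odot>\<^bsub>V\<^esub> x \<in> carrier V" if "x \<in> carrier V" for r :: 'f and x
    using V.smult_closed[of r x] that by (simp add: field_ring_def)
  have rd: "r \<odot>\<^bsub>V\<^esub> (x \<oplus>\<^bsub>V\<^esub> y) = r \<odot>\<^bsub>V\<^esub> x \<oplus>\<^bsub>V\<^esub> r \<odot>\<^bsub>V\<^esub> y"
    if "x \<in> carrier V" "y \<in> carrier V" for r :: 'f and x y
    using V.smult_r_distr[of r x y] that by (simp add: field_ring_def)
  have ld: "(r + q) \<odot>\<^bsub>V\<^esub> x = r \<odot>\<^bsub>V\<^esub> x \<oplus>\<^bsub>V\<^esub> q \<odot>\<^bsub>V\<^esub> x" if "x \<in> carrier V" for r q :: 'f and x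
    using V.smult_l_distr[of r q x] that by (simp add: field_ring_def)
  have as: "(r * q) \<odot>\<^bsub>V\<^esub> x = r \<odot>\<^bsub>V\<^esub> (q \<odot>\<^bsub>V\<^esub> x)" if "x \<in> carrier V" for r q :: 'f and x
    using V.smult_assoc1[of r q x] that by (simp add: field_ring_def)
  have on: "1 \<odot>\<^bsub>V\<^esub> x = x" if "x \<in> carrier V" for x
    using V.smult_one[of x] that by (simp add: field_ring_def)
  have *: "(\<Union>a\<in>(N +>\<^bsub>V\<^esub> x). N +>\<^bsub>V\<^esub> (r \<odot>\<^bsub>V\<^esub> a)) = N +>\<^bsub>V\<^esub> (r \<odot>\<^bsub>V\<^esub> x)" 
    if x: "x \<in> carrier V" for r x
  proof -
    have "N +>\<^bsub>V\<^esub> (r \<odot>\<^bsub>V\<^esub> a) = N +>\<^bsub>V\<^esub> (r \<odot>\<^bsub>V\<^esub> x)" if "a \<in> N +>\<^bsub>V\<^esub> x" for a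
    proof -
      from that obtain n where n: "n \<in> N" "a = n \<oplus>\<^bsub>V\<^esub> x" by (auto simp: a_r_coset_def')
      then have "r \<odot>\<^bsub>V\<^esub> a = r \<odot>\<^bsub>V\<^esub> n \<oplus>\<^bsub>V\<^esub> r \<odot>\<^bsub>V\<^esub> x"
        using x N.a_subset by (auto simp: rd)
      then have "r \<odot>\<^bsub>V\<^esub> a \<in> N +>\<^bsub>V\<^esub> (r \<odot>\<^bsub>V\<^esub> x)" using sm n by (auto simp: a_r_coset_def')
      from N.a_repr_independence'[OF this cl[OF x]] show ?thesis by (rule sym)
    qed
    then show ?thesis using N.a_rcos_self[OF x] by blast
  qed
  show **: "\<And>r x. x \<in> carrier V \<Longrightarrow>
           r \<odot>\<^bsub>quotient_space V N\<^esub> (N +>\<^bsub>V\<^esub> x) = N +>\<^bsub>V\<^esub> (r \<odot>\<^bsub>V\<^esub> x)"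
    using * by (simp add: quotient_space_def)
  have car: "carrier (quotient_space V N) = (\<lambda>x. N +>\<^bsub>V\<^esub> x) ` carrier V"
    by (auto simp: quotient_space_def A_RCOSETS_def')
  have addq: "(N +>\<^bsub>V\<^esub> x) \<oplus>\<^bsub>quotient_space V N\<^esub> (N +>\<^bsub>V\<^esub> y) = N +>\<^bsub>V\<^esub> (x \<oplus>\<^bsub>V\<^esub> y)" 
    if "x \<in> carrier V" "y \<in> carrier V" for x y
    using N.a_rcos_sum[of x y] that by (simp add: quotient_space_def)
  have zq: "\<zero>\<^bsub>quotient_space V N\<^esub> = N +>\<^bsub>V\<^esub> \<zero>\<^bsub>V\<^esub>"
    using V.a_coset_add_zero[OF N.a_subset] by (simp add: quotient_space_def)
  have ab: "abelian_group (quotient_space V N)"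
  proof (rule abelian_groupI)
    fix A assume "A \<in> carrier (quotient_space V N)"
    then obtain x where x: "x \<in> carrier V" "A = N +>\<^bsub>V\<^esub> x" by (auto simp: car)
    then show "\<exists>B\<in>carrier (quotient_space V N).
        B \<oplus>\<^bsub>quotient_space V N\<^esub> A = \<zero>\<^bsub>quotient_space V N\<^esub>"
      by (intro bexI[of _ "N +>\<^bsub>V\<^esub> (\<ominus>\<^bsub>V\<^esub> x)"]) (auto simp: car addq zq V.l_neg)
  qed (auto simp: car addq zq V.a_ac)
  show "Module.module field_ring (quotient_space V N)"
    by (rule moduleI[OF cring_field_ring ab])
       (auto simp: car ** addq rd ld as on field_ring_def)
qed

lemma chains_supp:
  "c \<in> chains k K \<Longrightarrow> c vs \<noteq> 0 \<Longrightarrow> distinct vs \<and> length vs = Suc k \<and> set vs \<in> K"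
  unfolding chains_def by blast

lemma chains_perm:
  "c \<in> chains k K \<Longrightarrow> p permutes {..<length vs} \<Longrightarrow> c (permute_list p vs) = of_int (sign p) * c vs"
  unfolding chains_def by blast

lemma chainsI:
  assumes "\<And>vs. c vs \<noteq> 0 \<Longrightarrow> distinct vs \<and> length vs = Suc k \<and> set vs \<in> K"
    and "\<And>vs p. p permutes {..<length vs} \<Longrightarrow> c (permute_list p vs) = of_int (sign p) * c vs"
  shows "c \<in> chains k K"
  using assms unfolding chains_def by blast

lemma boundary_alt:
  fixes c :: "'a list \<Rightarrow> 'f::field"
  assumes "c \<in> chains k K" "finite S" "\<Union>K \<subseteq> S"
  shows "boundary c vs = (if vs = [] then 0 else \<Sum>v\<in>S. c (v # vs))"
proof -
  have "{v. c (v # vs) \<noteq> 0} \<subseteq> S"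
  proof
    fix v assume "v \<in> {v. c (v # vs) \<noteq> 0}"
    then have "set (v # vs) \<in> K" using chains_supp[OF assms(1), of "v # vs"] by simp
    then have "v \<in> \<Union>K" by (intro UnionI[of "set (v # vs)"]) auto
    then show "v \<in> S" using assms(3) by blast
  qed
  then have "(\<Sum>v | c (v # vs) \<noteq> 0. c (v # vs)) = (\<Sum>v\<in>S. c (v # vs))"
    by (intro sum.mono_neutral_left assms(2)) auto
  then show ?thesis unfolding boundary_def by simp
qed

lemma chains_lin:
  fixes r :: "'f::field"
  assumes c: "c \<in> chains k K" "c' \<in> chains k K"
  shows "(\<lambda>vs. c vs + c' vs) \<in> chains k K" "(\<lambda>vs. r * c vs) \<in> chains k K"
proof -
  show "(\<lambda>vs. c vs + c' vs) \<in> chains k K"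
  proof (rule chainsI)
    fix vs assume "c vs + c' vs \<noteq> 0"
    then have "c vs \<noteq> 0 \<or> c' vs \<noteq> 0" by auto
    then show "distinct vs \<and> length vs = Suc k \<and> set vs \<in> K"
      using chains_supp c by blast
  qed (simp add: chains_perm[OF c(1)] chains_perm[OF c(2)] distrib_left)
  show "(\<lambda>vs. r * c vs) \<in> chains k K"
  proof (rule chainsI)
    fix vs assume "r * c vs \<noteq> 0"
    then have "c vs \<noteq> 0" by auto
    then show "distinct vs \<and> length vs = Suc k \<and> set vs \<in> K"
      using chains_supp c by blast
  qed (simp add: chains_perm[OF c(1)])
qed

lemma chains_0: "(\<lambda>_. 0) \<in> chains k K"
  by (rule chainsI) auto

lemma chains_mono: "K \<subseteq> K' \<Longrightarrow> chains k K \<subseteq> chains k K'"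
  by (intro subsetI chainsI) (use chains_supp chains_perm in blast)+

lemma cycles_mono: "K \<subseteq> K' \<Longrightarrow> cycles k K \<subseteq> cycles k K'"
  using chains_mono unfolding cycles_def by blast

lemma permute_Cons:
  assumes "p permutes {..<length vs}"
  obtains q where "q permutes {..<length (v # vs)}" "sign q = sign p" 
    "permute_list q (v # vs) = v # permute_list p vs"
proof
  let ?q = "map_permutation {..<length vs} Suc p"
  have "?q permutes Suc ` {..<length vs}"
    by (rule map_permutation_permutes) (use assms in \<open>auto simp: bij_betw_def\<close>)
  moreover have "0 \<notin> Suc ` {..<length vs}" by auto
  ultimately have q0: "?q 0 = 0" by (meson permutes_not_in)
  show "?q permutes {..<length (v # vs)}"
    by (rule permutes_subset[OF \<open>?q permutes _\<close>]) auto
  show "sign ?q = sign p" using assms by (intro sign_map_permutation) auto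
  have "?q (Suc i) = Suc (p i)" if "i < length vs" for i
    using that by (intro map_permutation_apply) auto
  then show "permute_list ?q (v # vs) = v # permute_list p vs"
    unfolding permute_list_def list.size by (subst upt_conv_Cons)
      (auto simp: q0 map_Suc_upt[symmetric] simp del: upt_Suc)
qed

lemma boundary_chains:
  fixes c :: "'a list \<Rightarrow> 'f::field"
  assumes c: "c \<in> chains (Suc k) K" and fin: "finite (\<Union>K)"
    and cl: "\<And>\<sigma> \<tau>. \<sigma> \<in> K \<Longrightarrow> \<tau> \<subseteq> \<sigma> \<Longrightarrow> \<tau> \<noteq> {} \<Longrightarrow> \<tau> \<in> K"
  shows "boundary c \<in> chains k K"
proof -
  note b = boundary_alt[OF c fin order_refl]
  have "distinct vs \<and> length vs = Suc k \<and> set vs \<in> K" if "boundary c vs \<noteq> 0" for vs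
  proof -
    from that obtain v where "c (v # vs) \<noteq> 0" "vs \<noteq> []"
      unfolding b by (metis (mono_tags, lifting) sum.neutral)
    with chains_supp[OF c, of "v # vs"] cl[of "set (v # vs)" "set vs"] show ?thesis by auto
  qed
  moreover have "boundary c (permute_list p vs) = of_int (sign p) * boundary c vs"
    if p: "p permutes {..<length vs}" for vs p
  proof -
    have "c (v # permute_list p vs) = of_int (sign p) * c (v # vs)" for v
      using permute_Cons[OF p, of v] chains_perm[OF c] by metis
    moreover have "permute_list p vs = [] \<longleftrightarrow> vs = []"
      by (simp add: permute_list_def)
    ultimately show ?thesis unfolding b by (simp add: sum_distrib_left)
  qed
  ultimately show ?thesis by (intro chainsI) blast+
qed

lemma swap_chain:
  fixes c :: "'a list \<Rightarrow> 'f::field"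
  assumes c: "c \<in> chains k K"
  shows "c (v # w # vs) = - c (w # v # vs)"
proof -
  let ?p = "Transposition.transpose 0 (Suc 0)"
  have "?p permutes {..<length (w # v # vs)}"
    by (rule permutes_swap_id) auto
  moreover have "permute_list ?p (w # v # vs) = v # w # vs"
    by (rule nth_equalityI)
      (auto simp: permute_list_def Transposition.transpose_def nth_Cons' simp del: upt_Suc)
  ultimately have "c (v # w # vs) = of_int (sign ?p) * c (w # v # vs)"
    using chains_perm[OF c] by metis
  then show ?thesis by (simp add: sign_swap_id)
qed

lemma sum_alternating:
  fixes f :: "'a \<Rightarrow> 'a \<Rightarrow> 'f::ab_group_add"
  assumes "finite S" "\<And>v. f v v = 0" "\<And>v w. f v w = - f w v"
  shows "(\<Sum>v\<in>S. \<Sum>w\<in>S. f w v) = 0"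
  using assms(1)
proof induction
  case (insert x F)
  have "(\<Sum>v\<in>F. f x v) = - (\<Sum>v\<in>F. f v x)"
    unfolding sum_negf[symmetric] by (intro sum.cong refl assms(3))
  then show ?case using insert by (simp add: sum.distrib assms(2))
qed simp

lemma boundary_boundary:
  fixes c :: "'a list \<Rightarrow> 'f::field"
  assumes c: "c \<in> chains (Suc k) K" and fin: "finite (\<Union>K)"
    and cl: "\<And>\<sigma> \<tau>. \<sigma> \<in> K \<Longrightarrow> \<tau> \<subseteq> \<sigma> \<Longrightarrow> \<tau> \<noteq> {} \<Longrightarrow> \<tau> \<in> K"
  shows "boundary (boundary c) vs = 0"
proof -
  have z: "c (v # v # vs) = 0" for v using chains_supp[OF c, of "v # v # vs"] by auto
  have "(\<Sum>v\<in>\<Union>K. \<Sum>w\<in>\<Union>K. c (w # v # vs)) = 0"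
    by (rule sum_alternating[OF fin, of "\<lambda>w v. c (w # v # vs)"], rule z, rule swap_chain[OF c])
  then show ?thesis
    by (simp add: boundary_alt[OF boundary_chains[OF c fin cl] fin order_refl]
      boundary_alt[OF c fin order_refl])
qed

lemma module_cycle_space:
  fixes K :: "'a set set"
  assumes fin: "finite (\<Union>K)"
  shows "Module.module field_ring (cycle_space k K :: ('f::field, 'a list \<Rightarrow> 'f) module)"
proof -
  have lin: "(\<lambda>vs. c vs + c' vs) \<in> cycles k K" "(\<lambda>vs. r * c vs) \<in> cycles k K"
    if "c \<in> cycles k K" "c' \<in> cycles k K" for c c' and r :: 'f
  proof -
    have cc: "c \<in> chains k K" "c' \<in> chains k K" using that by (auto simp: cycles_def)
    note L = chains_lin[OF cc] 
    note B = boundary_alt[OF _ fin order_refl]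
    have 0: "boundary c vs = 0" "boundary c' vs = 0" for vs
      using that by (auto simp: cycles_def)
    have "boundary (\<lambda>vs. c vs + c' vs) vs = boundary c vs + boundary c' vs" for vs
      by (simp add: B[OF cc(1)] B[OF cc(2)] B[OF L(1)] sum.distrib)
    then show "(\<lambda>vs. c vs + c' vs) \<in> cycles k K"
      using 0 L(1) by (simp add: cycles_def fun_eq_iff)
    have "boundary (\<lambda>vs. r * c vs) vs = r * boundary c vs" for vs
      by (simp add: B[OF cc(1)] B[OF L(2)] sum_distrib_left)
    then show "(\<lambda>vs. r * c vs) \<in> cycles k K"
      using 0 L(2) by (simp add: cycles_def fun_eq_iff)
  qed
  have z: "(\<lambda>_. 0) \<in> cycles k K" by (auto simp: cycles_def chains_0 boundary_def)
  have ab: "abelian_group (cycle_space k K :: ('f, 'a list \<Rightarrow> 'f) module)"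
  proof (rule abelian_groupI)
    fix c :: "'a list \<Rightarrow> 'f" assume "c \<in> carrier (cycle_space k K)"
    then show "\<exists>y\<in>carrier (cycle_space k K). y \<oplus>\<^bsub>cycle_space k K\<^esub> c = \<zero>\<^bsub>cycle_space k K\<^esub>"
      using lin(2)[of c c "-1"] by (intro bexI[of _ "\<lambda>vs. - 1 * c vs"]) (auto simp: cycle_space_def)
  qed (auto simp: cycle_space_def lin z algebra_simps)
  show ?thesis
    by (rule moduleI[OF cring_field_ring ab])
       (auto simp: cycle_space_def field_ring_def lin algebra_simps)
qed

lemma boundaries_sub:
  fixes K :: "'a set set"
  assumes fin: "finite (\<Union>K)"
    and cl: "\<And>\<sigma> \<tau>. \<sigma> \<in> K \<Longrightarrow> \<tau> \<subseteq> \<sigma> \<Longrightarrow> \<tau> \<noteq> {} \<Longrightarrow> \<tau> \<in> K"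
  shows "additive_subgroup (boundaries k K) (cycle_space k K :: ('f::field, 'a list \<Rightarrow> 'f) module)"
    and "\<And>r x. x \<in> boundaries k K \<Longrightarrow> r \<odot>\<^bsub>(cycle_space k K :: ('f, 'a list \<Rightarrow> 'f) module)\<^esub> x \<in> boundaries k K"
proof -
  interpret V: Module.module field_ring "cycle_space k K :: ('f, 'a list \<Rightarrow> 'f) module"
    by (rule module_cycle_space[OF fin])
  note B = boundary_alt[OF _ fin order_refl]
  have add: "(\<lambda>vs. boundary c vs + boundary c' vs) = boundary (\<lambda>vs. c vs + c' vs)" 
    and sm: "(\<lambda>vs. r * boundary c vs) = boundary (\<lambda>vs. r * c vs)"
    if "c \<in> chains (Suc k) K" "c' \<in> chains (Suc k) K" for c c' and r :: 'f
    by (simp_all add: fun_eq_iff B[OF that(1)] B[OF that(2)] B[OF chains_lin(1)[OF that]]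
      B[OF chains_lin(2)[OF that]] sum.distrib sum_distrib_left)
  have sub: "boundaries k K \<subseteq> (cycles k K :: ('a list \<Rightarrow> 'f) set)"
    using boundary_chains[OF _ fin cl] boundary_boundary[OF _ fin cl]
    unfolding boundaries_def cycles_def by (auto simp: fun_eq_iff)
  have z: "(\<lambda>_. 0) \<in> (boundaries k K :: ('a list \<Rightarrow> 'f) set)"
    unfolding boundaries_def by (rule image_eqI[of _ _ "\<lambda>_. 0"]) (auto simp: boundary_def chains_0)
  have a: "(\<lambda>vs. x vs + y vs) \<in> boundaries k K"
    if "x \<in> boundaries k K" "y \<in> boundaries k K" for x y :: "'a list \<Rightarrow> 'f"
    using that chains_lin(1) unfolding boundaries_def by (auto simp: add intro!: imageI)
  have s: "(\<lambda>vs. r * x vs) \<in> boundaries k K" if "x \<in> boundaries k K" for x and r :: 'f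
    using that chains_lin(2) unfolding boundaries_def by (auto simp: sm intro!: imageI)
  show sm': "\<And>r x. x \<in> boundaries k K \<Longrightarrow> r \<odot>\<^bsub>(cycle_space k K :: ('f, 'a list \<Rightarrow> 'f) module)\<^esub> x \<in> boundaries k K"
    using s by (auto simp: cycle_space_def)
  have neg: "\<ominus>\<^bsub>cycle_space k K\<^esub> x \<in> boundaries k K" if "x \<in> boundaries k K" for x :: "'a list \<Rightarrow> 'f"
  proof -
    have "(\<lambda>vs. (-1) * x vs) = \<ominus>\<^bsub>cycle_space k K\<^esub> x"
      by (rule V.minus_equality[symmetric])
        (use sub that s[OF that, of "-1"] in \<open>auto simp: cycle_space_def\<close>)
    then show ?thesis using s[OF that, of "-1"] by simp
  qed
  show "additive_subgroup (boundaries k K) (cycle_space k K :: ('f, 'a list \<Rightarrow> 'f) module)"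
    by (rule additive_subgroupI, unfold_locales)
       (use sub z a neg in \<open>auto simp: cycle_space_def a_inv_def\<close>)
qed

lemma module_homology:
  fixes K :: "'a set set"
  assumes fin: "finite (\<Union>K)"
    and cl: "\<And>\<sigma> \<tau>. \<sigma> \<in> K \<Longrightarrow> \<tau> \<subseteq> \<sigma> \<Longrightarrow> \<tau> \<noteq> {} \<Longrightarrow> \<tau> \<in> K"
  shows "Module.module field_ring (homology k K :: ('f::field, ('a list \<Rightarrow> 'f) set) module)"
  unfolding homology_def
  by (rule module_quotient_space[OF module_cycle_space[OF fin] boundaries_sub[OF fin cl]])

lemma homology_map_coset:
  fixes K K' :: "'a set set"
  assumes fin: "finite (\<Union>K')"
    and cl: "\<And>\<sigma> \<tau>. \<sigma> \<in> K \<Longrightarrow> \<tau> \<subseteq> \<sigma> \<Longrightarrow> \<tau> \<noteq> {} \<Longrightarrow> \<tau> \<in> K"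
    and cl': "\<And>\<sigma> \<tau>. \<sigma> \<in> K' \<Longrightarrow> \<tau> \<subseteq> \<sigma> \<Longrightarrow> \<tau> \<noteq> {} \<Longrightarrow> \<tau> \<in> K'"
    and sub: "K \<subseteq> K'" and z: "z \<in> cycles k K"
  shows "homology_map k K' (boundaries k K +>\<^bsub>cycle_space k K\<^esub> z) =
    boundaries k K' +>\<^bsub>cycle_space k K'\<^esub> (z :: 'a list \<Rightarrow> 'f::field)"
proof -
  have ch: "chains j K \<subseteq> (chains j K' :: ('a list \<Rightarrow> 'f) set)" for j
    by (rule chains_mono[OF sub])
  have cy: "cycles k K \<subseteq> (cycles k K' :: ('a list \<Rightarrow> 'f) set)" 
    and bo: "boundaries k K \<subseteq> (boundaries k K' :: ('a list \<Rightarrow> 'f) set)"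
    using ch cycles_mono[OF sub] unfolding boundaries_def by blast+
  have finK: "finite (\<Union>K)" using fin sub by (meson Union_mono finite_subset)
  interpret V: Module.module field_ring "cycle_space k K :: ('f, 'a list \<Rightarrow> 'f) module"
    by (rule module_cycle_space[OF finK])
  interpret V': Module.module field_ring "cycle_space k K' :: ('f, 'a list \<Rightarrow> 'f) module"
    by (rule module_cycle_space[OF fin])
  interpret N: abelian_subgroup "boundaries k K" "cycle_space k K :: ('f, 'a list \<Rightarrow> 'f) module"
    by (rule abelian_subgroupI3) (use boundaries_sub[OF finK cl] V.abelian_group_axioms in auto)
  interpret N': abelian_subgroup "boundaries k K'" "cycle_space k K' :: ('f, 'a list \<Rightarrow> 'f) module"
    by (rule abelian_subgroupI3) (use boundaries_sub[OF fin cl'] V'.abelian_group_axioms in auto)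
  have "boundaries k K' +>\<^bsub>cycle_space k K'\<^esub> y = boundaries k K' +>\<^bsub>cycle_space k K'\<^esub> z"
    if "y \<in> boundaries k K +>\<^bsub>cycle_space k K\<^esub> z" for y
  proof -
    have "y \<in> boundaries k K' +>\<^bsub>cycle_space k K'\<^esub> z"
      using that bo by (auto simp: a_r_coset_def' cycle_space_def)
    then show ?thesis using N'.a_repr_independence' z cy by (auto simp: cycle_space_def)
  qed
  moreover have "z \<in> boundaries k K +>\<^bsub>cycle_space k K\<^esub> z"
    by (rule N.a_rcos_self) (use z in \<open>simp add: cycle_space_def\<close>)
  ultimately show ?thesis unfolding homology_map_def by blast
qed

lemma persistent_homology:
  fixes \<phi> :: "'a set \<Rightarrow> real"
  assumes S: "finite S" and \<phi>: "filtration S \<phi>"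
  shows "persistent_vector_space
     (\<lambda>t. homology k (sublevel S \<phi> t) :: ('f::field, ('a list \<Rightarrow> 'f) set) module)
     (\<lambda>s t. homology_map k (sublevel S \<phi> t))"
proof -
  let ?K = "sublevel S \<phi>"
  let ?Q = "\<lambda>t. boundaries k (?K t) :: ('a list \<Rightarrow> 'f) set"
  let ?C = "\<lambda>t. cycle_space k (?K t) :: ('f, 'a list \<Rightarrow> 'f) module"
  let ?H = "\<lambda>t. homology k (?K t) :: ('f, ('a list \<Rightarrow> 'f) set) module"
  have fin: "finite (\<Union>(?K t))" for t
    by (rule finite_subset[OF _ S]) (auto simp: sublevel_def pow_ne_def Fpow_def)
  have cl: "\<tau> \<in> ?K t" if "\<sigma> \<in> ?K t" "\<tau> \<subseteq> \<sigma>" "\<tau> \<noteq> {}" for t \<sigma> \<tau>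
  proof -
    have "\<sigma> \<in> pow_ne S" "\<phi> \<sigma> \<le> t" using that by (auto simp: sublevel_def)
    moreover have "\<tau> \<in> pow_ne S" using calculation that
      by (auto simp: pow_ne_def Fpow_def intro: finite_subset)
    moreover have "\<phi> \<tau> \<le> \<phi> \<sigma>" using \<phi> calculation that unfolding filtration_def by blast
    ultimately show ?thesis by (auto simp: sublevel_def)
  qed
  have mono: "?K s \<subseteq> ?K t" if "s \<le> t" for s t using that by (auto simp: sublevel_def)
  have cy: "cycles k (?K s) \<subseteq> (cycles k (?K t) :: ('a list \<Rightarrow> 'f) set)" if "s \<le> t" for s t
    by (rule cycles_mono[OF mono[OF that]])
  have car: "carrier (?H t) = (\<lambda>z. ?Q t +>\<^bsub>?C t\<^esub> z) ` cycles k (?K t)" for t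
    by (auto simp: homology_def quotient_space_def A_RCOSETS_def' cycle_space_def)
  have map: "homology_map k (?K t) (?Q s +>\<^bsub>?C s\<^esub> z) = ?Q t +>\<^bsub>?C t\<^esub> z"
    if "s \<le> t" "z \<in> cycles k (?K s)" for s t z
    by (rule homology_map_coset[OF fin cl cl mono[OF that(1)] that(2)])
  have M: "Module.module field_ring (?C t)" for t by (rule module_cycle_space[OF fin])
  have N: "abelian_subgroup (?Q t) (?C t)" for t
    by (rule abelian_subgroupI3)
      (use boundaries_sub[OF fin cl] M[THEN Module.module.axioms(2)] in auto)
  have op: "carrier (?C t) = cycles k (?K t)" "z \<oplus>\<^bsub>?C t\<^esub> y = (\<lambda>vs. z vs + y vs)"
    "r \<odot>\<^bsub>?C t\<^esub> z = (\<lambda>vs. r * z vs)" for t z y r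
    by (simp_all add: cycle_space_def)
  have bs: "additive_subgroup (?Q t) (?C t)" "x \<in> ?Q t \<Longrightarrow> r \<odot>\<^bsub>?C t\<^esub> x \<in> ?Q t" for t r x
    by (rule boundaries_sub[OF fin cl]; assumption)+
  have sm: "r \<odot>\<^bsub>?H t\<^esub> (?Q t +>\<^bsub>?C t\<^esub> z) = ?Q t +>\<^bsub>?C t\<^esub> (\<lambda>vs. r * z vs)"
    if "z \<in> cycles k (?K t)" for r t z
    unfolding homology_def
    by (rule module_quotient_space(2)[OF M[of t] bs(1)[of t] bs(2)[where t=t], unfolded op, where x = z and r = r]) (rule that | assumption)+
  have ad: "(?Q t +>\<^bsub>?C t\<^esub> z) \<oplus>\<^bsub>?H t\<^esub> (?Q t +>\<^bsub>?C t\<^esub> y) = ?Q t +>\<^bsub>?C t\<^esub> (\<lambda>vs. z vs + y vs)"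
    if "z \<in> cycles k (?K t)" "y \<in> cycles k (?K t)" for t y z
    using abelian_subgroup.a_rcos_sum[OF N[of t], unfolded op, OF that]
    by (simp add: homology_def quotient_space_def)
  have cl_ad: "(\<lambda>vs. z vs + y vs) \<in> cycles k (?K t)" 
    if "z \<in> cycles k (?K t)" "y \<in> cycles k (?K t)" for t and y z :: "'a list \<Rightarrow> 'f"
    using abelian_group.axioms(1)[OF M[of t, THEN Module.module.axioms(2)], THEN abelian_monoid.a_closed, unfolded op, OF that] .
  have cl_sm: "(\<lambda>vs. r * z vs) \<in> cycles k (?K t)" 
    if "z \<in> cycles k (?K t)" for t r and z :: "'a list \<Rightarrow> 'f"
    using Module.module.smult_closed[OF M[of t], where x = z and a = r, unfolded op] that
    by (simp add: field_ring_def)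
  have lin: "homology_map k (?K t) \<in> linear_maps (?H s) (?H t)" if st: "s \<le> t" for s t
    unfolding linear_maps_def
  proof (intro CollectI conjI ballI allI Pi_I)
    fix A assume "A \<in> carrier (?H s)"
    then obtain z where z: "z \<in> cycles k (?K s)" "A = ?Q s +>\<^bsub>?C s\<^esub> z" unfolding car by blast
    have z': "z \<in> cycles k (?K t)" using cy[OF st] z(1) by blast
    show "homology_map k (?K t) A \<in> carrier (?H t)"
      unfolding car z(2) map[OF st z(1)] using z' by blast
    show "homology_map k (?K t) (r \<odot>\<^bsub>?H s\<^esub> A) = r \<odot>\<^bsub>?H t\<^esub> homology_map k (?K t) A" for r
      unfolding z(2) sm[OF z(1)] map[OF st z(1)] map[OF st cl_sm[OF z(1)]] sm[OF z'] ..
    fix B assume "B \<in> carrier (?H s)"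
    then obtain y where y: "y \<in> cycles k (?K s)" "B = ?Q s +>\<^bsub>?C s\<^esub> y" unfolding car by blast
    have y': "y \<in> cycles k (?K t)" using cy[OF st] y(1) by blast
    show "homology_map k (?K t) (A \<oplus>\<^bsub>?H s\<^esub> B) =
        homology_map k (?K t) A \<oplus>\<^bsub>?H t\<^esub> homology_map k (?K t) B"
      unfolding z(2) y(2) ad[OF z(1) y(1)] map[OF st z(1)] map[OF st y(1)]
        map[OF st cl_ad[OF z(1) y(1)]] ad[OF z' y'] ..
  qed
  have id: "homology_map k (?K t) x = x" if "x \<in> carrier (?H t)" for t x
    using that map[OF order_refl] unfolding car by blast
  have comp: "homology_map k (?K t) (homology_map k (?K s) x) = homology_map k (?K t) x"
    if rst: "r \<le> s" "s \<le> t" "x \<in> carrier (?H r)" for r s t x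
  proof -
    obtain z where z: "z \<in> cycles k (?K r)" "x = ?Q r +>\<^bsub>?C r\<^esub> z"
      using rst(3) unfolding car by blast
    moreover have "z \<in> cycles k (?K s)" using z(1) cy[OF rst(1)] by auto
    ultimately show ?thesis using rst by (simp only: map order_trans[OF rst(1,2)])
  qed
  show ?thesis
  proof (rule persistent_vector_space.intro)
    show "Module.module field_ring (?H t)" for t
      by (rule module_homology[OF fin cl])
  qed (rule lin id comp, assumption+)+
qed

end

theory Submission
  imports Defs
begin

text \<open>
  Pull both filtrations back to an optimal correspondence \<open>R\<close> between \<open>X\<close> and \<open>Y\<close>. The pullbacks
  differ by at most \<open>L\<close> times the distortion of \<open>R\<close>, because the curvature sets of the two
  projections of a subset of \<open>R\<close> are that close in the Hausdorff distance. A pullback has the same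
  barcode as the original filtration: points of \<open>R\<close> with the same projection dominate each other and
  can be removed one at a time.

  On a fixed vertex set, stability follows Cohen-Steiner, Edelsbrunner and Harer. For a total
  order of the simplices, reduction of the boundary matrix pairs each negative simplex \<open>\<tau>\<close> with a
  positive simplex \<open>\<sigma>\<close>, and every filtration \<open>\<phi>\<close> compatible with the order has the bars
  \<open>(\<phi> \<sigma>, \<phi> \<tau>)\<close>. Filtrations compatible with a common order thus have matching bars, and
  the segment joining two arbitrary filtrations is a finite chain of such pairs.
\<close>

section \<open>Oriented chains\<close>

text \<open>The factor 2 undoes the one half in the Gromov-Hausdorff distance, since the pullbacks
  are compared through the distortion itself. \<open>barcode\<close> is a definite description, so a
  barcode is computed by exhibiting a decomposition and knowing that decompositions are unique;
  uniqueness comes from counting the bars that contain two given parameters, which is a rank. A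
  filtration and its pullback have vertices of different types, so they are compared through
  coordinates on cycles with values in one common interval sum instead of through an isomorphism of
  homology. Chaining short steps along the segment needs a triangle inequality; it is proved for
  bijections of bars padded by empty bars, which compose, and only the end result is turned into a
  partial matching. Short steps have a common order because strict inequalities between filtration
  values survive a small change of the parameter, while ties may be broken either way.\<close>

lemma boundary_eq_sum:
  fixes c :: "'a list \<Rightarrow> 'f::field"
  assumes "finite S" "\<And>v vs. c (v # vs) \<noteq> 0 \<Longrightarrow> v \<in> S"
  shows "boundary c vs = (if vs = [] then 0 else \<Sum>v\<in>S. c (v # vs))"
proof -
  have "(\<Sum>v | c (v # vs) \<noteq> 0. c (v # vs)) = (\<Sum>v\<in>S. c (v # vs))"
    by (intro sum.mono_neutral_left assms(1)) (use assms(2) in auto)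
  then show ?thesis unfolding boundary_def by simp
qed

lemma chains_vertex:
  "c \<in> chains k K \<Longrightarrow> c (v # vs) \<noteq> 0 \<Longrightarrow> v \<in> \<Union>K"
  using chains_supp[of c k K "v # vs"] by auto

text \<open>The degree \<open>n i\<close> may vary with \<open>i\<close>, because the normal form
  expands functions over simplices of all dimensions at once.\<close>

lemma boundary_linear_combination:
  fixes a :: "'i \<Rightarrow> 'f::field"
  assumes fin: "finite (\<Union>K)" and f: "\<And>i. i \<in> I \<Longrightarrow> f i \<in> chains (n i) K"
  shows "boundary (\<lambda>vs. \<Sum>i\<in>I. a i * f i vs) = (\<lambda>vs. \<Sum>i\<in>I. a i * boundary (f i) vs)"
proof
  fix vs
  have "v \<in> \<Union>K" if nz: "(\<Sum>i\<in>I. a i * f i (v # ws)) \<noteq> 0" for v ws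
  proof -
    obtain i where "i \<in> I" "a i * f i (v # ws) \<noteq> 0"
      using sum.not_neutral_contains_not_neutral[OF nz] by blast
    then have "i \<in> I" "f i (v # ws) \<noteq> 0" by auto
    then show ?thesis using f chains_vertex by metis
  qed
  then have "boundary (\<lambda>vs. \<Sum>i\<in>I. a i * f i vs) vs =
      (if vs = [] then 0 else \<Sum>v\<in>\<Union>K. \<Sum>i\<in>I. a i * f i (v # vs))"
    by (intro boundary_eq_sum fin) auto
  also have "\<dots> = (if vs = [] then 0 else \<Sum>i\<in>I. a i * (\<Sum>v\<in>\<Union>K. f i (v # vs)))"
    by (simp add: sum_distrib_left sum.swap[of _ I])
  also have "\<dots> = (\<Sum>i\<in>I. a i * boundary (f i) vs)"
    by (auto intro!: sum.cong simp: boundary_alt[OF f fin order_refl])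
  finally show "boundary (\<lambda>vs. \<Sum>i\<in>I. a i * f i vs) vs = (\<Sum>i\<in>I. a i * boundary (f i) vs)" .
qed

lemma boundary_add_smult:
  fixes r :: "'f::field"
  assumes fin: "finite (\<Union>K)" and c: "c \<in> chains m K" "c' \<in> chains n K"
  shows "boundary (\<lambda>vs. c vs + r * c' vs) = (\<lambda>vs. boundary c vs + r * boundary c' vs)"
  using boundary_linear_combination[OF fin, where I = "UNIV :: bool set"
      and f = "\<lambda>i. if i then c' else c" and a = "\<lambda>i. if i then r else 1"
      and n = "\<lambda>i. if i then n else m"] c
  by (simp add: UNIV_bool)

lemma chains_linear_combination:
  fixes a :: "'i \<Rightarrow> 'f::field"
  assumes "\<And>i. i \<in> I \<Longrightarrow> a i \<noteq> 0 \<Longrightarrow> f i \<in> chains k K"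
  shows "(\<lambda>vs. \<Sum>i\<in>I. a i * f i vs) \<in> chains k K"
proof (rule chainsI)
  fix vs assume "(\<Sum>i\<in>I. a i * f i vs) \<noteq> 0"
  then obtain i where "i \<in> I" "a i * f i vs \<noteq> 0"
    by (rule sum.not_neutral_contains_not_neutral)
  then have "i \<in> I" "a i \<noteq> 0" "f i vs \<noteq> 0" by auto
  then show "distinct vs \<and> length vs = Suc k \<and> set vs \<in> K"
    using chains_supp assms by metis
next
  fix vs :: "'a list" and p assume p: "p permutes {..<length vs}"
  have "a i * f i (permute_list p vs) = of_int (sign p) * (a i * f i vs)" if "i \<in> I" for i
    using chains_perm[OF assms[OF that] p] by (cases "a i = 0") (auto simp: ac_simps)
  from sum.cong[OF refl this] show "(\<Sum>i\<in>I. a i * f i (permute_list p vs)) = of_int (sign p) * (\<Sum>i\<in>I. a i * f i vs)"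
    by (simp add: sum_distrib_left)
qed

lemma chains_add_smult:
  fixes r :: "'f::field"
  assumes "c \<in> chains k K" "c' \<in> chains k K"
  shows "(\<lambda>vs. c vs + r * c' vs) \<in> chains k K"
  using chains_lin(1)[OF assms(1) chains_lin(2)[OF assms(2) assms(2)]] .

lemma chains_restrict:
  assumes "c \<in> chains k K" "\<And>vs. c vs \<noteq> 0 \<Longrightarrow> set vs \<in> K'"
  shows "c \<in> chains k K'"
  by (rule chainsI) (use assms chains_supp chains_perm in blast)+

section \<open>Values on one ordering, and chains of a single simplex\<close>

lemma distinct_permutation:
  assumes "distinct vs" "distinct ws" "set vs = set ws"
  obtains p where "p permutes {..<length vs}" "permute_list p vs = ws"
  using assms mset_eq_permutation[of ws vs] set_eq_iff_mset_eq_distinct by metis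

lemma chains_eq_0_permuted:
  assumes c: "c \<in> chains k K" and "distinct vs" "set vs = set ws" "c vs = 0"
  shows "c ws = 0"
proof (rule ccontr)
  assume "c ws \<noteq> 0"
  then have "distinct ws" using chains_supp[OF c] by blast
  then obtain p where "p permutes {..<length vs}" "permute_list p vs = ws"
    using distinct_permutation assms by metis
  then show False using chains_perm[OF c] \<open>c ws \<noteq> 0\<close> \<open>c vs = 0\<close> by force
qed

text \<open>A reference ordering of the simplex. Chains alternate, so the value there serves as the
  coefficient of the simplex; another choice changes it only by a sign.\<close>

definition simplex_list :: "'a set \<Rightarrow> 'a list" where
  "simplex_list \<sigma> = (SOME vs. distinct vs \<and> set vs = \<sigma>)"

lemma simplex_list:
  assumes "finite \<sigma>"
  shows "distinct (simplex_list \<sigma>)" "set (simplex_list \<sigma>) = \<sigma>" "length (simplex_list \<sigma>) = card \<sigma>"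
proof -
  have "\<exists>vs. distinct vs \<and> set vs = \<sigma>" using finite_distinct_list[OF assms] by blast
  from someI_ex[OF this]
  show "distinct (simplex_list \<sigma>)" "set (simplex_list \<sigma>) = \<sigma>"
    unfolding simplex_list_def by auto
  then show "length (simplex_list \<sigma>) = card \<sigma>" using distinct_card by metis
qed

text \<open>The sign belongs to the permutation that carries \<open>vs\<close> to \<open>ws\<close>.
  It is unique when \<open>vs\<close> is distinct (\<open>permute_list_inj\<close>), the case in
  which the definition is used.\<close>

definition oriented_simplex :: "'a list \<Rightarrow> 'a list \<Rightarrow> 'f::field" where
  "oriented_simplex vs ws =
     (if mset ws = mset vs
      then of_int (sign (THE p. p permutes {..<length vs} \<and> permute_list p vs = ws)) else 0)"

lemma permute_list_inj:
  assumes "distinct vs" "p permutes {..<length vs}" "q permutes {..<length vs}"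
    and "permute_list p vs = permute_list q vs"
  shows "p = q"
proof
  fix i
  show "p i = q i"
  proof (cases "i < length vs")
    case True
    then have "vs ! p i = vs ! q i"
      using assms permute_list_nth by metis
    moreover have "p i < length vs" "q i < length vs"
      using True assms(2,3) permutes_in_image by fastforce+
    ultimately show ?thesis using assms(1) nth_eq_iff_index_eq by blast
  next
    case False
    then have "i \<notin> {..<length vs}" by simp
    then show ?thesis using assms(2,3) permutes_not_in by metis
  qed
qed

lemma oriented_simplex_permute:
  assumes "distinct vs" "p permutes {..<length vs}"
  shows "oriented_simplex vs (permute_list p vs) = of_int (sign p)"
proof -
  have "(THE q. q permutes {..<length vs} \<and> permute_list q vs = permute_list p vs) = p"
    using assms permute_list_inj by (intro the_equality) blast+
  then show ?thesis using assms by (simp add: oriented_simplex_def)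
qed

lemma oriented_simplex_self: "distinct vs \<Longrightarrow> oriented_simplex vs vs = 1"
  using oriented_simplex_permute[of vs id] by (simp add: permutes_id sign_id)

lemma oriented_simplex_chains:
  assumes "distinct vs" "length vs = Suc k" "set vs \<in> K"
  shows "(oriented_simplex vs :: 'a list \<Rightarrow> 'f::field) \<in> chains k K"
proof (rule chainsI)
  fix ws assume "(oriented_simplex vs ws :: 'f) \<noteq> 0"
  then have "mset ws = mset vs" by (auto simp: oriented_simplex_def split: if_splits)
  then show "distinct ws \<and> length ws = Suc k \<and> set ws \<in> K"
    using assms by (metis mset_eq_imp_distinct_iff mset_eq_length mset_eq_setD)
next
  fix ws q assume q: "q permutes {..<length (ws :: 'a list)}"
  show "(oriented_simplex vs (permute_list q ws) :: 'f) = of_int (sign q) * oriented_simplex vs ws"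
  proof (cases "mset ws = mset vs")
    case True
    then obtain p where p: "p permutes {..<length vs}" "permute_list p vs = ws"
      using mset_eq_permutation by metis
    have q': "q permutes {..<length vs}" using q True mset_eq_length by metis
    have "permute_list q ws = permute_list (p \<circ> q) vs"
      using p q' permute_list_compose by metis
    moreover have "p \<circ> q permutes {..<length vs}" using p q' by (simp add: permutes_compose)
    moreover have "sign (p \<circ> q) = sign p * sign q"
      using p q' by (intro sign_compose) (auto intro: permutes_imp_permutation)
    ultimately show ?thesis
      using assms p oriented_simplex_permute[of vs "p \<circ> q", where 'b = 'f]
        oriented_simplex_permute[of vs p, where 'b = 'f]
      by (simp add: ac_simps)
  next
    case False
    then show ?thesis using q by (simp add: oriented_simplex_def)
  qed
qed

section \<open>Normal form of the boundary operator\<close>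

text \<open>The leading coefficient is merely nonzero: column reduction replaces some
  \<open>c \<sigma>\<close> by a boundary, whose leading coefficient is not normalised. The
  difference \<open>card \<sigma> - 1\<close> is the dimension of a non-empty simplex.\<close>

definition triangular :: "('a set \<Rightarrow> nat) \<Rightarrow> 'a set set \<Rightarrow> ('a set \<Rightarrow> 'a list \<Rightarrow> 'f::field) \<Rightarrow> bool" where
  "triangular r K c \<longleftrightarrow>
     (\<forall>\<sigma>\<in>K. c \<sigma> \<in> chains (card \<sigma> - 1) {\<tau>\<in>K. r \<tau> \<le> r \<sigma>} \<and> c \<sigma> (simplex_list \<sigma>) \<noteq> 0)"

text \<open>The sublevel complexes of every filtration compatible with \<open>r\<close> are of this
  kind, so a result on initial segments serves all of these filtrations at once.\<close>

definition initial_segment :: "('a set \<Rightarrow> nat) \<Rightarrow> 'a set set \<Rightarrow> 'a set set \<Rightarrow> bool" where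
  "initial_segment r K T \<longleftrightarrow> T \<subseteq> K \<and> (\<forall>\<sigma>\<in>T. \<forall>\<tau>\<in>K. r \<tau> \<le> r \<sigma> \<longrightarrow> \<tau> \<in> T)"

definition simplices :: "'a set set \<Rightarrow> bool" where
  "simplices K \<longleftrightarrow> finite K \<and> (\<forall>\<sigma>\<in>K. finite \<sigma> \<and> \<sigma> \<noteq> {})"

lemma simplices_subset: "simplices K \<Longrightarrow> T \<subseteq> K \<Longrightarrow> simplices T"
  unfolding simplices_def by (meson finite_subset subset_iff)

lemma simplices_finite_vertices: "simplices K \<Longrightarrow> finite (\<Union>K)"
  unfolding simplices_def by auto

lemma triangular_chains:
  assumes "triangular r K c" "\<sigma> \<in> K"
  shows "c \<sigma> \<in> chains (card \<sigma> - 1) K"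
  using assms chains_mono[of "{\<tau>\<in>K. r \<tau> \<le> r \<sigma>}" K "card \<sigma> - 1"]
  unfolding triangular_def by blast

lemma triangular_eq_0:
  assumes "simplices K" "triangular r K c" "\<sigma> \<in> K" "\<tau> \<in> K" "r \<sigma> < r \<tau>"
  shows "c \<sigma> (simplex_list \<tau>) = 0"
proof (rule ccontr)
  assume "c \<sigma> (simplex_list \<tau>) \<noteq> 0"
  moreover have "c \<sigma> \<in> chains (card \<sigma> - 1) {\<tau>\<in>K. r \<tau> \<le> r \<sigma>}"
    using assms unfolding triangular_def by blast
  moreover have "set (simplex_list \<tau>) = \<tau>"
    using assms simplex_list unfolding simplices_def by blast
  ultimately show False using assms chains_supp by fastforce
qed

lemma triangular_chains_segment:
  assumes "triangular r K c" "initial_segment r K T" "\<sigma> \<in> T"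
  shows "c \<sigma> \<in> chains (card \<sigma> - 1) T"
proof -
  have "{\<tau>\<in>K. r \<tau> \<le> r \<sigma>} \<subseteq> T" "\<sigma> \<in> K"
    using assms unfolding initial_segment_def by auto
  then show ?thesis
    using assms(1) chains_mono[of "{\<tau>\<in>K. r \<tau> \<le> r \<sigma>}" T "card \<sigma> - 1"]
    unfolding triangular_def by blast
qed

text \<open>Elimination from the top: a multiple of \<open>c \<sigma>\<close> for the latest simplex
  \<sigma> of \<open>T\<close> removes \<sigma> from \<open>x\<close>, and the rest lives on a
  smaller initial segment. Thus one basis restricts to a basis of the chains of every initial
  segment. The sum still runs over all of \<open>K\<close>, so that coefficients for different
  segments are comparable.\<close>

lemma triangular_span:
  fixes c :: "'a set \<Rightarrow> 'a list \<Rightarrow> 'f::field"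
  assumes K: "simplices K" "inj_on r K" "triangular r K c"
    and T: "initial_segment r K T" "x \<in> chains k T"
  shows "\<exists>a. (\<forall>\<sigma>. a \<sigma> \<noteq> 0 \<longrightarrow> \<sigma> \<in> T \<and> card \<sigma> = Suc k) \<and> x = (\<lambda>vs. \<Sum>\<sigma>\<in>K. a \<sigma> * c \<sigma> vs)"
proof -
  have finK: "finite K" using K(1) by (simp add: simplices_def)
  have "finite T" using T finK by (auto simp: initial_segment_def intro: finite_subset)
  then show ?thesis using T
  proof (induction T arbitrary: x rule: finite_ranking_induct[where f = r])
    case empty
    then have "x = (\<lambda>_. 0)" using chains_supp by fastforce
    then show ?case by (intro exI[of _ "\<lambda>_. 0"]) simp
  next
    case (insert \<sigma> T)
    show ?case
    proof (cases "\<sigma> \<in> T")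
      case True
      then show ?thesis using insert.IH insert.prems by (simp add: insert_absorb)
    next
      case \<sigma>T: False
      have \<sigma>: "\<sigma> \<in> K" "finite \<sigma>" and finT: "finite T"
        using insert K(1) by (auto simp: initial_segment_def simplices_def)
      note l = simplex_list[OF \<sigma>(2)]
      have seg: "initial_segment r K T"
        unfolding initial_segment_def
      proof (intro conjI ballI impI)
        show "T \<subseteq> K" using insert.prems by (auto simp: initial_segment_def)
        fix \<tau> \<rho> assume *: "\<tau> \<in> T" "\<rho> \<in> K" "r \<rho> \<le> r \<tau>"
        have "\<rho> \<noteq> \<sigma>"
        proof
          assume "\<rho> = \<sigma>"
          then have "r \<tau> = r \<sigma>" using * insert(2) by force
          then have "\<tau> = \<sigma>" using K(2) \<open>T \<subseteq> K\<close> * \<sigma> by (metis inj_onD subsetD)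
          then show False using * \<sigma>T by simp
        qed
        then show "\<rho> \<in> T" using * insert.prems by (auto simp: initial_segment_def)
      qed
      have supp: "y \<in> chains k T" if "y \<in> chains k (insert \<sigma> T)" "y (simplex_list \<sigma>) = 0" for y :: "'a list \<Rightarrow> 'f"
      proof (rule chains_restrict[OF that(1)])
        fix vs assume "y vs \<noteq> 0"
        then have "set vs \<in> insert \<sigma> T" using chains_supp[OF that(1)] by blast
        moreover have "set vs \<noteq> \<sigma>"
          using chains_eq_0_permuted[OF that(1) l(1) _ that(2), of vs] \<open>y vs \<noteq> 0\<close> l(2) by auto
        ultimately show "set vs \<in> T" by simp
      qed
      show ?thesis
      proof (cases "card \<sigma> = Suc k")
        case False
        then have "x (simplex_list \<sigma>) = 0" using chains_supp[OF insert.prems(2)] l(3) by metis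
        then show ?thesis using insert.IH[OF seg supp[OF insert.prems(2)]] by blast
      next
        case True
        let ?b = "x (simplex_list \<sigma>) / c \<sigma> (simplex_list \<sigma>)"
        let ?y = "\<lambda>vs. x vs + - ?b * c \<sigma> vs"
        have "c \<sigma> (simplex_list \<sigma>) \<noteq> 0" using K(3) \<sigma> unfolding triangular_def by blast
        moreover have "c \<sigma> \<in> chains k (insert \<sigma> T)"
          using triangular_chains_segment[OF K(3) insert.prems(1), of \<sigma>] True by simp
        ultimately have "?y \<in> chains k T"
          by (intro supp chains_add_smult insert.prems(2)) auto
        from insert.IH[OF seg this] obtain a where
          a: "\<And>\<sigma>. a \<sigma> \<noteq> 0 \<Longrightarrow> \<sigma> \<in> T \<and> card \<sigma> = Suc k" "?y = (\<lambda>vs. \<Sum>\<sigma>\<in>K. a \<sigma> * c \<sigma> vs)" by blast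
        have "a \<sigma> = 0" using a(1) \<sigma>T by blast
        let ?a = "a(\<sigma> := ?b)"
        have "x vs = (\<Sum>\<sigma>\<in>K. ?a \<sigma> * c \<sigma> vs)" for vs
        proof -
          have "(\<Sum>\<sigma>\<in>K. ?a \<sigma> * c \<sigma> vs) = ?b * c \<sigma> vs + (\<Sum>\<sigma>\<in>K. a \<sigma> * c \<sigma> vs)"
            using \<sigma> finK \<open>a \<sigma> = 0\<close> by (simp add: sum.remove[of K \<sigma>])
          moreover have "?y vs = (\<Sum>\<sigma>\<in>K. a \<sigma> * c \<sigma> vs)" by (rule fun_cong[OF a(2)])
          ultimately show ?thesis by (simp add: algebra_simps)
        qed
        then have "x = (\<lambda>vs. \<Sum>\<sigma>\<in>K. ?a \<sigma> * c \<sigma> vs)" by (rule ext)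
        moreover have "\<forall>\<rho>. ?a \<rho> \<noteq> 0 \<longrightarrow> \<rho> \<in> insert \<sigma> T \<and> card \<rho> = Suc k" using a(1) True by auto
        ultimately show ?thesis by blast
      qed
    qed
  qed
qed

text \<open>Evaluate at the latest simplex with a nonzero coefficient: basis chains of earlier
  simplices vanish there, its own does not.\<close>

lemma triangular_independent:
  fixes c :: "'a set \<Rightarrow> 'a list \<Rightarrow> 'f::field"
  assumes K: "simplices K" "inj_on r K" "triangular r K c"
    and 0: "\<And>vs. (\<Sum>\<sigma>\<in>K. a \<sigma> * c \<sigma> vs) = 0" and "\<sigma> \<in> K"
  shows "a \<sigma> = 0"
proof (rule ccontr)
  assume "a \<sigma> \<noteq> 0"
  let ?A = "{\<sigma>\<in>K. a \<sigma> \<noteq> 0}"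
  have fin: "finite ?A" "finite K" "?A \<noteq> {}"
    using K(1) \<open>\<sigma> \<in> K\<close> \<open>a \<sigma> \<noteq> 0\<close> by (auto simp: simplices_def)
  then obtain \<tau> where \<tau>: "\<tau> \<in> ?A" "r \<tau> = Max (r ` ?A)"
    by (metis (no_types, lifting) Max_in finite_imageI image_iff image_is_empty)
  have "a \<rho> * c \<rho> (simplex_list \<tau>) = 0" if "\<rho> \<in> K - {\<tau>}" for \<rho>
  proof (cases "a \<rho> = 0")
    case False
    then have "r \<rho> \<le> r \<tau>" using \<tau> that fin by simp
    moreover have "r \<rho> \<noteq> r \<tau>" using inj_onD[OF K(2), of \<rho> \<tau>] that \<tau>(1) by blast
    ultimately show ?thesis using triangular_eq_0[OF K(1,3)] that \<tau> by auto
  qed simp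
  then have "(\<Sum>\<rho>\<in>K - {\<tau>}. a \<rho> * c \<rho> (simplex_list \<tau>)) = 0"
    by (intro sum.neutral ballI)
  then have "(\<Sum>\<sigma>\<in>K. a \<sigma> * c \<sigma> (simplex_list \<tau>)) = a \<tau> * c \<tau> (simplex_list \<tau>)"
    using \<tau> fin by (simp add: sum.remove[of K \<tau>])
  then have "a \<tau> * c \<tau> (simplex_list \<tau>) = 0" using 0 by simp
  then show False using \<tau> K(3) unfolding triangular_def by auto
qed

text \<open>
  A basis of the chains adapted to the order \<open>r\<close> in which the simplices appear: the basis chain
  \<open>c \<sigma>\<close> has leading simplex \<open>\<sigma>\<close>, and the boundary of \<open>c \<tau>\<close> is either zero or the basis chain
  \<open>c (b \<tau>)\<close>. Homologically, \<open>\<tau>\<close> kills the class born with \<open>b \<tau>\<close>.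
\<close>

definition normal_form ::
    "('a set \<Rightarrow> nat) \<Rightarrow> 'a set set \<Rightarrow> ('a set \<Rightarrow> 'a list \<Rightarrow> 'f::field) \<Rightarrow> ('a set \<Rightarrow> 'a set option) \<Rightarrow> bool" where
  "normal_form r K c b \<longleftrightarrow> triangular r K c \<and>
     (\<forall>\<tau>\<in>K. boundary (c \<tau>) = (case b \<tau> of None \<Rightarrow> (\<lambda>_. 0) | Some \<sigma> \<Rightarrow> c \<sigma>)) \<and>
     (\<forall>\<tau>\<in>K. \<forall>\<sigma>. b \<tau> = Some \<sigma> \<longrightarrow> \<sigma> \<in> K \<and> r \<sigma> < r \<tau> \<and> card \<tau> = Suc (card \<sigma>)) \<and>
     (\<forall>\<tau>\<in>K. \<forall>\<tau>'\<in>K. b \<tau> \<noteq> None \<longrightarrow> b \<tau> = b \<tau>' \<longrightarrow> \<tau> = \<tau>')"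

lemma normal_form_triangular: "normal_form r K c b \<Longrightarrow> triangular r K c"
  unfolding normal_form_def by blast

lemma normal_form_None:
  "normal_form r K c b \<Longrightarrow> \<tau> \<in> K \<Longrightarrow> b \<tau> = None \<Longrightarrow> boundary (c \<tau>) = (\<lambda>_. 0)"
  unfolding normal_form_def by (metis option.simps(4))

lemma normal_form_Some:
  assumes "normal_form r K c b" "\<tau> \<in> K" "b \<tau> = Some \<sigma>"
  shows "boundary (c \<tau>) = c \<sigma>" "\<sigma> \<in> K" "r \<sigma> < r \<tau>" "card \<tau> = Suc (card \<sigma>)"
  using assms unfolding normal_form_def by (metis option.simps(5), blast+)

lemma normal_form_inj:
  assumes "normal_form r K c b" "\<tau> \<in> K" "\<tau>' \<in> K" "b \<tau> = Some \<sigma>" "b \<tau>' = Some \<sigma>"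
  shows "\<tau> = \<tau>'"
  using assms unfolding normal_form_def by (metis option.distinct(1))

definition killed :: "'a set set \<Rightarrow> ('a set \<Rightarrow> 'a set option) \<Rightarrow> 'a set \<Rightarrow> bool" where
  "killed K b \<sigma> \<longleftrightarrow> (\<exists>\<tau>\<in>K. b \<tau> = Some \<sigma>)"

text \<open>Meaningful only under \<open>killed K b \<sigma>\<close>, where injectivity of
  \<open>b\<close> makes it unique; formulas that use it are guarded by that condition.\<close>

definition killer :: "'a set set \<Rightarrow> ('a set \<Rightarrow> 'a set option) \<Rightarrow> 'a set \<Rightarrow> 'a set" where
  "killer K b \<sigma> = (THE \<tau>. \<tau> \<in> K \<and> b \<tau> = Some \<sigma>)"

lemma killer_eq:
  assumes "normal_form r K c b" "\<tau> \<in> K" "b \<tau> = Some \<sigma>"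
  shows "killer K b \<sigma> = \<tau>"
  unfolding killer_def
proof (rule the_equality)
  fix \<tau>' assume "\<tau>' \<in> K \<and> b \<tau>' = Some \<sigma>"
  with assms show "\<tau>' = \<tau>" using normal_form_inj by metis
qed (use assms in simp)

text \<open>In the basis \<open>c\<close> the boundary is the matrix of the partial injection
  \<open>b\<close>: each row and column has at most one nonzero entry, and that entry is 1. So the
  coefficient of a killer simply moves to the simplex that it kills.\<close>

lemma boundary_normal_form:
  fixes c :: "'a set \<Rightarrow> 'a list \<Rightarrow> 'f::field"
  assumes K: "simplices K" and nf: "normal_form r K c b"
  shows "boundary (\<lambda>vs. \<Sum>\<tau>\<in>K. a \<tau> * c \<tau> vs) =
    (\<lambda>vs. \<Sum>\<sigma>\<in>K. (if killed K b \<sigma> then a (killer K b \<sigma>) else 0) * c \<sigma> vs)"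
proof
  fix vs
  have fin: "finite K" "finite (\<Union>K)" using K simplices_finite_vertices by (auto simp: simplices_def)
  have tri: "triangular r K c" by (rule normal_form_triangular[OF nf])
  let ?P = "{\<tau>\<in>K. b \<tau> \<noteq> None}" and ?Q = "{\<sigma>\<in>K. killed K b \<sigma>}"
  have "boundary (\<lambda>vs. \<Sum>\<tau>\<in>K. a \<tau> * c \<tau> vs) vs = (\<Sum>\<tau>\<in>K. a \<tau> * boundary (c \<tau>) vs)"
    by (subst boundary_linear_combination[OF fin(2) triangular_chains[OF tri]]) auto
  also have "\<dots> = (\<Sum>\<tau>\<in>?P. a \<tau> * boundary (c \<tau>) vs)"
    using normal_form_None[OF nf] fin(1) by (intro sum.mono_neutral_right) auto
  also have "\<dots> = (\<Sum>\<sigma>\<in>?Q. a (killer K b \<sigma>) * c \<sigma> vs)"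
  proof (rule sum.reindex_bij_witness[of _ "killer K b" "\<lambda>\<tau>. the (b \<tau>)"])
    fix \<sigma> assume "\<sigma> \<in> ?Q"
    then obtain \<tau> where \<tau>: "\<tau> \<in> K" "b \<tau> = Some \<sigma>" by (auto simp: killed_def)
    with killer_eq[OF nf this] show "the (b (killer K b \<sigma>)) = \<sigma>" "killer K b \<sigma> \<in> ?P" by auto
  next
    fix \<tau> assume "\<tau> \<in> ?P"
    then obtain \<sigma> where \<tau>: "\<tau> \<in> K" "b \<tau> = Some \<sigma>" by auto
    moreover have "\<sigma> \<in> K" "boundary (c \<tau>) = c \<sigma>" using normal_form_Some[OF nf \<tau>] by auto
    ultimately show "killer K b (the (b \<tau>)) = \<tau>" "the (b \<tau>) \<in> ?Q"
      "a (killer K b (the (b \<tau>))) * c (the (b \<tau>)) vs = a \<tau> * boundary (c \<tau>) vs"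
      using killer_eq[OF nf \<tau>] by (auto simp: killed_def)
  qed
  also have "\<dots> = (\<Sum>\<sigma>\<in>K. (if killed K b \<sigma> then a (killer K b \<sigma>) else 0) * c \<sigma> vs)"
    using fin(1) by (intro sum.mono_neutral_cong_left) auto
  finally show "boundary (\<lambda>vs. \<Sum>\<tau>\<in>K. a \<tau> * c \<tau> vs) vs =
    (\<Sum>\<sigma>\<in>K. (if killed K b \<sigma> then a (killer K b \<sigma>) else 0) * c \<sigma> vs)" .
qed

text \<open>A coefficient at a killer would reappear in the boundary as the coefficient of the chain
  killed, where independence forces it to be zero. Hence cycles are combinations of those basis
  chains that are cycles themselves.\<close>

lemma normal_form_cycle_coefficient:
  fixes c :: "'a set \<Rightarrow> 'a list \<Rightarrow> 'f::field"
  assumes K: "simplices K" "inj_on r K" and nf: "normal_form r K c b"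
    and 0: "boundary (\<lambda>vs. \<Sum>\<tau>\<in>K. a \<tau> * c \<tau> vs) = (\<lambda>_. 0)" and \<tau>: "\<tau> \<in> K" "b \<tau> \<noteq> None"
  shows "a \<tau> = 0"
proof -
  obtain \<sigma> where \<sigma>: "b \<tau> = Some \<sigma>" using \<tau> by blast
  then have "\<sigma> \<in> K" using normal_form_Some[OF nf \<tau>(1)] by blast
  have "(\<Sum>\<sigma>\<in>K. (if killed K b \<sigma> then a (killer K b \<sigma>) else 0) * c \<sigma> vs) = 0" for vs
    using fun_cong[OF boundary_normal_form[OF K(1) nf, of a], of vs] unfolding 0 by simp
  from triangular_independent[OF K normal_form_triangular[OF nf] this \<open>\<sigma> \<in> K\<close>]
  show ?thesis using \<tau> \<sigma> killer_eq[OF nf \<tau>(1) \<sigma>] by (auto simp: killed_def split: if_splits)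
qed

section \<open>Column reduction of the boundary matrix\<close>

definition complex_order :: "('a set \<Rightarrow> nat) \<Rightarrow> 'a set set \<Rightarrow> bool" where
  "complex_order r K \<longleftrightarrow> simplices K \<and> inj_on r K \<and>
     (\<forall>\<sigma>\<in>K. \<forall>\<tau>. \<tau> \<subset> \<sigma> \<longrightarrow> \<tau> \<noteq> {} \<longrightarrow> \<tau> \<in> K \<and> r \<tau> < r \<sigma>)"

text \<open>One column of the reduction. The boundary of the new simplex \<tau> is a cycle, hence a
  combination of basis cycles. Those already killed are cleared by subtracting their killers from
  the simplex. If nothing is left, the corrected chain \<open>x\<close> is a cycle and \<tau>
  creates a class; otherwise \<tau> kills the latest simplex that is left.\<close>

lemma normal_form_insert:
  fixes c :: "'a set \<Rightarrow> 'a list \<Rightarrow> 'f::field"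
  assumes ord: "complex_order r (insert \<tau> K)" and \<tau>: "\<tau> \<notin> K" and mx: "\<And>\<sigma>. \<sigma> \<in> K \<Longrightarrow> r \<sigma> < r \<tau>"
    and nf: "normal_form r K c b"
  shows "\<exists>(c' :: 'a set \<Rightarrow> 'a list \<Rightarrow> 'f) b'. normal_form r (insert \<tau> K) c' b'"
proof -
  let ?K = "insert \<tau> K"
  have S: "simplices ?K" "inj_on r ?K" "simplices K" "inj_on r K"
    using ord simplices_subset[of ?K K] by (auto simp: complex_order_def)
  have fin: "finite K" "finite (\<Union>?K)" "finite \<tau>" "\<tau> \<noteq> {}"
    using S simplices_finite_vertices[OF S(1)] by (auto simp: simplices_def)
  have cl: "\<rho> \<in> ?K" if "\<sigma> \<in> ?K" "\<rho> \<subseteq> \<sigma>" "\<rho> \<noteq> {}" for \<rho> \<sigma>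
    using ord that unfolding complex_order_def by (metis psubsetI)
  have tri: "triangular r K c" by (rule normal_form_triangular[OF nf])
  have same: "{\<rho>\<in>?K. r \<rho> \<le> r \<sigma>} = {\<rho>\<in>K. r \<rho> \<le> r \<sigma>}" if "\<sigma> \<in> K" for \<sigma>
    using mx[OF that] by auto
  have top: "{\<rho>\<in>?K. r \<rho> \<le> r \<tau>} = ?K" using mx by (auto intro: less_imp_le)
  note l = simplex_list[OF fin(3)]
  let ?m = "card \<tau> - 1"
  have m: "card \<tau> = Suc ?m" using fin(3,4) card_gt_0_iff[of \<tau>] by simp
  let ?e = "oriented_simplex (simplex_list \<tau>) :: 'a list \<Rightarrow> 'f"
  have e: "?e \<in> chains ?m ?K" "?e (simplex_list \<tau>) = 1"
    using l m by (auto intro!: oriented_simplex_chains oriented_simplex_self)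
  have c0: "c \<sigma> (simplex_list \<tau>) = 0" if "\<sigma> \<in> K" for \<sigma>
  proof (rule ccontr)
    assume "c \<sigma> (simplex_list \<tau>) \<noteq> 0"
    then have "set (simplex_list \<tau>) \<in> K" using chains_supp[OF triangular_chains[OF tri that]] by blast
    then show False using l \<tau> by simp
  qed
  have cK: "c \<sigma> \<in> chains (card \<sigma> - 1) ?K" if "\<sigma> \<in> K" for \<sigma>
    using triangular_chains[OF tri that] chains_mono[of K ?K] by blast
  have triK: "c \<sigma> \<in> chains (card \<sigma> - 1) {\<rho>\<in>?K. r \<rho> \<le> r \<sigma>} \<and> c \<sigma> (simplex_list \<sigma>) \<noteq> 0" if "\<sigma> \<in> K" for \<sigma>
    using tri that same[OF that] unfolding triangular_def by metis
  \<comment> \<open>A vertex is treated apart: its boundary is zero, while the degree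
    \<open>?m - 1\<close> would be truncated to 0 instead of dropping to -1.\<close>
  have cyc: "boundary ?e \<in> chains (?m - 1) K \<and> boundary (boundary ?e) = (\<lambda>_. 0) \<and> 1 \<le> ?m
      \<or> boundary ?e = (\<lambda>_. 0)"
  proof (cases ?m)
    case 0
    have "?e (v # vs) = 0" if "vs \<noteq> []" for v vs
      using that chains_supp[OF e(1), of "v # vs"] 0 by auto
    then have "boundary ?e vs = 0" for vs unfolding boundary_def by simp
    then show ?thesis by auto
  next
    case (Suc j)
    have e': "?e \<in> chains (Suc j) ?K" using e(1) Suc by simp
    have "boundary ?e \<in> chains j ?K" by (rule boundary_chains[OF e' fin(2) cl])
    then have "boundary ?e \<in> chains j K"
    proof (rule chains_restrict)
      fix vs assume "boundary ?e vs \<noteq> 0"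
      then have "set vs \<in> ?K \<and> distinct vs \<and> length vs = Suc j"
        using chains_supp[OF \<open>boundary ?e \<in> chains j ?K\<close>] by blast
      then show "set vs \<in> K" using m Suc distinct_card[of vs] by auto
    qed
    moreover have "boundary (boundary ?e) = (\<lambda>_. 0)"
      by (rule ext, rule boundary_boundary[OF e' fin(2) cl])
    ultimately show ?thesis using Suc by simp
  qed
  obtain a where a: "\<And>\<sigma>. a \<sigma> \<noteq> 0 \<Longrightarrow> \<sigma> \<in> K \<and> card \<sigma> = ?m"
    "boundary ?e = (\<lambda>vs. \<Sum>\<sigma>\<in>K. a \<sigma> * c \<sigma> vs)" "\<And>\<sigma>. \<sigma> \<in> K \<Longrightarrow> b \<sigma> \<noteq> None \<Longrightarrow> a \<sigma> = 0"
  proof (rule disjE[OF cyc])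
    assume *: "boundary ?e \<in> chains (?m - 1) K \<and> boundary (boundary ?e) = (\<lambda>_. 0) \<and> 1 \<le> ?m"
    moreover have "initial_segment r K K" by (simp add: initial_segment_def)
    ultimately obtain a where a: "\<And>\<sigma>. a \<sigma> \<noteq> 0 \<Longrightarrow> \<sigma> \<in> K \<and> card \<sigma> = Suc (?m - 1)"
      "boundary ?e = (\<lambda>vs. \<Sum>\<sigma>\<in>K. a \<sigma> * c \<sigma> vs)"
      using triangular_span[OF S(3,4) tri, of K] by meson
    have "1 \<le> ?m" using * by blast
    then have "Suc (?m - 1) = ?m" by linarith
    from a(1)[unfolded this] have "\<And>\<sigma>. a \<sigma> \<noteq> 0 \<Longrightarrow> \<sigma> \<in> K \<and> card \<sigma> = ?m" by blast
    moreover have "a \<sigma> = 0" if "\<sigma> \<in> K" "b \<sigma> \<noteq> None" for \<sigma>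
      by (rule normal_form_cycle_coefficient[OF S(3,4) nf _ that]) (use a(2) * in metis)
    ultimately show ?thesis using that a(2) by blast
  next
    assume "boundary ?e = (\<lambda>_. 0)"
    then show ?thesis by (intro that[of "\<lambda>_. 0"]) auto
  qed
  \<comment> \<open>For a killed \<sigma>, the chain \<open>c \<sigma>\<close> is the boundary of
    the chain of its killer. \<open>?s\<close> collects these killers, weighted by the coefficients
    of what they kill; subtracting it leaves the coefficients \<open>?a''\<close>, which live on
    unkilled simplices.\<close>
  let ?a' = "\<lambda>\<rho>. case b \<rho> of None \<Rightarrow> 0 | Some \<sigma> \<Rightarrow> a \<sigma>"
  let ?a'' = "\<lambda>\<sigma>. if killed K b \<sigma> then 0 else a \<sigma>"
  let ?s = "\<lambda>vs. \<Sum>\<rho>\<in>K. ?a' \<rho> * c \<rho> vs"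
  define x where "x = (\<lambda>vs. ?e vs + (-1) * ?s vs)"
  have s: "?s \<in> chains ?m ?K"
  proof (rule chains_linear_combination)
    fix \<rho> assume \<rho>: "\<rho> \<in> K" "?a' \<rho> \<noteq> 0"
    then obtain \<sigma> where "b \<rho> = Some \<sigma>" "a \<sigma> \<noteq> 0" by (auto split: option.splits)
    then have "card \<rho> = Suc (card \<sigma>)" "card \<sigma> = ?m" using a(1) normal_form_Some[OF nf \<rho>(1)] by auto
    then show "c \<rho> \<in> chains ?m ?K" using cK[OF \<rho>(1)] by simp
  qed
  have x: "x \<in> chains ?m ?K" unfolding x_def by (rule chains_add_smult[OF e(1) s])
  have xl: "x (simplex_list \<tau>) \<noteq> 0" using e(2) c0 by (simp add: x_def)
  have dx: "boundary x = (\<lambda>vs. \<Sum>\<sigma>\<in>K. ?a'' \<sigma> * c \<sigma> vs)"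
  proof
    fix vs
    have "boundary x vs = boundary ?e vs + (-1) * boundary ?s vs"
      unfolding x_def using boundary_add_smult[OF fin(2) e(1) s, of "-1"] by metis
    also have "\<dots> = (\<Sum>\<sigma>\<in>K. a \<sigma> * c \<sigma> vs) -
        (\<Sum>\<sigma>\<in>K. (if killed K b \<sigma> then ?a' (killer K b \<sigma>) else 0) * c \<sigma> vs)"
      unfolding boundary_normal_form[OF S(3) nf] a(2) by simp
    also have "\<dots> = (\<Sum>\<sigma>\<in>K. a \<sigma> * c \<sigma> vs - (if killed K b \<sigma> then ?a' (killer K b \<sigma>) else 0) * c \<sigma> vs)"
      by (rule sum_subtractf[symmetric])
    also have "\<dots> = (\<Sum>\<sigma>\<in>K. ?a'' \<sigma> * c \<sigma> vs)"
      using killer_eq[OF nf] by (intro sum.cong refl) (auto simp: killed_def)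
    finally show "boundary x vs = (\<Sum>\<sigma>\<in>K. ?a'' \<sigma> * c \<sigma> vs)" .
  qed
  show ?thesis
  proof (cases "\<forall>\<sigma>\<in>K. ?a'' \<sigma> = 0")
    case True
    then have dx0: "boundary x = (\<lambda>_. 0)" unfolding dx by (auto intro!: sum.neutral)
    have "normal_form r ?K (c(\<tau> := x)) (b(\<tau> := None))"
      unfolding normal_form_def
    proof (intro conjI)
      show "triangular r ?K (c(\<tau> := x))"
        unfolding triangular_def using triK x xl top \<tau> by auto
      show "\<forall>\<rho>\<in>?K. boundary ((c(\<tau> := x)) \<rho>) =
          (case (b(\<tau> := None)) \<rho> of None \<Rightarrow> \<lambda>_. 0 | Some \<sigma> \<Rightarrow> (c(\<tau> := x)) \<sigma>)"
        using normal_form_None[OF nf] normal_form_Some[OF nf] dx0 \<tau>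
        by (auto split: option.splits)
      show "\<forall>\<rho>\<in>?K. \<forall>\<pi>. (b(\<tau> := None)) \<rho> = Some \<pi> \<longrightarrow>
          \<pi> \<in> ?K \<and> r \<pi> < r \<rho> \<and> card \<rho> = Suc (card \<pi>)"
        using normal_form_Some[OF nf] by auto
      show "\<forall>\<rho>\<in>?K. \<forall>\<rho>'\<in>?K. (b(\<tau> := None)) \<rho> \<noteq> None \<longrightarrow>
          (b(\<tau> := None)) \<rho> = (b(\<tau> := None)) \<rho>' \<longrightarrow> \<rho> = \<rho>'"
      proof (intro ballI impI)
        fix \<rho> \<rho>' assume "\<rho> \<in> ?K" "\<rho>' \<in> ?K" "(b(\<tau> := None)) \<rho> \<noteq> None"
          "(b(\<tau> := None)) \<rho> = (b(\<tau> := None)) \<rho>'"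
        then show "\<rho> = \<rho>'" using normal_form_inj[OF nf]
          by (metis fun_upd_apply insertE not_None_eq)
      qed
    qed
    then show ?thesis by blast
  next
    case False
    define A where "A = {\<sigma>\<in>K. \<not> killed K b \<sigma> \<and> a \<sigma> \<noteq> 0}"
    have A: "finite A" "A \<noteq> {}" using fin(1) False by (simp add: A_def, auto simp: A_def split: if_splits)
    \<comment> \<open>The choice of the latest remaining simplex makes \<sigma> the leading simplex
      of \<open>boundary x\<close>, so triangularity survives. This is the elder rule: the youngest
      class dies.\<close>
    then have "Max (r ` A) \<in> r ` A" by simp
    then obtain \<sigma> where "\<sigma> \<in> A" and mxA: "r \<sigma> = Max (r ` A)" by (metis imageE)
    then have \<sigma>: "\<sigma> \<in> K" "a \<sigma> \<noteq> 0" "\<not> killed K b \<sigma>" by (auto simp: A_def)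
    then have b\<sigma>: "b \<sigma> = None" "card \<sigma> = ?m" using a(1)[of \<sigma>] a(3)[of \<sigma>] by blast+
    have "\<sigma> \<noteq> \<tau>" using \<sigma> \<tau> by blast
    have "card \<sigma> \<noteq> 0" using \<sigma> S(3) by (auto simp: simplices_def)
    have le: "r \<rho> \<le> r \<sigma>" if "\<rho> \<in> K" "?a'' \<rho> \<noteq> 0" for \<rho>
    proof -
      have "\<rho> \<in> A" using that by (auto simp: A_def split: if_splits)
      then show ?thesis using A(1) mxA by simp
    qed
    have dxc: "boundary x \<in> chains (card \<sigma> - 1) {\<rho>\<in>?K. r \<rho> \<le> r \<sigma>}"
      unfolding dx
    proof (rule chains_linear_combination)
      fix \<rho> assume \<rho>: "\<rho> \<in> K" "?a'' \<rho> \<noteq> 0"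
      then have card: "card \<rho> = card \<sigma>" using a(1) b\<sigma> by (auto split: if_splits)
      have "{\<pi>\<in>?K. r \<pi> \<le> r \<rho>} \<subseteq> {\<pi>\<in>?K. r \<pi> \<le> r \<sigma>}" using le[OF \<rho>] by auto
      from subsetD[OF chains_mono[OF this, of "card \<sigma> - 1"]]
      show "c \<rho> \<in> chains (card \<sigma> - 1) {\<pi>\<in>?K. r \<pi> \<le> r \<sigma>}"
        using triK[OF \<rho>(1)] unfolding card by blast
    qed
    have dxl: "boundary x (simplex_list \<sigma>) \<noteq> 0"
    proof -
      have "?a'' \<rho> * c \<rho> (simplex_list \<sigma>) = 0" if "\<rho> \<in> K - {\<sigma>}" for \<rho>
      proof (cases "?a'' \<rho> = 0")
        case nz: False
        have "r \<rho> \<noteq> r \<sigma>" using that \<sigma> S(4) by (auto dest: inj_onD)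
        then have "r \<rho> < r \<sigma>" using le[OF _ nz] that by simp
        then show ?thesis using triangular_eq_0[OF S(3) tri, of \<rho> \<sigma>] that \<sigma> by simp
      qed simp
      then have "(\<Sum>\<rho>\<in>K - {\<sigma>}. ?a'' \<rho> * c \<rho> (simplex_list \<sigma>)) = 0"
        by (intro sum.neutral ballI)
      then have "boundary x (simplex_list \<sigma>) = ?a'' \<sigma> * c \<sigma> (simplex_list \<sigma>)"
        unfolding dx using \<sigma> fin by (simp add: sum.remove[of K \<sigma>])
      then show ?thesis using \<sigma> tri by (simp add: triangular_def)
    qed
    have ddx: "boundary (boundary x) = (\<lambda>_. 0)"
    proof -
      have "?m \<noteq> 0" using b\<sigma>(2) \<open>card \<sigma> \<noteq> 0\<close> by metis
      then have "Suc (?m - 1) = ?m" by linarith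
      then have x': "x \<in> chains (Suc (?m - 1)) ?K" using x by (simp only:)
      show ?thesis by (rule ext, rule boundary_boundary[OF x' fin(2) cl])
    qed
    \<comment> \<open>\<open>c \<sigma>\<close> is traded for \<open>boundary x\<close>, so that the
      boundary of the new chain is exactly a basis chain. No other column is disturbed: \<sigma> was
      not killed by an earlier simplex, and the old and the new chain at \<sigma> are both
      cycles.\<close>
    let ?c = "c(\<tau> := x, \<sigma> := boundary x)" and ?b = "b(\<tau> := Some \<sigma>)"
    have nk: "b \<rho> \<noteq> Some \<sigma>" if "\<rho> \<in> K" for \<rho> using \<sigma>(3) that by (auto simp: killed_def)
    have "normal_form r ?K ?c ?b"
      unfolding normal_form_def
    proof (intro conjI)
      show "triangular r ?K ?c"
        unfolding triangular_def using triK x xl top \<tau> \<open>\<sigma> \<noteq> \<tau>\<close> dxc dxl by auto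
      show "\<forall>\<rho>\<in>?K. boundary (?c \<rho>) = (case ?b \<rho> of None \<Rightarrow> \<lambda>_. 0 | Some \<sigma> \<Rightarrow> ?c \<sigma>)"
      proof
        fix \<rho> assume \<rho>: "\<rho> \<in> ?K"
        consider "\<rho> = \<tau>" | "\<rho> = \<sigma>" | "\<rho> \<in> K" "\<rho> \<noteq> \<tau>" "\<rho> \<noteq> \<sigma>" using \<rho> by blast
        then show "boundary (?c \<rho>) = (case ?b \<rho> of None \<Rightarrow> \<lambda>_. 0 | Some \<sigma> \<Rightarrow> ?c \<sigma>)"
        proof cases
          case 3
          then have "boundary (c \<rho>) = (case b \<rho> of None \<Rightarrow> \<lambda>_. 0 | Some \<sigma> \<Rightarrow> c \<sigma>)"
            using normal_form_None[OF nf] normal_form_Some[OF nf] by (auto split: option.splits)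
          moreover have "\<pi> \<noteq> \<tau>" "\<pi> \<noteq> \<sigma>" if "b \<rho> = Some \<pi>" for \<pi>
            using normal_form_Some[OF nf 3(1) that] nk[OF 3(1)] that \<tau> by auto
          ultimately show ?thesis using 3 by (auto split: option.splits)
        qed (use \<open>\<sigma> \<noteq> \<tau>\<close> b\<sigma> ddx in auto)
      qed
      show "\<forall>\<rho>\<in>?K. \<forall>\<pi>. ?b \<rho> = Some \<pi> \<longrightarrow> \<pi> \<in> ?K \<and> r \<pi> < r \<rho> \<and> card \<rho> = Suc (card \<pi>)"
        using normal_form_Some[OF nf] \<sigma> mx b\<sigma> m by auto
      show "\<forall>\<rho>\<in>?K. \<forall>\<rho>'\<in>?K. ?b \<rho> \<noteq> None \<longrightarrow> ?b \<rho> = ?b \<rho>' \<longrightarrow> \<rho> = \<rho>'"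
      proof (intro ballI impI)
        fix \<rho> \<rho>' assume "\<rho> \<in> ?K" "\<rho>' \<in> ?K" "?b \<rho> \<noteq> None" "?b \<rho> = ?b \<rho>'"
        then show "\<rho> = \<rho>'" using normal_form_inj[OF nf] nk
          by (metis fun_upd_apply insertE not_None_eq)
      qed
    qed
    then show ?thesis by blast
  qed
qed

lemma normal_form_exists:
  assumes "complex_order r K"
  shows "\<exists>(c :: 'a set \<Rightarrow> 'a list \<Rightarrow> 'f::field) b. normal_form r K c b"
proof -
  have "finite K" using assms by (simp add: complex_order_def simplices_def)
  then show ?thesis using assms
  proof (induction K rule: finite_ranking_induct[where f = r])
    case empty
    show ?case by (intro exI[of _ undefined]) (simp add: normal_form_def triangular_def)
  next
    case (insert \<tau> K)
    show ?case
    proof (cases "\<tau> \<in> K")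
      case True
      then show ?thesis using insert.IH insert.prems by (simp add: insert_absorb)
    next
      case \<tau>: False
      have less: "r \<sigma> < r \<tau>" if "\<sigma> \<in> K" for \<sigma>
      proof -
        have "r \<sigma> \<noteq> r \<tau>"
          using insert.prems \<tau> that unfolding complex_order_def inj_on_def by blast
        then show ?thesis using insert(2)[OF that] by simp
      qed
      have "complex_order r K"
        unfolding complex_order_def
      proof (intro conjI ballI allI impI)
        show "simplices K" "inj_on r K"
          using insert.prems simplices_subset[of "insert \<tau> K" K] by (auto simp: complex_order_def)
        fix \<sigma> \<rho> assume *: "\<sigma> \<in> K" "\<rho> \<subset> \<sigma>" "\<rho> \<noteq> {}"
        then show "r \<rho> < r \<sigma>" using insert.prems by (auto simp: complex_order_def)
        moreover have "\<rho> \<in> insert \<tau> K" using * insert.prems by (auto simp: complex_order_def)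
        ultimately show "\<rho> \<in> K" using less[OF *(1)] by auto
      qed
      from insert.IH[OF this] obtain c :: "'a set \<Rightarrow> 'a list \<Rightarrow> 'f" and b where "normal_form r K c b" by blast
      with normal_form_insert[OF insert.prems \<tau> less] show ?thesis by blast
    qed
  qed
qed

section \<open>Uniqueness of barcodes\<close>

text \<open>Gaussian elimination with more unknowns than equations. It takes the place of a
  dimension count when ranks are compared below.\<close>

lemma homogeneous_system_solution:
  fixes w :: "'i \<Rightarrow> 'j \<Rightarrow> 'f::field"
  assumes "finite B" "finite A" "card B < card A"
  shows "\<exists>a. (\<exists>i\<in>A. a i \<noteq> 0) \<and> (\<forall>j\<in>B. (\<Sum>i\<in>A. a i * w i j) = 0)"
  using assms
proof (induction B arbitrary: A w rule: finite_induct)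
  case empty
  then have "A \<noteq> {}" by auto
  then show ?case by (intro exI[of _ "\<lambda>_. 1"]) auto
next
  case (insert j B)
  show ?case
  proof (cases "\<forall>i\<in>A. w i j = 0")
    case True
    have "card B < card A" using insert by simp
    from insert.IH[OF insert.prems(1) this, of w] True show ?thesis by auto
  next
    case False
    then obtain i0 where i0: "i0 \<in> A" "w i0 j \<noteq> 0" by blast
    \<comment> \<open>Equation \<open>j\<close> is solved for the unknown \<open>i0\<close>; the
      factors \<open>?q\<close> substitute the result into the other equations.\<close>
    let ?A = "A - {i0}" and ?q = "\<lambda>i. w i j / w i0 j"
    have "finite ?A" "card B < card ?A" using insert i0 by auto
    from insert.IH[OF this, of "\<lambda>i l. w i l - ?q i * w i0 l"] obtain a where
      a: "\<exists>i\<in>?A. a i \<noteq> 0" "\<And>l. l \<in> B \<Longrightarrow> (\<Sum>i\<in>?A. a i * (w i l - ?q i * w i0 l)) = 0" by blast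
    let ?a = "a(i0 := - (\<Sum>i\<in>?A. a i * ?q i))"
    have split: "(\<Sum>i\<in>A. ?a i * w i l) = (\<Sum>i\<in>?A. a i * (w i l - ?q i * w i0 l))" for l
    proof -
      have "(\<Sum>i\<in>A. ?a i * w i l) = ?a i0 * w i0 l + (\<Sum>i\<in>?A. a i * w i l)"
        using i0 insert.prems by (subst sum.remove[of A i0]) (auto intro!: sum.cong)
      also have "\<dots> = (\<Sum>i\<in>?A. a i * w i l - a i * ?q i * w i0 l)"
        by (simp add: sum_subtractf sum_distrib_right)
      finally show ?thesis by (simp add: algebra_simps)
    qed
    have "(\<Sum>i\<in>A. ?a i * w i l) = 0" if "l \<in> insert j B" for l
      unfolding split using a(2) that i0 by auto
    moreover have "\<exists>i\<in>A. ?a i \<noteq> 0" using a(1) by auto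
    ultimately show ?thesis by blast
  qed
qed

lemma linear_maps_inv_into:
  fixes V :: "('f::field, 'v) module" and W :: "('f, 'w) module"
  assumes V: "Module.module field_ring V" and f: "f \<in> linear_maps V W"
    and bij: "bij_betw f (carrier V) (carrier W)"
  shows "inv_into (carrier V) f \<in> linear_maps W V"
proof -
  interpret V: Module.module field_ring V by (rule V)
  let ?g = "inv_into (carrier V) f"
  have g: "?g y \<in> carrier V" "f (?g y) = y" if "y \<in> carrier W" for y
    using that bij bij_betwE[OF bij_betw_inv_into[OF bij]] bij_betw_inv_into_right[OF bij] by auto
  have gf: "?g (f x) = x" if "x \<in> carrier V" for x
    using that bij bij_betw_inv_into_left by metis
  have fl: "f (x \<oplus>\<^bsub>V\<^esub> y) = f x \<oplus>\<^bsub>W\<^esub> f y" "f (r \<odot>\<^bsub>V\<^esub> x) = r \<odot>\<^bsub>W\<^esub> f x"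
    if "x \<in> carrier V" "y \<in> carrier V" for x y r
    using f that by (auto simp: linear_maps_def)
  show ?thesis
    unfolding linear_maps_def
  proof (intro CollectI conjI ballI allI Pi_I)
    fix x assume x: "x \<in> carrier W"
    show "?g x \<in> carrier V" using g x by blast
    have "r \<odot>\<^bsub>V\<^esub> ?g x \<in> carrier V" for r
      using V.smult_closed[of r "?g x"] g x by (simp add: field_ring_def)
    then show "?g (r \<odot>\<^bsub>W\<^esub> x) = r \<odot>\<^bsub>V\<^esub> ?g x" for r
      using gf fl(2)[of "?g x" "?g x" r] g x by metis
    fix y assume y: "y \<in> carrier W"
    have "?g x \<oplus>\<^bsub>V\<^esub> ?g y \<in> carrier V" using g x y by blast
    then show "?g (x \<oplus>\<^bsub>W\<^esub> y) = ?g x \<oplus>\<^bsub>V\<^esub> ?g y"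
      using gf fl(1) g x y by metis
  qed
qed

lemma interval_sum_linear_combination:
  fixes T :: "(nat \<Rightarrow> 'f::field) \<Rightarrow> nat \<Rightarrow> 'f"
  assumes T: "T \<in> linear_maps (interval_sum Is t) (interval_sum Js t)"
    and e: "\<And>i. i \<in> A \<Longrightarrow> e i \<in> carrier (interval_sum Is t)"
  shows "(\<lambda>l. \<Sum>i\<in>A. a i * e i l) \<in> carrier (interval_sum Is t)"
    and "T (\<lambda>l. \<Sum>i\<in>A. a i * e i l) = (\<lambda>l. \<Sum>i\<in>A. a i * T (e i) l)"
proof -
  let ?V = "interval_sum Is t :: ('f, _) module"
  have Tl: "T (c \<oplus>\<^bsub>?V\<^esub> d) = T c \<oplus>\<^bsub>interval_sum Js t\<^esub> T d"
    "T (r \<odot>\<^bsub>?V\<^esub> c) = r \<odot>\<^bsub>interval_sum Js t\<^esub> T c"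
    if "c \<in> carrier ?V" "d \<in> carrier ?V" for c d r
    using T that unfolding linear_maps_def by blast+
  have cl: "c \<oplus>\<^bsub>?V\<^esub> d \<in> carrier ?V" "r \<odot>\<^bsub>?V\<^esub> c \<in> carrier ?V"
    if "c \<in> carrier ?V" "d \<in> carrier ?V" for c d r
    using that by (auto simp: interval_sum_def) (metis add.right_neutral)+
  have add: "(\<lambda>l. c l + d l) \<in> carrier ?V \<and> T (\<lambda>l. c l + d l) = (\<lambda>l. T c l + T d l)"
    if "c \<in> carrier ?V" "d \<in> carrier ?V" for c d
    using Tl(1)[OF that] cl(1)[OF that] by (simp add: interval_sum_def)
  have sm: "(\<lambda>l. r * c l) \<in> carrier ?V \<and> T (\<lambda>l. r * c l) = (\<lambda>l. r * T c l)"
    if "c \<in> carrier ?V" for c r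
    using Tl(2)[OF that that] cl(2)[OF that that] by (simp add: interval_sum_def)
  have z: "(\<lambda>_. 0) \<in> carrier ?V" by (simp add: interval_sum_def)
  have "T (\<lambda>_. 0) = (\<lambda>_. 0)" using sm[OF z, of 0] by simp
  then have "(\<lambda>l. \<Sum>i\<in>A. a i * e i l) \<in> carrier ?V \<and>
      T (\<lambda>l. \<Sum>i\<in>A. a i * e i l) = (\<lambda>l. \<Sum>i\<in>A. a i * T (e i) l)"
    using e
  proof (induction A rule: infinite_finite_induct)
    case (insert i A)
    then show ?case
      using add[of "\<lambda>l. a i * e i l" "\<lambda>l. \<Sum>i\<in>A. a i * e i l"] sm[of "e i" "a i"] by simp
  qed (use z in simp_all)
  then show "(\<lambda>l. \<Sum>i\<in>A. a i * e i l) \<in> carrier (interval_sum Is t)"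
    "T (\<lambda>l. \<Sum>i\<in>A. a i * e i l) = (\<lambda>l. \<Sum>i\<in>A. a i * T (e i) l)" by blast+
qed

text \<open>The rank of the structure map from \<open>s\<close> to \<open>t\<close> in the interval
  module with bars \<open>D\<close>.\<close>

definition bars_through :: "bar multiset \<Rightarrow> real \<Rightarrow> real \<Rightarrow> nat" where
  "bars_through D s t = size {#I \<in># D. in_bar s I \<and> in_bar t I#}"

lemma bars_through_mset:
  "bars_through (mset Is) s t = card {i. i < length Is \<and> in_bar s (Is ! i) \<and> in_bar t (Is ! i)}"
  unfolding bars_through_def by (simp add: length_filter_conv_card flip: mset_filter)

text \<open>Composing one decomposition with the inverse of the other gives an injective linear map
  \<open>?T\<close> of interval sums at \<open>t\<close>. It sends the unit vectors of the bars of
  \<open>D\<close> through \<open>s\<close> and \<open>t\<close> into the span of those of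
  \<open>E\<close>. With fewer bars on the right, some nontrivial combination would be sent to
  zero.\<close>

lemma is_barcode_bars_through_le:
  fixes V :: "real \<Rightarrow> ('f::field, 'v) module"
  assumes pv: "persistent_vector_space V \<theta>"
    and D: "is_barcode V \<theta> D" and E: "is_barcode V \<theta> E" and st: "0 \<le> s" "s \<le> t"
  shows "bars_through D s t \<le> bars_through E s t"
proof -
  interpret persistent_vector_space V \<theta> by (rule pv)
  obtain Is \<Psi> where Is: "mset Is = D"
    "\<And>t. 0 \<le> t \<Longrightarrow> \<Psi> t \<in> linear_maps (V t) (interval_sum Is t)"
    "\<And>t. 0 \<le> t \<Longrightarrow> bij_betw (\<Psi> t) (carrier (V t)) (carrier (interval_sum Is t))"
    "\<And>s t x. 0 \<le> s \<Longrightarrow> s \<le> t \<Longrightarrow> x \<in> carrier (V s) \<Longrightarrow> \<Psi> t (\<theta> s t x) = interval_sum_map Is s t (\<Psi> s x)"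
    using D unfolding is_barcode_def by blast
  obtain Js \<Xi> where Js: "mset Js = E"
    "\<And>t. 0 \<le> t \<Longrightarrow> \<Xi> t \<in> linear_maps (V t) (interval_sum Js t)"
    "\<And>t. 0 \<le> t \<Longrightarrow> bij_betw (\<Xi> t) (carrier (V t)) (carrier (interval_sum Js t))"
    "\<And>s t x. 0 \<le> s \<Longrightarrow> s \<le> t \<Longrightarrow> x \<in> carrier (V s) \<Longrightarrow> \<Xi> t (\<theta> s t x) = interval_sum_map Js s t (\<Xi> s x)"
    using E unfolding is_barcode_def by blast
  have t: "0 \<le> t" using st by simp
  let ?I = "\<lambda>t. interval_sum Is t :: ('f, _) module" and ?J = "\<lambda>t. interval_sum Js t :: ('f, _) module"
  let ?g = "\<lambda>t. inv_into (carrier (V t)) (\<Psi> t)"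
  let ?T = "\<lambda>c. \<Xi> t (?g t c)"
  have g: "?g t \<in> linear_maps (?I t) (V t)"
    by (rule linear_maps_inv_into[OF vector_space[OF t] Is(2,3)[OF t]])
  have gc: "?g t c \<in> carrier (V t)" if "c \<in> carrier (?I t)" for c
    using g that by (auto simp: linear_maps_def)
  have T: "?T \<in> linear_maps (?I t) (?J t)"
    using g Js(2)[OF t] unfolding linear_maps_def by (auto simp: Pi_iff)
  have T0: "c = (\<lambda>_. 0)" if "c \<in> carrier (?I t)" "?T c = (\<lambda>_. 0)" for c
  proof -
    have z: "(\<lambda>_. 0) \<in> carrier (?I t)" by (simp add: interval_sum_def)
    have "?T (\<lambda>_. 0) = (\<lambda>_. 0)"
      using interval_sum_linear_combination(2)[OF T, of "{}" undefined undefined] by simp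
    then have "?g t c = ?g t (\<lambda>_. 0)"
      using Js(3)[OF t] that z gc by (metis bij_betw_imp_inj_on inj_onD)
    then show ?thesis
      using that z Is(3)[OF t] by (metis bij_betw_inv_into_right)
  qed
  define A where "A = {i. i < length Is \<and> in_bar s (Is ! i) \<and> in_bar t (Is ! i)}"
  define B where "B = {i. i < length Js \<and> in_bar s (Js ! i) \<and> in_bar t (Js ! i)}"
  have fin: "finite A" "finite B" by (auto simp: A_def B_def)
  let ?e = "\<lambda>i j. if j = i then 1 else 0 :: 'f"
  have e: "?e i \<in> carrier (?I s)" "?e i \<in> carrier (?I t)" if "i \<in> A" for i
    using that by (auto simp: A_def interval_sum_def)
  \<comment> \<open>The unit vector at \<open>t\<close> is the image of the one at \<open>s\<close>,
    and the decompositions commute with the structure maps. So its image under \<open>?T\<close>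
    comes from \<open>s\<close> as well and is zero off the bars of \<open>B\<close>.\<close>
  have Te: "?T (?e i) j = 0" if "i \<in> A" "j \<notin> B" for i j
  proof -
    let ?x = "?g s (?e i)"
    have x: "?x \<in> carrier (V s)" "\<Psi> s ?x = ?e i"
      using bij_betwE[OF bij_betw_inv_into[OF Is(3)[OF st(1)]]] e(1)[OF that(1)]
        bij_betw_inv_into_right[OF Is(3)[OF st(1)]] by auto
    have \<theta>x: "\<theta> s t ?x \<in> carrier (V t)" using linear[OF st] x by (auto simp: linear_maps_def)
    have "\<Psi> t (\<theta> s t ?x) = interval_sum_map Is s t (?e i)" using Is(4)[OF st x(1)] x by simp
    also have "\<dots> = ?e i" using that by (auto simp: interval_sum_map_def A_def)
    finally have "?g t (?e i) = \<theta> s t ?x" using \<theta>x Is(3)[OF t] bij_betw_inv_into_left by metis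
    then have "?T (?e i) = interval_sum_map Js s t (\<Xi> s ?x)" using Js(4)[OF st x(1)] by simp
    then show ?thesis using that by (auto simp: interval_sum_map_def B_def)
  qed
  have "card A \<le> card B"
  proof (rule ccontr)
    assume "\<not> card A \<le> card B"
    then obtain a where a: "\<exists>i\<in>A. a i \<noteq> 0" "\<And>j. j \<in> B \<Longrightarrow> (\<Sum>i\<in>A. a i * ?T (?e i) j) = 0"
      using homogeneous_system_solution[OF fin(2,1), of "\<lambda>i. ?T (?e i)"] by (auto simp: not_le)
    note L = interval_sum_linear_combination[OF T e(2), of A]
    have "(\<Sum>i\<in>A. a i * ?T (?e i) j) = 0" for j
      by (cases "j \<in> B") (use a(2) Te in \<open>auto intro!: sum.neutral\<close>)
    then have "?T (\<lambda>l. \<Sum>i\<in>A. a i * ?e i l) = (\<lambda>_. 0)" using L(2) by auto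
    from T0[OF L(1) this] have "(\<Sum>i\<in>A. a i * ?e i l) = 0" for l by meson
    moreover have "(\<Sum>i\<in>A. a i * ?e i l) = a l" if "l \<in> A" for l using that fin(1) by (simp add: if_distrib cong: if_cong)
    ultimately show False using a(1) by metis
  qed
  then show ?thesis using Is(1) Js(1) bars_through_mset by (metis A_def B_def)
qed

lemma bars_through_plus: "bars_through (D + E) s t = bars_through D s t + bars_through E s t"
  by (simp add: bars_through_def)

lemma bars_through_unique_bar:
  assumes "\<And>I. I \<in># D \<Longrightarrow> in_bar s I \<and> in_bar t I \<longleftrightarrow> I = J"
  shows "bars_through D s t = count D J"
proof -
  have "{#I \<in># D. in_bar s I \<and> in_bar t I#} = {#I \<in># D. I = J#}"
    using assms by (intro filter_mset_cong) auto
  then show ?thesis by (simp add: bars_through_def filter_eq_replicate_mset)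
qed

text \<open>Among the bars in which the multisets differ, take the earliest birth \<open>b\<close>
  and, for it, the latest death \<open>d\<close>. A suitable \<open>t\<close> makes
  \<open>(b, d)\<close> the only such bar containing both \<open>b\<close> and \<open>t\<close>. Its
  multiplicities in \<open>D - E\<close> and \<open>E - D\<close> then agree, yet they cannot both
  be positive and one of them is.\<close>

lemma multiset_eq_if_bars_through_eq:
  assumes bars: "\<And>b d. (b, d) \<in># D + E \<Longrightarrow> 0 \<le> b \<and> ereal b < d"
    and eq: "\<And>s t. 0 \<le> s \<Longrightarrow> s \<le> t \<Longrightarrow> bars_through D s t = bars_through E s t"
  shows "D = E"
proof (rule ccontr)
  assume "D \<noteq> E"
  let ?D = "D - E" and ?E = "E - D"
  let ?U = "set_mset (?D + ?E)"
  have DE: "D = ?D + (D \<inter># E)" "E = ?E + (D \<inter># E)"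
    by (auto intro!: multiset_eqI)
  have eq': "bars_through ?D s t = bars_through ?E s t" if "0 \<le> s" "s \<le> t" for s t
    using eq[OF that] bars_through_plus DE by (metis add_right_cancel)
  have "?U \<noteq> {}" using DE \<open>D \<noteq> E\<close> by (metis empty_neutral(1) set_mset_eq_empty_iff union_eq_empty)
  have ok: "0 \<le> b \<and> ereal b < d" if "(b, d) \<in> ?U" for b d
  proof -
    have "(b, d) \<in># D \<or> (b, d) \<in># E" using that by (auto dest: in_diffD)
    then show ?thesis using bars by (simp only: union_iff)
  qed
  define b where "b = Min (fst ` ?U)"
  have b: "b \<in> fst ` ?U" "\<And>I. I \<in> ?U \<Longrightarrow> b \<le> fst I"
    using \<open>?U \<noteq> {}\<close> by (auto simp only: b_def intro!: Min_in Min_le finite_imageI finite_set_mset)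
  let ?d = "snd ` {I\<in>?U. fst I = b}"
  define d where "d = Max ?d"
  have "finite ?d" "?d \<noteq> {}" using b(1) by auto
  then have d: "(b, d) \<in> ?U" "\<And>I. I \<in> ?U \<Longrightarrow> fst I = b \<Longrightarrow> snd I \<le> d"
  proof -
    assume f: "finite ?d" "?d \<noteq> {}"
    then have "d \<in> ?d" unfolding d_def by (rule Max_in)
    then show "(b, d) \<in> ?U" by auto
    show "\<And>I. I \<in> ?U \<Longrightarrow> fst I = b \<Longrightarrow> snd I \<le> d" using f unfolding d_def by (intro Max_ge) auto
  qed
  \<comment> \<open>The parameter \<open>t\<close> is the last death before \<open>d\<close> among
    bars born at \<open>b\<close>, or \<open>b\<close> itself if there is none. Bars are half-open,
    so a bar that dies at \<open>t\<close> no longer contains it.\<close>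
  let ?F = "insert (ereal b) {e. (b, e) \<in> ?U \<and> e < d}"
  define m where "m = Max ?F"
  have "{e. (b, e) \<in> ?U \<and> e < d} \<subseteq> snd ` ?U" by force
  then have F: "finite ?F" by (meson finite_imageI finite_insert finite_set_mset finite_subset)
  have m: "m \<in> ?F" "\<And>e. e \<in> ?F \<Longrightarrow> e \<le> m"
    unfolding m_def by (rule Max_in[OF F], blast) (rule Max_ge[OF F])
  have "m < d" "ereal b \<le> m" using m d(1) ok by auto
  then obtain t where t: "m = ereal t" by (cases m) auto
  have bt: "b \<le> t" "0 \<le> b" "ereal t < d" using t \<open>m < d\<close> \<open>ereal b \<le> m\<close> ok d(1) by auto
  have iff: "in_bar b I \<and> in_bar t I \<longleftrightarrow> I = (b, d)" if I: "I \<in> ?U" for I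
  proof
    assume *: "in_bar b I \<and> in_bar t I"
    then have "fst I = b" using b(2)[OF I] by (simp add: in_bar_def)
    moreover have "\<not> snd I < d"
    proof
      assume "snd I < d"
      then have "snd I \<in> ?F" using I \<open>fst I = b\<close> by (metis (mono_tags, lifting) insertCI mem_Collect_eq prod.collapse)
      then show False using m(2) t * by (fastforce simp: in_bar_def)
    qed
    ultimately show "I = (b, d)" using d(2)[OF I] by (metis order_less_le prod.collapse)
  qed (use bt ok d(1) in \<open>auto simp: in_bar_def\<close>)
  have "bars_through ?D b t = count ?D (b, d)" "bars_through ?E b t = count ?E (b, d)"
    by (intro bars_through_unique_bar iff; auto)+
  then have "count ?D (b, d) = count ?E (b, d)" using eq' bt by simp
  moreover have "0 < count (?D + ?E) (b, d)" using d(1) by (simp only: count_greater_zero_iff)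
  ultimately show False by simp
qed

lemma barcode_eqI:
  assumes pv: "persistent_vector_space V \<theta>" and D: "is_barcode V \<theta> D"
  shows "barcode V \<theta> = D"
  unfolding barcode_def
proof (rule the_equality)
  show "is_barcode V \<theta> D" by (rule D)
  fix E assume E: "is_barcode V \<theta> E"
  have bars: "0 \<le> b \<and> ereal b < d" if "is_barcode V \<theta> F" "(b, d) \<in># F" for F b d
    using that unfolding is_barcode_def by (metis (mono_tags, lifting) case_prodD set_mset_mset)
  show "E = D"
    by (rule multiset_eq_if_bars_through_eq)
      (use bars[OF D] bars[OF E] is_barcode_bars_through_le[OF pv D E]
        is_barcode_bars_through_le[OF pv E D] in \<open>auto intro: antisym\<close>)
qed

section \<open>Barcodes from coordinates on cycles\<close>

text \<open>A decomposition into bars phrased on cycles instead of homology classes. Without cosets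
  it can be moved between complexes on different vertex types by precomposition. The law with the
  factor \<open>q\<close> covers addition and scaling together.\<close>

definition cycle_coordinates ::
    "nat \<Rightarrow> (real \<Rightarrow> 'a set set) \<Rightarrow> bar list \<Rightarrow> (real \<Rightarrow> ('a list \<Rightarrow> 'f::field) \<Rightarrow> nat \<Rightarrow> 'f) \<Rightarrow> bool" where
  "cycle_coordinates k K Is \<Lambda> \<longleftrightarrow>
     (\<forall>t\<ge>0. (\<forall>x\<in>cycles k (K t). \<forall>y\<in>cycles k (K t). \<forall>q.
          \<Lambda> t (\<lambda>vs. x vs + q * y vs) = (\<lambda>i. \<Lambda> t x i + q * \<Lambda> t y i)) \<and>
        \<Lambda> t ` cycles k (K t) = carrier (interval_sum Is t :: ('f, _) module) \<and>
        (\<forall>x\<in>cycles k (K t). \<Lambda> t x = (\<lambda>_. 0) \<longleftrightarrow> x \<in> boundaries k (K t))) \<and>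
     (\<forall>s t. 0 \<le> s \<longrightarrow> s \<le> t \<longrightarrow>
        (\<forall>x\<in>cycles k (K s). \<Lambda> t x = interval_sum_map Is s t (\<Lambda> s x)))"

definition simplicial_complex :: "'a set set \<Rightarrow> bool" where
  "simplicial_complex K \<longleftrightarrow>
     finite (\<Union>K) \<and> (\<forall>\<sigma>\<in>K. \<forall>\<tau>. \<tau> \<subseteq> \<sigma> \<longrightarrow> \<tau> \<noteq> {} \<longrightarrow> \<tau> \<in> K)"

lemma simplicial_complexD:
  assumes "simplicial_complex K"
  shows "finite (\<Union>K)" "\<And>\<sigma> \<tau>. \<sigma> \<in> K \<Longrightarrow> \<tau> \<subseteq> \<sigma> \<Longrightarrow> \<tau> \<noteq> {} \<Longrightarrow> \<tau> \<in> K"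
  using assms unfolding simplicial_complex_def by blast+

lemma homology_cosets:
  fixes K :: "'a set set" and k :: nat
  assumes cx: "simplicial_complex K"
  defines "C \<equiv> cycle_space k K :: ('f::field, 'a list \<Rightarrow> 'f) module"
  defines "H \<equiv> homology k K :: ('f, ('a list \<Rightarrow> 'f) set) module"
  defines "cls \<equiv> \<lambda>z. boundaries k K +>\<^bsub>C\<^esub> z"
  shows "carrier H = cls ` cycles k K"
    and "\<And>z y. z \<in> cycles k K \<Longrightarrow> y \<in> cycles k K \<Longrightarrow> cls z \<oplus>\<^bsub>H\<^esub> cls y = cls (\<lambda>vs. z vs + y vs)"
    and "\<And>z r. z \<in> cycles k K \<Longrightarrow> r \<odot>\<^bsub>H\<^esub> cls z = cls (\<lambda>vs. r * z vs)"
    and "\<And>z y. y \<in> cls z \<longleftrightarrow> (\<exists>n\<in>boundaries k K. y = (\<lambda>vs. z vs + n vs))"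
    and "\<And>z. z \<in> cycles k K \<Longrightarrow> z \<in> cls z"
    and "\<And>z y. z \<in> cycles k K \<Longrightarrow> y \<in> cls z \<Longrightarrow> cls y = cls z"
    and "\<And>(z :: 'a list \<Rightarrow> 'f) y q. z \<in> cycles k K \<Longrightarrow> y \<in> cycles k K \<Longrightarrow> (\<lambda>vs. z vs + q * y vs) \<in> cycles k K"
    and "boundaries k K \<subseteq> (cycles k K :: ('a list \<Rightarrow> 'f) set)"
    and "(\<lambda>_. 0) \<in> (cycles k K :: ('a list \<Rightarrow> 'f) set)"
proof -
  note fin = simplicial_complexD(1)[OF cx] and cl = simplicial_complexD(2)[OF cx]
  interpret V: Module.module field_ring C
    unfolding C_def by (rule module_cycle_space[OF fin])
  have bs: "additive_subgroup (boundaries k K) C" "\<And>x r. x \<in> boundaries k K \<Longrightarrow> r \<odot>\<^bsub>C\<^esub> x \<in> boundaries k K"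
    unfolding C_def by (rule boundaries_sub[OF fin cl]; assumption)+
  interpret N: abelian_subgroup "boundaries k K" C
    by (rule abelian_subgroupI3) (use bs V.abelian_group_axioms in auto)
  have op: "carrier C = cycles k K" "z \<oplus>\<^bsub>C\<^esub> y = (\<lambda>vs. z vs + y vs)" "r \<odot>\<^bsub>C\<^esub> z = (\<lambda>vs. r * z vs)"
    "\<zero>\<^bsub>C\<^esub> = (\<lambda>_. 0)" for z y r
    by (simp_all add: cycle_space_def C_def)
  have H: "H = quotient_space C (boundaries k K)" by (simp add: H_def homology_def C_def)
  show "carrier H = cls ` cycles k K"
    by (auto simp: H quotient_space_def A_RCOSETS_def' cls_def op)
  show "cls z \<oplus>\<^bsub>H\<^esub> cls y = cls (\<lambda>vs. z vs + y vs)" if "z \<in> cycles k K" "y \<in> cycles k K" for z y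
    using N.a_rcos_sum[of z y] that by (simp add: H quotient_space_def cls_def op)
  show "r \<odot>\<^bsub>H\<^esub> cls z = cls (\<lambda>vs. r * z vs)" if "z \<in> cycles k K" for z r
    using module_quotient_space(2)[OF V.module_axioms bs(1) bs(2), of z r] that
    by (simp add: H cls_def op)
  show mem: "y \<in> cls z \<longleftrightarrow> (\<exists>n\<in>boundaries k K. y = (\<lambda>vs. z vs + n vs))" for z y
    by (auto simp: cls_def a_r_coset_def' op add.commute)
  show self: "z \<in> cls z" if "z \<in> cycles k K" for z
    using N.a_rcos_self[of z] that by (simp add: cls_def op)
  show "cls y = cls z" if "z \<in> cycles k K" "y \<in> cls z" for y z
    using N.a_repr_independence'[of y z] that by (simp add: cls_def op)
  show "(\<lambda>vs. z vs + q * y vs) \<in> cycles k K" if "z \<in> cycles k K" "y \<in> cycles k K" for z y :: "'a list \<Rightarrow> 'f" and q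
  proof -
    have "q \<odot>\<^bsub>C\<^esub> y \<in> carrier C" using V.smult_closed[of q y] that by (simp add: field_ring_def op)
    then show ?thesis using V.a_closed[of z "q \<odot>\<^bsub>C\<^esub> y"] that by (simp add: op)
  qed
  show "boundaries k K \<subseteq> (cycles k K :: ('a list \<Rightarrow> 'f) set)"
    using N.a_subset by (simp add: op)
  show "(\<lambda>_. 0) \<in> (cycles k K :: ('a list \<Rightarrow> 'f) set)"
    using V.zero_closed by (simp add: op)
qed

lemma sublevel_complex:
  assumes S: "finite S" and \<phi>: "filtration S \<phi>"
  shows "simplicial_complex (sublevel S \<phi> t)"
  unfolding simplicial_complex_def
proof (intro conjI ballI allI impI)
  show "finite (\<Union>(sublevel S \<phi> t))"
    by (rule finite_subset[OF _ S]) (auto simp: sublevel_def pow_ne_def Fpow_def)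
  fix \<sigma> \<tau> assume *: "\<sigma> \<in> sublevel S \<phi> t" "\<tau> \<subseteq> \<sigma>" "\<tau> \<noteq> {}"
  then have \<sigma>: "\<sigma> \<in> pow_ne S" "\<phi> \<sigma> \<le> t" by (auto simp: sublevel_def)
  moreover have "\<tau> \<in> pow_ne S"
    using \<sigma> * by (auto simp: pow_ne_def Fpow_def intro: finite_subset)
  moreover have "\<phi> \<tau> \<le> \<phi> \<sigma>" using \<phi> calculation * unfolding filtration_def by blast
  ultimately show "\<tau> \<in> sublevel S \<phi> t" by (auto simp: sublevel_def)
qed

lemma sublevel_mono: "s \<le> t \<Longrightarrow> sublevel S \<phi> s \<subseteq> sublevel S \<phi> t"
  by (auto simp: sublevel_def)

lemma interval_sum_simps:
  "c \<oplus>\<^bsub>interval_sum Is t\<^esub> d = (\<lambda>i. c i + d i)" "r \<odot>\<^bsub>interval_sum Is t\<^esub> c = (\<lambda>i. r * c i)"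
  by (simp_all add: interval_sum_def)

text \<open>The kernel of \<open>\<Lambda> t\<close> is the space of boundaries, so its value at any
  representative of a homology class is the same; the isomorphism \<Psi> evaluates it at a chosen
  one.\<close>

lemma is_barcode_cycle_coordinates:
  fixes \<Lambda> :: "real \<Rightarrow> ('a list \<Rightarrow> 'f::field) \<Rightarrow> nat \<Rightarrow> 'f"
  assumes S: "finite S" and \<phi>: "filtration S \<phi>"
    and bars: "\<And>b d. (b, d) \<in> set Is \<Longrightarrow> 0 \<le> b \<and> ereal b < d"
    and \<Lambda>: "cycle_coordinates k (sublevel S \<phi>) Is \<Lambda>"
  shows "is_barcode (\<lambda>t. homology k (sublevel S \<phi> t) :: ('f, ('a list \<Rightarrow> 'f) set) module)
     (\<lambda>s t. homology_map k (sublevel S \<phi> t)) (mset Is)"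
proof -
  let ?K = "sublevel S \<phi>"
  let ?H = "\<lambda>t. homology k (?K t) :: ('f, ('a list \<Rightarrow> 'f) set) module"
  let ?cls = "\<lambda>t z. boundaries k (?K t) +>\<^bsub>(cycle_space k (?K t) :: ('f, 'a list \<Rightarrow> 'f) module)\<^esub> z"
  let ?I = "\<lambda>t. interval_sum Is t :: ('f, _) module"
  note cx = sublevel_complex[OF S \<phi>]
  note hc = homology_cosets[OF cx]
  have lin: "\<Lambda> t (\<lambda>vs. x vs + q * y vs) = (\<lambda>i. \<Lambda> t x i + q * \<Lambda> t y i)"
    if "0 \<le> t" "x \<in> cycles k (?K t)" "y \<in> cycles k (?K t)" for t x y q
    using \<Lambda> that unfolding cycle_coordinates_def by blast
  have img: "\<Lambda> t ` cycles k (?K t) = carrier (?I t)" if "0 \<le> t" for t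
    using \<Lambda> that unfolding cycle_coordinates_def by blast
  have ker: "\<Lambda> t x = (\<lambda>_. 0) \<longleftrightarrow> x \<in> boundaries k (?K t)" if "0 \<le> t" "x \<in> cycles k (?K t)" for t x
    using \<Lambda> that unfolding cycle_coordinates_def by blast
  have nat: "\<Lambda> t x = interval_sum_map Is s t (\<Lambda> s x)" if "0 \<le> s" "s \<le> t" "x \<in> cycles k (?K s)" for s t x
    using \<Lambda> that unfolding cycle_coordinates_def by blast
  define \<Psi> where "\<Psi> t A = \<Lambda> t (SOME z. z \<in> A)" for t A
  have \<Psi>: "\<Psi> t (?cls t z) = \<Lambda> t z" if t: "0 \<le> t" and z: "z \<in> cycles k (?K t)" for t z
  proof -
    have "(SOME y. y \<in> ?cls t z) \<in> ?cls t z" by (rule someI[of "\<lambda>y. y \<in> ?cls t z" z, OF hc(5)[OF z]])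
    then obtain n where n: "n \<in> boundaries k (?K t)" "(SOME y. y \<in> ?cls t z) = (\<lambda>vs. z vs + n vs)"
      unfolding hc(4) by blast
    then have nc: "n \<in> cycles k (?K t)" using hc(8) by blast
    then have "\<Lambda> t n = (\<lambda>_. 0)" using ker[OF t] n by blast
    then show ?thesis using lin[OF t z nc, of 1] by (simp add: \<Psi>_def n(2))
  qed
  have neg: "(\<lambda>vs. z vs + (-1) * y vs) \<in> boundaries k (?K t) \<Longrightarrow> z \<in> ?cls t y" for t z y
    unfolding hc(4) by (rule bexI[of _ "\<lambda>vs. z vs + (-1) * y vs"]) auto
  have "\<Psi> t \<in> linear_maps (?H t) (?I t) \<and> bij_betw (\<Psi> t) (carrier (?H t)) (carrier (?I t))"
    if t: "0 \<le> t" for t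
  proof
    show "\<Psi> t \<in> linear_maps (?H t) (?I t)"
      unfolding linear_maps_def
    proof (intro CollectI conjI ballI allI Pi_I)
      fix A assume "A \<in> carrier (?H t)"
      then obtain z where z: "z \<in> cycles k (?K t)" "A = ?cls t z" unfolding hc(1) by blast
      show "\<Psi> t A \<in> carrier (?I t)" unfolding z(2) \<Psi>[OF t z(1)] using img[OF t] z(1) by blast
      have zero: "\<Lambda> t (\<lambda>_. 0) = (\<lambda>_. 0)"
        using lin[OF t z(1) z(1), of "-1"] by simp
      show "\<Psi> t (r \<odot>\<^bsub>?H t\<^esub> A) = r \<odot>\<^bsub>?I t\<^esub> \<Psi> t A" for r
      proof -
        have "(\<lambda>vs. r * z vs) \<in> cycles k (?K t)" using hc(7)[OF hc(9) z(1), of r] by simp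
        then show ?thesis
          unfolding z(2) hc(3)[OF z(1)] \<Psi>[OF t z(1)] using lin[OF t hc(9) z(1), of r] zero
          by (simp add: \<Psi>[OF t] interval_sum_simps)
      qed
      fix B assume "B \<in> carrier (?H t)"
      then obtain y where y: "y \<in> cycles k (?K t)" "B = ?cls t y" unfolding hc(1) by blast
      show "\<Psi> t (A \<oplus>\<^bsub>?H t\<^esub> B) = \<Psi> t A \<oplus>\<^bsub>?I t\<^esub> \<Psi> t B"
      proof -
        have "(\<lambda>vs. z vs + y vs) \<in> cycles k (?K t)" using hc(7)[OF z(1) y(1), of 1] by simp
        then show ?thesis
          unfolding z(2) y(2) hc(2)[OF z(1) y(1)] \<Psi>[OF t z(1)] \<Psi>[OF t y(1)]
          using lin[OF t z(1) y(1), of 1] by (simp add: \<Psi>[OF t] interval_sum_simps)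
      qed
    qed
    have "inj_on (\<Psi> t) (carrier (?H t))"
    proof (rule inj_onI)
      fix A B assume "A \<in> carrier (?H t)" "B \<in> carrier (?H t)" and eq: "\<Psi> t A = \<Psi> t B"
      then obtain z y where z: "z \<in> cycles k (?K t)" "A = ?cls t z"
        and y: "y \<in> cycles k (?K t)" "B = ?cls t y" unfolding hc(1) by blast
      have "\<Lambda> t (\<lambda>vs. z vs + (-1) * y vs) = (\<lambda>_. 0)"
        using lin[OF t z(1) y(1), of "-1"] eq \<Psi>[OF t z(1)] \<Psi>[OF t y(1)] z(2) y(2) by simp
      then have "z \<in> ?cls t y" using ker[OF t hc(7)[OF z(1) y(1)]] neg by blast
      then show "A = B" using hc(6)[OF y(1)] z(2) y(2) by simp
    qed
    moreover have "\<Psi> t ` carrier (?H t) = carrier (?I t)"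
      unfolding hc(1) img[OF t, symmetric] image_image using \<Psi>[OF t] by (intro image_cong) auto
    ultimately show "bij_betw (\<Psi> t) (carrier (?H t)) (carrier (?I t))" by (simp add: bij_betw_def)
  qed
  moreover have "\<Psi> t (homology_map k (?K t) A) = interval_sum_map Is s t (\<Psi> s A)"
    if st: "0 \<le> s" "s \<le> t" and A: "A \<in> carrier (?H s)" for s t A
  proof -
    obtain z where z: "z \<in> cycles k (?K s)" "A = ?cls s z" using A unfolding hc(1) by blast
    have "z \<in> cycles k (?K t)" using z(1) cycles_mono[OF sublevel_mono[OF st(2)]] by blast
    moreover have "homology_map k (?K t) (?cls s z) = ?cls t z"
      by (rule homology_map_coset[OF simplicial_complexD(1)[OF cx] simplicial_complexD(2)[OF cx] simplicial_complexD(2)[OF cx] sublevel_mono[OF st(2)] z(1)])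
    ultimately show ?thesis using nat[OF st z(1)] \<Psi> st z by simp
  qed
  ultimately show ?thesis
    unfolding is_barcode_def using bars by (intro exI[of _ Is]) blast
qed

section \<open>Bars read off a normal form\<close>

definition death :: "('a set \<Rightarrow> real) \<Rightarrow> 'a set set \<Rightarrow> ('a set \<Rightarrow> 'a set option) \<Rightarrow> 'a set \<Rightarrow> ereal" where
  "death \<phi> K b \<sigma> = (if killed K b \<sigma> then ereal (\<phi> (killer K b \<sigma>)) else \<infinity>)"

text \<open>Positive in the sense of matrix reduction: the simplex enters with a new cycle. Each one
  is the birth of a bar of degree \<open>k\<close>, possibly an empty one.\<close>

definition positive_simplices :: "nat \<Rightarrow> 'a set set \<Rightarrow> ('a set \<Rightarrow> 'a set option) \<Rightarrow> 'a set set" where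
  "positive_simplices k K b = {\<sigma>\<in>K. card \<sigma> = Suc k \<and> b \<sigma> = None}"

text \<open>This multiset may contain empty bars \<open>(x, x)\<close>.\<close>

definition all_bars ::
    "nat \<Rightarrow> ('a set \<Rightarrow> real) \<Rightarrow> 'a set set \<Rightarrow> ('a set \<Rightarrow> 'a set option) \<Rightarrow> bar multiset" where
  "all_bars k \<phi> K b = {#(\<phi> \<sigma>, death \<phi> K b \<sigma>). \<sigma> \<in># mset_set (positive_simplices k K b)#}"

definition proper_bar :: "bar \<Rightarrow> bool" where
  "proper_bar I \<longleftrightarrow> ereal (fst I) < snd I"

lemma simplices_pow_ne: "finite S \<Longrightarrow> simplices (pow_ne S)"
  unfolding simplices_def pow_ne_def Fpow_def by auto

text \<open>The normal form refers to the order \<open>r\<close> alone; the filtration enters only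
  through \<open>compatible\<close>, which permits ties. Two filtrations compatible with one order
  therefore share \<open>c\<close> and \<open>b\<close>, and their bars are indexed by the same
  simplices.\<close>

locale filtered_normal_form =
  fixes S :: "'a set" and \<phi> :: "'a set \<Rightarrow> real" and r :: "'a set \<Rightarrow> nat"
    and c :: "'a set \<Rightarrow> 'a list \<Rightarrow> 'f::field" and b :: "'a set \<Rightarrow> 'a set option"
  assumes finite_S: "finite S" and filtration: "filtration S \<phi>"
    and inj: "inj_on r (pow_ne S)"
    and nf: "normal_form r (pow_ne S) c b"
    and compatible: "\<And>\<sigma> \<tau>. \<sigma> \<in> pow_ne S \<Longrightarrow> \<tau> \<in> pow_ne S \<Longrightarrow> r \<sigma> \<le> r \<tau> \<Longrightarrow> \<phi> \<sigma> \<le> \<phi> \<tau>"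
begin

abbreviation "P \<equiv> pow_ne S"
abbreviation "K \<equiv> sublevel S \<phi>"

lemma simplices_P: "simplices P"
  by (rule simplices_pow_ne[OF finite_S])

lemma finite_P: "finite P"
  using simplices_P by (simp add: simplices_def)

lemmas tri = normal_form_triangular[OF nf]

lemma segment_K: "initial_segment r P (K t)"
  unfolding initial_segment_def sublevel_def using compatible by fastforce

lemma in_K: "\<sigma> \<in> K t \<longleftrightarrow> \<sigma> \<in> P \<and> \<phi> \<sigma> \<le> t"
  by (simp add: sublevel_def)

definition comb :: "('a set \<Rightarrow> 'f) \<Rightarrow> 'a list \<Rightarrow> 'f" where
  "comb a = (\<lambda>vs. \<Sum>\<sigma>\<in>P. a \<sigma> * c \<sigma> vs)"

text \<open>The expansion is unique when it exists (\<open>comb_inj\<close>); the support condition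
  fixes the values off \<open>P\<close>.\<close>

definition coord :: "('a list \<Rightarrow> 'f) \<Rightarrow> 'a set \<Rightarrow> 'f" where
  "coord x = (SOME a. (\<forall>\<sigma>. a \<sigma> \<noteq> 0 \<longrightarrow> \<sigma> \<in> P) \<and> x = comb a)"

lemma comb_inj:
  assumes "comb a = comb a'" "\<And>\<sigma>. a \<sigma> \<noteq> 0 \<Longrightarrow> \<sigma> \<in> P" "\<And>\<sigma>. a' \<sigma> \<noteq> 0 \<Longrightarrow> \<sigma> \<in> P"
  shows "a = a'"
proof
  fix \<sigma>
  show "a \<sigma> = a' \<sigma>"
  proof (cases "\<sigma> \<in> P")
    case True
    have "(\<Sum>\<sigma>\<in>P. (a \<sigma> - a' \<sigma>) * c \<sigma> vs) = 0" for vs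
      using fun_cong[OF assms(1), of vs] by (simp add: comb_def left_diff_distrib sum_subtractf)
    from triangular_independent[OF simplices_P inj tri this True] show ?thesis by simp
  next
    case False
    then show ?thesis using assms(2,3) by metis
  qed
qed

lemma coord_comb:
  assumes "\<And>\<sigma>. a \<sigma> \<noteq> 0 \<Longrightarrow> \<sigma> \<in> P"
  shows "coord (comb a) = a"
proof -
  have "(\<forall>\<sigma>. coord (comb a) \<sigma> \<noteq> 0 \<longrightarrow> \<sigma> \<in> P) \<and> comb a = comb (coord (comb a))"
    unfolding coord_def by (rule someI[of _ a]) (use assms in blast)
  then show ?thesis using comb_inj assms by metis
qed

lemma chain_coord:
  assumes "x \<in> chains k (K t)"
  shows "x = comb (coord x)" "\<And>\<sigma>. coord x \<sigma> \<noteq> 0 \<Longrightarrow> \<sigma> \<in> P \<and> \<phi> \<sigma> \<le> t \<and> card \<sigma> = Suc k"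
proof -
  obtain a where a: "\<And>\<sigma>. a \<sigma> \<noteq> 0 \<Longrightarrow> \<sigma> \<in> K t \<and> card \<sigma> = Suc k" "x = comb a"
    using triangular_span[OF simplices_P inj tri segment_K assms] unfolding comb_def by blast
  then have "coord x = a" using coord_comb[of a] in_K by blast
  then show "x = comb (coord x)" "\<And>\<sigma>. coord x \<sigma> \<noteq> 0 \<Longrightarrow> \<sigma> \<in> P \<and> \<phi> \<sigma> \<le> t \<and> card \<sigma> = Suc k"
    using a in_K by blast+
qed

lemma comb_chains:
  assumes "\<And>\<sigma>. a \<sigma> \<noteq> 0 \<Longrightarrow> \<sigma> \<in> K t \<and> card \<sigma> = Suc k"
  shows "comb a \<in> chains k (K t)"
  unfolding comb_def
proof (rule chains_linear_combination)
  fix \<sigma> assume "a \<sigma> \<noteq> 0"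
  then have "\<sigma> \<in> K t" "card \<sigma> - 1 = k" using assms by auto
  then show "c \<sigma> \<in> chains k (K t)" using triangular_chains_segment[OF tri segment_K] by metis
qed

lemma boundary_comb:
  "boundary (comb a) = comb (\<lambda>\<sigma>. if killed P b \<sigma> then a (killer P b \<sigma>) else 0)"
  unfolding comb_def by (rule boundary_normal_form[OF simplices_P nf])

lemma cycle_coord:
  assumes x: "x \<in> cycles k (K t)" and \<sigma>: "coord x \<sigma> \<noteq> 0"
  shows "\<sigma> \<in> positive_simplices k P b" "\<phi> \<sigma> \<le> t"
proof -
  have xc: "x \<in> chains k (K t)" and 0: "boundary x = (\<lambda>_. 0)" using x by (auto simp: cycles_def)
  note cc = chain_coord[OF xc]
  have \<sigma>': "\<sigma> \<in> P" "card \<sigma> = Suc k" "\<phi> \<sigma> \<le> t" using cc(2)[OF \<sigma>] by auto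
  have "boundary (\<lambda>vs. \<Sum>\<tau>\<in>P. coord x \<tau> * c \<tau> vs) = (\<lambda>_. 0)"
    using 0 cc(1) unfolding comb_def by simp
  then have "b \<sigma> = None"
    using normal_form_cycle_coefficient[OF simplices_P inj nf _ \<sigma>'(1)] \<sigma> by blast
  then show "\<sigma> \<in> positive_simplices k P b" "\<phi> \<sigma> \<le> t" using \<sigma>' by (auto simp: positive_simplices_def)
qed

lemma coord_lin:
  assumes "x \<in> chains k (K t)" "y \<in> chains k (K t)"
  shows "coord (\<lambda>vs. x vs + q * y vs) = (\<lambda>\<sigma>. coord x \<sigma> + q * coord y \<sigma>)"
proof -
  note x = chain_coord[OF assms(1)] and y = chain_coord[OF assms(2)]
  have "(\<lambda>vs. x vs + q * y vs) = comb (\<lambda>\<sigma>. coord x \<sigma> + q * coord y \<sigma>)"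
    by (subst x(1), subst y(1))
      (simp add: comb_def sum.distrib sum_distrib_left distrib_right mult.assoc)
  moreover have "\<sigma> \<in> P" if "coord x \<sigma> + q * coord y \<sigma> \<noteq> 0" for \<sigma>
    using that x(2) y(2) by (metis add_0 mult_zero_right)
  ultimately show ?thesis using coord_comb[of "\<lambda>\<sigma>. coord x \<sigma> + q * coord y \<sigma>"] by simp
qed

text \<open>Expand a cycle in the basis \<open>c\<close> and keep the coefficient at \<sigma> while
  the bar of \<sigma> is alive. What is forgotten at \<open>t\<close> are the coefficients at
  simplices killed by time \<open>t\<close>, and these make up exactly the boundaries. Simplices
  with empty bars are never alive and need no coordinate.\<close>

lemma cycle_coordinates_exist:
  assumes ps: "distinct ps"
    "set ps = {\<sigma> \<in> positive_simplices k P b. ereal (\<phi> \<sigma>) < death \<phi> P b \<sigma>}"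
  shows "\<exists>\<Lambda>. cycle_coordinates k K (map (\<lambda>\<sigma>. (\<phi> \<sigma>, death \<phi> P b \<sigma>)) ps) (\<Lambda> :: real \<Rightarrow> ('a list \<Rightarrow> 'f) \<Rightarrow> nat \<Rightarrow> 'f)"
proof -
  let ?n = "length ps"
  let ?bar = "\<lambda>\<sigma>. (\<phi> \<sigma>, death \<phi> P b \<sigma>)"
  let ?Is = "map ?bar ps"
  define \<Lambda> :: "real \<Rightarrow> ('a list \<Rightarrow> 'f) \<Rightarrow> nat \<Rightarrow> 'f" where
    "\<Lambda> t x i = (if i < ?n \<and> in_bar t (?bar (ps ! i)) then coord x (ps ! i) else 0)" for t x i
  have cyc: "x \<in> chains k (K t)" if "x \<in> cycles k (K t)" for x t using that by (simp add: cycles_def)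
  have lin: "\<Lambda> t (\<lambda>vs. x vs + q * y vs) = (\<lambda>i. \<Lambda> t x i + q * \<Lambda> t y i)"
    if "x \<in> cycles k (K t)" "y \<in> cycles k (K t)" for t x y q
    unfolding \<Lambda>_def using coord_lin[OF cyc cyc, OF that] by auto
  have nat: "\<Lambda> t x = interval_sum_map ?Is s t (\<Lambda> s x)" if "s \<le> t" "x \<in> cycles k (K s)" for s t x
  proof
    fix i
    \<comment> \<open>A bar alive at \<open>t\<close> but not at \<open>s\<close> is born after
      \<open>s\<close>, so its simplex cannot occur in a cycle at \<open>s\<close>. Hence
      coordinates are lost only by death.\<close>
    have "coord x (ps ! i) = 0" if "in_bar t (?bar (ps ! i))" "\<not> in_bar s (?bar (ps ! i))"
    proof -
      have "ereal s < death \<phi> P b (ps ! i)"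
        using that(1) \<open>s \<le> t\<close> le_less_trans[of "ereal s" "ereal t"] by (simp add: in_bar_def)
      then have "\<not> \<phi> (ps ! i) \<le> s" using that(2) by (auto simp: in_bar_def)
      then show ?thesis using cycle_coord(2)[OF \<open>x \<in> cycles k (K s)\<close>] by blast
    qed
    then show "\<Lambda> t x i = interval_sum_map ?Is s t (\<Lambda> s x) i"
      unfolding \<Lambda>_def interval_sum_map_def by auto
  qed
  have sub: "\<Lambda> t x \<in> carrier (interval_sum ?Is t)" for t x
    by (auto simp: \<Lambda>_def interval_sum_def)
  have sur: "\<exists>x\<in>cycles k (K t). \<Lambda> t x = d" if d: "d \<in> carrier (interval_sum ?Is t)" for t d
  proof -
    define idx where "idx = inv_into {..<?n} ((!) ps)"
    have bij: "bij_betw ((!) ps) {..<?n} (set ps)" using ps(1) by (rule bij_betw_nth) auto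
    have idx: "idx (ps ! i) = i" if "i < ?n" for i
      using bij_betw_inv_into_left[OF bij] that unfolding idx_def by simp
    define a where "a \<sigma> = (if \<sigma> \<in> set ps then d (idx \<sigma>) else 0)" for \<sigma>
    have ap: "a (ps ! i) = d i" if "i < ?n" for i using that idx by (simp add: a_def)
    have supp: "\<sigma> \<in> P \<and> \<phi> \<sigma> \<le> t \<and> card \<sigma> = Suc k \<and> b \<sigma> = None" if nz: "a \<sigma> \<noteq> 0" for \<sigma>
    proof -
      have "\<sigma> \<in> set ps" using nz by (auto simp: a_def split: if_splits)
      then obtain i where i: "i < ?n" "\<sigma> = ps ! i" by (metis in_set_conv_nth)
      then have "in_bar t (?bar \<sigma>)" using d ap nz by (auto simp: interval_sum_def)
      then show ?thesis using \<open>\<sigma> \<in> set ps\<close> ps(2) by (auto simp: in_bar_def positive_simplices_def)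
    qed
    have "comb a \<in> chains k (K t)" by (rule comb_chains) (use supp in_K in blast)
    moreover have "a (killer P b \<sigma>) = 0" if kd: "killed P b \<sigma>" for \<sigma>
    proof -
      obtain \<tau> where \<tau>: "\<tau> \<in> P" "b \<tau> = Some \<sigma>" using kd by (auto simp: killed_def)
      then show ?thesis using killer_eq[OF nf \<tau>] supp[of \<tau>] by force
    qed
    then have "boundary (comb a) = (\<lambda>_. 0)" by (subst boundary_comb) (auto simp: comb_def fun_eq_iff intro!: sum.neutral)
    ultimately have "comb a \<in> cycles k (K t)" by (simp add: cycles_def)
    moreover have "coord (comb a) = a" by (rule coord_comb) (use supp in blast)
    then have "\<Lambda> t (comb a) = d" using d ap by (fastforce simp: \<Lambda>_def interval_sum_def)
    ultimately show ?thesis by blast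
  qed
  have ker1: "\<Lambda> t x = (\<lambda>_. 0)" if x: "x \<in> boundaries k (K t)" for t x
  proof
    fix i
    obtain y where y: "y \<in> chains (Suc k) (K t)" "x = boundary y" using x by (auto simp: boundaries_def)
    note yc = chain_coord[OF y(1)]
    let ?a = "\<lambda>\<sigma>. if killed P b \<sigma> then coord y (killer P b \<sigma>) else 0"
    have "x = comb ?a" unfolding y(2) by (rule trans[OF arg_cong[OF yc(1), of boundary] boundary_comb])
    have supp: "\<sigma> \<in> P" if "?a \<sigma> \<noteq> 0" for \<sigma>
      using that normal_form_Some(2)[OF nf] by (auto simp: killed_def split: if_splits)
    have xa: "coord x = ?a" unfolding \<open>x = comb ?a\<close> by (rule coord_comb) (rule supp)
    show "\<Lambda> t x i = 0"
    proof (rule ccontr)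
      assume "\<Lambda> t x i \<noteq> 0"
      then have i: "in_bar t (?bar (ps ! i))" "?a (ps ! i) \<noteq> 0"
        by (auto simp: \<Lambda>_def xa split: if_splits)
      then have k: "killed P b (ps ! i)" "coord y (killer P b (ps ! i)) \<noteq> 0" by (auto split: if_splits)
      then have "\<phi> (killer P b (ps ! i)) \<le> t" using yc(2) by blast
      then show False using i(1) k(1) by (auto simp: in_bar_def death_def)
    qed
  qed
  have ker2: "x \<in> boundaries k (K t)" if x: "x \<in> cycles k (K t)" and 0: "\<Lambda> t x = (\<lambda>_. 0)" for t x
  proof -
    \<comment> \<open>Otherwise the bar of \<sigma> would be alive at \<open>t\<close>, thus not
      empty and listed in \<open>ps\<close>, and the coordinate that is assumed to vanish would be
      \<open>coord x \<sigma>\<close>.\<close>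
    have kl: "killed P b \<sigma> \<and> \<phi> (killer P b \<sigma>) \<le> t" if \<sigma>: "coord x \<sigma> \<noteq> 0" for \<sigma>
    proof (rule ccontr)
      assume "\<not> (killed P b \<sigma> \<and> \<phi> (killer P b \<sigma>) \<le> t)"
      then have "ereal t < death \<phi> P b \<sigma>" by (auto simp: death_def)
      moreover note p = cycle_coord[OF x \<sigma>]
      ultimately have bar: "in_bar t (?bar \<sigma>)" by (simp add: in_bar_def)
      have "ereal (\<phi> \<sigma>) \<le> ereal t" using p(2) by simp
      then have "ereal (\<phi> \<sigma>) < death \<phi> P b \<sigma>" using \<open>ereal t < _\<close> by (rule le_less_trans)
      then have "\<sigma> \<in> set ps" using ps(2) p(1) by simp
      then obtain i where i: "i < ?n" "\<sigma> = ps ! i" by (metis in_set_conv_nth)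
      then have "\<Lambda> t x i = coord x \<sigma>" using bar by (simp add: \<Lambda>_def)
      then show False using \<sigma> fun_cong[OF 0, of i] by simp
    qed
    \<comment> \<open>The filling chain: each coefficient of \<open>x\<close> is moved from a
      simplex to its killer, which has entered by time \<open>t\<close> by
      \<open>kl\<close>.\<close>
    define a where "a \<tau> = (if \<tau> \<in> P then case b \<tau> of None \<Rightarrow> 0 | Some \<sigma> \<Rightarrow> coord x \<sigma> else 0)" for \<tau>
    have supp: "\<tau> \<in> K t \<and> card \<tau> = Suc (Suc k)" if "a \<tau> \<noteq> 0" for \<tau>
    proof -
      obtain \<sigma> where \<sigma>: "\<tau> \<in> P" "b \<tau> = Some \<sigma>" "coord x \<sigma> \<noteq> 0"
        using \<open>a \<tau> \<noteq> 0\<close> by (auto simp: a_def split: if_splits option.splits)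
      have "\<phi> \<tau> \<le> t" using kl[OF \<sigma>(3)] killer_eq[OF nf \<sigma>(1,2)] by simp
      moreover have "card \<sigma> = Suc k" using cycle_coord(1)[OF x \<sigma>(3)] by (simp add: positive_simplices_def)
      ultimately show ?thesis using \<sigma> in_K normal_form_Some(4)[OF nf \<sigma>(1,2)] by simp
    qed
    have "(if killed P b \<sigma> then a (killer P b \<sigma>) else 0) = coord x \<sigma>" for \<sigma>
    proof (cases "killed P b \<sigma>")
      case True
      then obtain \<tau> where \<tau>: "\<tau> \<in> P" "b \<tau> = Some \<sigma>" by (auto simp: killed_def)
      then show ?thesis using killer_eq[OF nf \<tau>] True by (simp add: a_def)
    next
      case False
      then show ?thesis using kl[of \<sigma>] by (cases "coord x \<sigma> = 0") auto
    qed
    then have "boundary (comb a) = comb (coord x)" unfolding boundary_comb by simp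
    also have "\<dots> = x" using chain_coord(1)[OF cyc[OF x]] by simp
    finally show ?thesis using comb_chains[of a t "Suc k"] supp
      unfolding boundaries_def by blast
  qed
  have "cycle_coordinates k K ?Is \<Lambda>"
    unfolding cycle_coordinates_def
  proof (intro conjI allI ballI impI)
    fix t
    show "\<Lambda> t ` cycles k (K t) = carrier (interval_sum ?Is t)" using sub sur by blast
  qed (use lin nat ker1 ker2 in blast)+
  then show ?thesis by blast
qed

lemma is_barcode_all_bars:
  "is_barcode (\<lambda>t. homology k (K t) :: ('f, ('a list \<Rightarrow> 'f) set) module)
     (\<lambda>s t. homology_map k (K t)) (filter_mset proper_bar (all_bars k \<phi> P b))"
proof -
  let ?bar = "\<lambda>\<sigma>. (\<phi> \<sigma>, death \<phi> P b \<sigma>)"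
  let ?A = "{\<sigma> \<in> positive_simplices k P b. ereal (\<phi> \<sigma>) < death \<phi> P b \<sigma>}"
  have fin: "finite (positive_simplices k P b)" using finite_P by (simp add: positive_simplices_def)
  then obtain ps where ps: "set ps = ?A" "distinct ps" using finite_distinct_list[of ?A] by auto
  obtain \<Lambda> :: "real \<Rightarrow> ('a list \<Rightarrow> 'f) \<Rightarrow> nat \<Rightarrow> 'f" where
    \<Lambda>: "cycle_coordinates k K (map ?bar ps) \<Lambda>" using cycle_coordinates_exist[OF ps(2,1)] by blast
  have "0 \<le> \<phi> \<sigma>" if "\<sigma> \<in> P" for \<sigma> using filtration that by (simp add: filtration_def)
  then have "0 \<le> x \<and> ereal x < y" if "(x, y) \<in> set (map ?bar ps)" for x y
    using that ps by (auto simp: positive_simplices_def)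
  from is_barcode_cycle_coordinates[OF finite_S filtration this \<Lambda>]
  have "is_barcode (\<lambda>t. homology k (K t) :: ('f, ('a list \<Rightarrow> 'f) set) module)
     (\<lambda>s t. homology_map k (K t)) (mset (map ?bar ps))" .
  moreover have "mset (map ?bar ps) = filter_mset proper_bar (all_bars k \<phi> P b)"
    using ps fin by (simp add: all_bars_def filter_mset_image_mset proper_bar_def
      filter_mset_mset_set flip: mset_set_set)
  ultimately show ?thesis by simp
qed

end

section \<open>Matchings of bars\<close>

definition empty_bars :: "bar multiset \<Rightarrow> bool" where
  "empty_bars P \<longleftrightarrow> (\<forall>I\<in>#P. snd I = ereal (fst I))"

text \<open>Pairing a bar with an added empty bar stands for leaving it unmatched. Bijections of
  padded multisets compose directly, which partial matchings with costs for leftover bars do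
  not.\<close>

definition bars_close :: "real \<Rightarrow> bar multiset \<Rightarrow> bar multiset \<Rightarrow> bool" where
  "bars_close \<epsilon> D E \<longleftrightarrow>
     (\<exists>P Q. empty_bars P \<and> empty_bars Q \<and> rel_mset (\<lambda>I J. bar_dist I J \<le> ereal \<epsilon>) (D + P) (E + Q))"

lemma bar_dist_le_iff:
  "bar_dist I J \<le> ereal \<epsilon> \<longleftrightarrow> \<bar>fst I - fst J\<bar> \<le> \<epsilon> \<and>
     (snd I = snd J \<or> (\<exists>x y. snd I = ereal x \<and> snd J = ereal y \<and> \<bar>x - y\<bar> \<le> \<epsilon>))"
proof -
  have "0 \<le> \<epsilon>" if "\<bar>fst I - fst J\<bar> \<le> \<epsilon>" using that by linarith
  then show ?thesis
    unfolding bar_dist_def by (cases "snd I"; cases "snd J") auto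
qed

lemma bar_dist_triangle:
  assumes "bar_dist I J \<le> ereal \<delta>" "bar_dist J K \<le> ereal \<epsilon>"
  shows "bar_dist I K \<le> ereal (\<delta> + \<epsilon>)"
proof -
  have "\<bar>fst I - fst K\<bar> \<le> \<delta> + \<epsilon>" using assms unfolding bar_dist_le_iff by linarith
  moreover have "snd I = snd K \<or> (\<exists>x y. snd I = ereal x \<and> snd K = ereal y \<and> \<bar>x - y\<bar> \<le> \<delta> + \<epsilon>)"
    using assms unfolding bar_dist_le_iff by (cases "snd I"; cases "snd J"; cases "snd K") auto
  ultimately show ?thesis unfolding bar_dist_le_iff by blast
qed

text \<open>Both endpoints of \<open>I\<close> lie within \<epsilon> of the same real, so
  \<open>I\<close> has length at most twice \<epsilon>, and \<open>diag_dist\<close> halves the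
  length.\<close>

lemma diag_dist_le:
  assumes "bar_dist I J \<le> ereal \<epsilon> \<or> bar_dist J I \<le> ereal \<epsilon>" "snd J = ereal (fst J)"
  shows "diag_dist I \<le> ereal \<epsilon>"
proof -
  have "\<bar>fst I - fst J\<bar> \<le> \<epsilon>" using assms(1) unfolding bar_dist_le_iff by linarith
  moreover obtain x where x: "snd I = ereal x" "\<bar>x - fst J\<bar> \<le> \<epsilon>"
    using assms calculation unfolding bar_dist_le_iff by (cases "snd I") auto
  ultimately have "x - fst I \<le> 2 * \<epsilon>" by linarith
  then have "(x - fst I) / 2 \<le> \<epsilon>" by simp
  then show ?thesis unfolding diag_dist_def x(1) by simp
qed

lemma bar_dist_self: "0 \<le> \<epsilon> \<Longrightarrow> bar_dist I I \<le> ereal \<epsilon>"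
  by (simp add: bar_dist_le_iff)

lemma rel_mset_refl_on: "(\<And>x. R x x) \<Longrightarrow> rel_mset R A A"
  by (induction A) (auto intro: rel_mset_Zero rel_mset_Plus)

lemma rel_mset_add: "rel_mset R A B \<Longrightarrow> rel_mset R C D \<Longrightarrow> rel_mset R (A + C) (B + D)"
  by (induction rule: rel_mset_induct) (auto intro: rel_mset_Plus)

lemma bars_close_trans:
  assumes "bars_close \<delta> A B" "bars_close \<epsilon> B C" "0 \<le> \<delta>" "0 \<le> \<epsilon>"
  shows "bars_close (\<delta> + \<epsilon>) A C"
proof -
  obtain P Q where 1: "empty_bars P" "empty_bars Q"
    "rel_mset (\<lambda>I J. bar_dist I J \<le> ereal \<delta>) (A + P) (B + Q)"
    using assms(1) unfolding bars_close_def by blast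
  obtain P' Q' where 2: "empty_bars P'" "empty_bars Q'"
    "rel_mset (\<lambda>I J. bar_dist I J \<le> ereal \<epsilon>) (B + P') (C + Q')"
    using assms(2) unfolding bars_close_def by blast
  \<comment> \<open>Each bijection is enlarged by the identity on the padding that the other one
    adds to \<open>B\<close>, so that both meet in \<open>B + Q + P'\<close>.\<close>
  have "rel_mset (\<lambda>I J. bar_dist I J \<le> ereal \<delta>) (A + P + P') (B + Q + P')"
    by (intro rel_mset_add 1 rel_mset_refl_on bar_dist_self assms)
  then have r1: "rel_mset (\<lambda>I J. bar_dist I J \<le> ereal \<delta>) (A + (P + P')) (B + (Q + P'))"
    by (simp only: add.assoc)
  have "rel_mset (\<lambda>I J. bar_dist I J \<le> ereal \<epsilon>) (B + P' + Q) (C + Q' + Q)"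
    by (intro rel_mset_add 2 rel_mset_refl_on bar_dist_self assms)
  then have r2: "rel_mset (\<lambda>I J. bar_dist I J \<le> ereal \<epsilon>) (B + (Q + P')) (C + (Q' + Q))"
    by (simp only: add.assoc add.commute[of P' Q])
  have "rel_mset ((\<lambda>I J. bar_dist I J \<le> ereal \<delta>) OO (\<lambda>I J. bar_dist I J \<le> ereal \<epsilon>))
      (A + (P + P')) (C + (Q' + Q))"
    unfolding multiset.rel_compp using r1 r2 by (rule relcomppI)
  then have "rel_mset (\<lambda>I J. bar_dist I J \<le> ereal (\<delta> + \<epsilon>)) (A + (P + P')) (C + (Q' + Q))"
    by (rule multiset.rel_mono_strong) (blast intro: bar_dist_triangle)
  moreover have "empty_bars (P + P')" "empty_bars (Q' + Q)" using 1 2 by (auto simp: empty_bars_def)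
  ultimately show ?thesis unfolding bars_close_def by blast
qed

text \<open>The matching keeps the pairs of two proper bars. A proper bar paired with an empty one
  stays unmatched and is near the diagonal. As \<open>D\<close> and \<open>E\<close> consist of
  proper bars, every empty bar comes from the padding.\<close>

lemma bottleneck_dist_le:
  assumes close: "bars_close \<epsilon> D E" and "0 \<le> \<epsilon>"
    and proper: "\<And>I. I \<in># D + E \<Longrightarrow> proper_bar I"
  shows "bottleneck_dist D E \<le> ereal \<epsilon>"
proof -
  obtain P Q where PQ: "empty_bars P" "empty_bars Q"
    "rel_mset (\<lambda>I J. bar_dist I J \<le> ereal \<epsilon>) (D + P) (E + Q)"
    using close unfolding bars_close_def by blast
  then obtain M where M: "\<And>I J. (I, J) \<in># M \<Longrightarrow> bar_dist I J \<le> ereal \<epsilon>"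
    "image_mset fst M = D + P" "image_mset snd M = E + Q"
    unfolding multiset.in_rel by auto
  have fP: "filter_mset proper_bar (X + Y) = X" if "\<And>I. I \<in># X \<Longrightarrow> proper_bar I" "empty_bars Y" for X Y
  proof -
    have "filter_mset proper_bar X = X" using that(1) by (simp add: filter_mset_eq_conv)
    moreover have "filter_mset proper_bar Y = {#}"
      using that(2) by (auto simp: empty_bars_def proper_bar_def)
    ultimately show ?thesis by simp
  qed
  let ?N = "{#p \<in># M. proper_bar (fst p) \<and> proper_bar (snd p)#}"
  have "filter_mset proper_bar (D + P) = D" "filter_mset proper_bar (E + Q) = E"
    using fP[of D P] fP[of E Q] proper PQ by simp_all
  then have D: "D = image_mset fst {#p \<in># M. proper_bar (fst p)#}"
    and E: "E = image_mset snd {#p \<in># M. proper_bar (snd p)#}"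
    using image_mset_filter_mset_swap[of fst proper_bar M] image_mset_filter_mset_swap[of snd proper_bar M]
      M(2,3) by simp_all
  have "{#p \<in># M. proper_bar (fst p)#} = ?N + {#p \<in># M. proper_bar (fst p) \<and> \<not> proper_bar (snd p)#}"
    using multiset_partition[of "{#p \<in># M. proper_bar (fst p)#}" "\<lambda>p. proper_bar (snd p)"]
    by (simp only: filter_filter_mset)
  from arg_cong[OF this, of "image_mset fst"]
  have Ds: "D = image_mset fst ?N + image_mset fst {#p \<in># M. proper_bar (fst p) \<and> \<not> proper_bar (snd p)#}"
    by (simp only: D[symmetric] image_mset_union)
  have "{#p \<in># M. proper_bar (snd p)#} = ?N + {#p \<in># M. \<not> proper_bar (fst p) \<and> proper_bar (snd p)#}"
    using multiset_partition[of "{#p \<in># M. proper_bar (snd p)#}" "\<lambda>p. proper_bar (fst p)"]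
    by (simp only: filter_filter_mset conj_commute)
  from arg_cong[OF this, of "image_mset snd"]
  have Es: "E = image_mset snd ?N + image_mset snd {#p \<in># M. \<not> proper_bar (fst p) \<and> proper_bar (snd p)#}"
    by (simp only: E[symmetric] image_mset_union)
  have deg: "snd I = ereal (fst I)" if "I \<in># X + Y" "\<not> proper_bar I" "empty_bars Y"
    "\<And>I. I \<in># X \<Longrightarrow> proper_bar I" for I X Y
    using that unfolding empty_bars_def by (metis union_iff)
  have d1: "diag_dist I \<le> ereal \<epsilon>" if I: "I \<in># D - image_mset fst ?N" for I
  proof -
    have "I \<in># image_mset fst {#p \<in># M. proper_bar (fst p) \<and> \<not> proper_bar (snd p)#}"
      using I by (subst (asm) Ds) simp
    then obtain J where J: "(I, J) \<in># M" "\<not> proper_bar J" by auto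
    then have "J \<in># E + Q" using M(3) by (metis image_eqI set_image_mset snd_conv)
    then have "snd J = ereal (fst J)" using deg[OF _ J(2) PQ(2)] proper by simp
    with M(1)[OF J(1)] show ?thesis using diag_dist_le by blast
  qed
  have d2: "diag_dist J \<le> ereal \<epsilon>" if J: "J \<in># E - image_mset snd ?N" for J
  proof -
    have "J \<in># image_mset snd {#p \<in># M. \<not> proper_bar (fst p) \<and> proper_bar (snd p)#}"
      using J by (subst (asm) Es) simp
    then obtain I where I: "(I, J) \<in># M" "\<not> proper_bar I" by auto
    then have "I \<in># D + P" using M(2) by (metis image_eqI set_image_mset fst_conv)
    then have "snd I = ereal (fst I)" using deg[OF _ I(2) PQ(1)] proper by simp
    with M(1)[OF I(1)] show ?thesis using diag_dist_le by blast
  qed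
  have "partial_matching D E ?N"
    unfolding partial_matching_def
    by (rule conjI, subst Ds, rule mset_subset_eq_add_left, subst Es, rule mset_subset_eq_add_left)
  moreover have "matching_cost D E ?N \<le> ereal \<epsilon>"
    unfolding matching_cost_def using M(1) d1 d2 \<open>0 \<le> \<epsilon>\<close>
    by (subst Max_le_iff) auto
  ultimately show ?thesis unfolding bottleneck_dist_def by (intro INF_lower2) auto
qed

text \<open>The discarded bars return as padding; the second hypothesis ensures that a bar which is
  not proper has equal endpoints.\<close>

lemma bars_close_filter:
  assumes "rel_mset (\<lambda>I J. bar_dist I J \<le> ereal \<epsilon>) A B"
    and "\<And>I. I \<in># A + B \<Longrightarrow> ereal (fst I) \<le> snd I"
  shows "bars_close \<epsilon> (filter_mset proper_bar A) (filter_mset proper_bar B)"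
proof -
  have "empty_bars {#I \<in># X. \<not> proper_bar I#}" if "X \<subseteq># A + B" for X
    unfolding empty_bars_def
  proof
    fix I assume "I \<in># {#I \<in># X. \<not> proper_bar I#}"
    then have "I \<in># A + B" "\<not> ereal (fst I) < snd I"
      using mset_subset_eqD[OF that] by (auto simp: proper_bar_def)
    then show "snd I = ereal (fst I)" using assms(2)[of I] by (simp add: order_less_le)
  qed
  then have "empty_bars {#I \<in># A. \<not> proper_bar I#}" "empty_bars {#I \<in># B. \<not> proper_bar I#}" by simp_all
  then show ?thesis
    unfolding bars_close_def using assms(1)
    by (intro exI[of _ "{#I \<in># A. \<not> proper_bar I#}"] exI[of _ "{#I \<in># B. \<not> proper_bar I#}"]) simp
qed

section \<open>Stability for filtrations on the same set\<close>

definition persistence_barcode :: "'f::field itself \<Rightarrow> nat \<Rightarrow> 'a set \<Rightarrow> ('a set \<Rightarrow> real) \<Rightarrow> bar multiset" where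
  "persistence_barcode F k S \<phi> =
     barcode (\<lambda>t. homology k (sublevel S \<phi> t) :: ('f, ('a list \<Rightarrow> 'f) set) module)
             (\<lambda>s t. homology_map k (sublevel S \<phi> t))"

lemma dgm_eq_persistence_barcode: "dgm F k \<Phi> X = persistence_barcode F k (mspace X) (\<Phi> X)"
  by (simp add: dgm_def persistence_barcode_def Let_def)

lemma (in filtered_normal_form) persistence_barcode_eq:
  "persistence_barcode TYPE('f) k S \<phi> = filter_mset proper_bar (all_bars k \<phi> P b)"
  unfolding persistence_barcode_def
  by (rule barcode_eqI[OF persistent_homology[OF finite_S filtration] is_barcode_all_bars])

text \<open>The order comes from \<eta>. It respects \<phi> because \<eta> refines the strict order
  of \<phi>: if \<sigma> comes no later than \<tau>, then \<phi> \<tau> < \<phi> \<sigma> would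
  force \<eta> \<tau> < \<eta> \<sigma>. The hypothesis is one-sided, since \<eta> may separate
  simplices on which \<phi> is constant.\<close>

lemma compatible_order_exists:
  fixes \<phi> \<eta> :: "'a set \<Rightarrow> real"
  assumes S: "finite S" and \<eta>: "filtration S \<eta>"
    and less: "\<And>\<sigma> \<tau>. \<sigma> \<in> pow_ne S \<Longrightarrow> \<tau> \<in> pow_ne S \<Longrightarrow> \<phi> \<sigma> < \<phi> \<tau> \<Longrightarrow> \<eta> \<sigma> < \<eta> \<tau>"
  shows "\<exists>r. complex_order r (pow_ne S) \<and>
     (\<forall>\<sigma>\<in>pow_ne S. \<forall>\<tau>\<in>pow_ne S. r \<sigma> \<le> r \<tau> \<longrightarrow> \<phi> \<sigma> \<le> \<phi> \<tau> \<and> \<eta> \<sigma> \<le> \<eta> \<tau>)"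
proof -
  let ?P = "pow_ne S"
  have P: "simplices ?P" "finite ?P" using simplices_pow_ne[OF S] by (auto simp: simplices_def)
  obtain f :: "'a set \<Rightarrow> nat" where f: "inj_on f ?P" using finite_imp_inj_to_nat_seg[OF P(2)] by metis
  \<comment> \<open>Ties in \<eta> are broken by cardinality, so that faces come before cofaces, and
    then by the injection \<open>f\<close>, which makes the order total. The rank \<open>r\<close>
    counts predecessors.\<close>
  define prec where "prec \<sigma> \<tau> \<longleftrightarrow> \<eta> \<sigma> < \<eta> \<tau> \<or> \<eta> \<sigma> = \<eta> \<tau> \<and>
      (card \<sigma> < card \<tau> \<or> card \<sigma> = card \<tau> \<and> f \<sigma> < f \<tau>)" for \<sigma> \<tau>
  define r where "r \<sigma> = card {\<rho>\<in>?P. prec \<rho> \<sigma>}" for \<sigma>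
  have trans: "prec \<rho> \<tau>" if "prec \<rho> \<sigma>" "prec \<sigma> \<tau>" for \<rho> \<sigma> \<tau>
    using that unfolding prec_def by (elim disjE conjE) auto
  have r_less: "r \<sigma> < r \<tau>" if "\<sigma> \<in> ?P" "prec \<sigma> \<tau>" for \<sigma> \<tau>
    unfolding r_def
  proof (rule psubset_card_mono)
    have "\<not> prec \<sigma> \<sigma>" by (simp add: prec_def)
    then show "{\<rho>\<in>?P. prec \<rho> \<sigma>} \<subset> {\<rho>\<in>?P. prec \<rho> \<tau>}" using that trans by blast
  qed (use P(2) in simp)
  have total: "prec \<sigma> \<tau> \<or> prec \<tau> \<sigma>" if "\<sigma> \<in> ?P" "\<tau> \<in> ?P" "\<sigma> \<noteq> \<tau>" for \<sigma> \<tau>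
  proof -
    have "f \<sigma> \<noteq> f \<tau>" using f that by (auto dest: inj_onD)
    then show ?thesis unfolding prec_def by linarith
  qed
  have "complex_order r ?P"
    unfolding complex_order_def
  proof (intro conjI ballI allI impI)
    show "simplices ?P" by (rule P(1))
    show "inj_on r ?P"
    proof (rule inj_onI)
      fix \<sigma> \<tau> assume "\<sigma> \<in> ?P" "\<tau> \<in> ?P" "r \<sigma> = r \<tau>"
      then show "\<sigma> = \<tau>" using r_less[of \<sigma> \<tau>] r_less[of \<tau> \<sigma>] total[of \<sigma> \<tau>] by linarith
    qed
    fix \<sigma> \<tau> assume \<sigma>: "\<sigma> \<in> ?P" and \<tau>: "\<tau> \<subset> \<sigma>" "\<tau> \<noteq> {}"
    show \<tau>P: "\<tau> \<in> ?P" using \<sigma> \<tau> by (auto simp: pow_ne_def Fpow_def intro: finite_subset)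
    have "finite \<sigma>" using \<sigma> P(1) by (auto simp: simplices_def)
    then have "card \<tau> < card \<sigma>" using \<tau>(1) by (rule psubset_card_mono)
    moreover have "\<eta> \<tau> \<le> \<eta> \<sigma>" using \<eta> \<sigma> \<tau>P \<tau>(1) unfolding filtration_def by blast
    ultimately have "prec \<tau> \<sigma>" unfolding prec_def by linarith
    then show "r \<tau> < r \<sigma>" by (rule r_less[OF \<tau>P])
  qed
  moreover have "\<phi> \<sigma> \<le> \<phi> \<tau> \<and> \<eta> \<sigma> \<le> \<eta> \<tau>" if "\<sigma> \<in> ?P" "\<tau> \<in> ?P" "r \<sigma> \<le> r \<tau>" for \<sigma> \<tau>
  proof -
    have "\<not> prec \<tau> \<sigma>" using r_less[of \<tau> \<sigma>] that by linarith
    then have "\<eta> \<sigma> \<le> \<eta> \<tau>" unfolding prec_def by linarith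
    then show ?thesis using less[of \<tau> \<sigma>] that by (meson linorder_not_less)
  qed
  ultimately show ?thesis by blast
qed

lemma rel_mset_image_mset:
  "(\<And>x. x \<in># M \<Longrightarrow> R (f x) (g x)) \<Longrightarrow> rel_mset R (image_mset f M) (image_mset g M)"
  by (simp add: multiset.rel_map multiset.rel_refl_strong)

lemma killer_normal_form:
  assumes nf: "normal_form r P c b" and \<sigma>: "killed P b \<sigma>"
  shows "killer P b \<sigma> \<in> P" "\<sigma> \<in> P" "r \<sigma> \<le> r (killer P b \<sigma>)"
proof -
  obtain \<tau> where \<tau>: "\<tau> \<in> P" "b \<tau> = Some \<sigma>" using \<sigma> by (auto simp: killed_def)
  show "killer P b \<sigma> \<in> P" "\<sigma> \<in> P" "r \<sigma> \<le> r (killer P b \<sigma>)"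
    unfolding killer_eq[OF nf \<tau>] using \<tau> normal_form_Some[OF nf \<tau>] by auto
qed

text \<open>With a common order both barcodes come from the same pairs of a simplex and its killer.
  Matching bars with the same index moves each finite endpoint by at most \<epsilon>, and infinite
  deaths coincide.\<close>

lemma bars_close_same_order:
  fixes \<phi> \<eta> :: "'a set \<Rightarrow> real" and S :: "'a set"
  assumes S: "finite S" and \<phi>: "filtration S \<phi>" and \<eta>: "filtration S \<eta>"
    and less: "\<And>\<sigma> \<tau>. \<sigma> \<in> pow_ne S \<Longrightarrow> \<tau> \<in> pow_ne S \<Longrightarrow> \<phi> \<sigma> < \<phi> \<tau> \<Longrightarrow> \<eta> \<sigma> < \<eta> \<tau>"
    and close: "\<And>\<sigma>. \<sigma> \<in> pow_ne S \<Longrightarrow> \<bar>\<phi> \<sigma> - \<eta> \<sigma>\<bar> \<le> \<epsilon>"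
  shows "bars_close \<epsilon> (persistence_barcode TYPE('f::field) k S \<phi>) (persistence_barcode TYPE('f) k S \<eta>)"
    and "\<And>I. I \<in># persistence_barcode TYPE('f) k S \<phi> \<Longrightarrow> proper_bar I"
proof -
  let ?P = "pow_ne S"
  obtain r where r: "complex_order r ?P"
    "\<And>\<sigma> \<tau>. \<sigma> \<in> ?P \<Longrightarrow> \<tau> \<in> ?P \<Longrightarrow> r \<sigma> \<le> r \<tau> \<Longrightarrow> \<phi> \<sigma> \<le> \<phi> \<tau> \<and> \<eta> \<sigma> \<le> \<eta> \<tau>"
    using compatible_order_exists[OF S \<eta> less] by blast
  then obtain c :: "'a set \<Rightarrow> 'a list \<Rightarrow> 'f" and b where nf: "normal_form r ?P c b"
    using normal_form_exists by blast
  have inj: "inj_on r ?P" using r(1) by (simp add: complex_order_def)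
  interpret A: filtered_normal_form S \<phi> r c b by unfold_locales (use S \<phi> inj nf r(2) in auto)
  interpret B: filtered_normal_form S \<eta> r c b by unfold_locales (use S \<eta> inj nf r(2) in auto)
  have pos: "\<sigma> \<in> ?P" if "\<sigma> \<in># mset_set (positive_simplices k ?P b)" for \<sigma>
    using that A.finite_P by (simp add: positive_simplices_def)
  have "rel_mset (\<lambda>I J. bar_dist I J \<le> ereal \<epsilon>) (all_bars k \<phi> ?P b) (all_bars k \<eta> ?P b)"
    unfolding all_bars_def
  proof (rule rel_mset_image_mset)
    fix \<sigma> assume "\<sigma> \<in># mset_set (positive_simplices k ?P b)"
    then show "bar_dist (\<phi> \<sigma>, death \<phi> ?P b \<sigma>) (\<eta> \<sigma>, death \<eta> ?P b \<sigma>) \<le> ereal \<epsilon>"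
      using close pos killer_normal_form(1)[OF nf] by (auto simp: bar_dist_le_iff death_def)
  qed
  moreover have "ereal (fst I) \<le> snd I" if "I \<in># all_bars k \<phi> ?P b + all_bars k \<eta> ?P b" for I
    using that r(2) killer_normal_form[OF nf] by (auto simp: all_bars_def death_def)
  ultimately show "bars_close \<epsilon> (persistence_barcode TYPE('f) k S \<phi>) (persistence_barcode TYPE('f) k S \<eta>)"
    unfolding A.persistence_barcode_eq B.persistence_barcode_eq by (rule bars_close_filter)
  show "\<And>I. I \<in># persistence_barcode TYPE('f) k S \<phi> \<Longrightarrow> proper_bar I"
    unfolding A.persistence_barcode_eq by simp
qed

lemma bars_close_sym:
  assumes "bars_close \<epsilon> D E"
  shows "bars_close \<epsilon> E D"
proof -
  obtain P Q where PQ: "empty_bars P" "empty_bars Q"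
    "rel_mset (\<lambda>I J. bar_dist I J \<le> ereal \<epsilon>) (D + P) (E + Q)"
    using assms unfolding bars_close_def by blast
  have "bar_dist I J \<le> ereal \<epsilon> \<Longrightarrow> bar_dist J I \<le> ereal \<epsilon>" for I J
    unfolding bar_dist_le_iff by (auto simp: abs_minus_commute)
  then have "(\<lambda>I J. bar_dist I J \<le> ereal \<epsilon>)\<inverse>\<inverse> = (\<lambda>I J. bar_dist I J \<le> ereal \<epsilon>)" by (intro ext) auto
  then have "rel_mset (\<lambda>I J. bar_dist I J \<le> ereal \<epsilon>) (E + Q) (D + P)"
    using PQ(3) multiset.rel_conversep[of "\<lambda>I J. bar_dist I J \<le> ereal \<epsilon>"] by (metis conversep.intros)
  then show ?thesis unfolding bars_close_def using PQ by blast
qed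

text \<open>
  Along the segment from \<open>\<phi>\<close> to \<open>\<eta>\<close>, every parameter has a neighbourhood in which one order of the
  simplices is compatible with the filtration at the parameter and at the neighbour.
\<close>

lemma persistence_barcode_stable:
  fixes \<phi> \<eta> :: "'a set \<Rightarrow> real" and S :: "'a set"
  assumes S: "finite S" and \<phi>: "filtration S \<phi>" and \<eta>: "filtration S \<eta>" and "0 \<le> \<epsilon>"
    and close: "\<And>\<sigma>. \<sigma> \<in> pow_ne S \<Longrightarrow> \<bar>\<phi> \<sigma> - \<eta> \<sigma>\<bar> \<le> \<epsilon>"
  shows "bottleneck_dist (persistence_barcode TYPE('f::field) k S \<phi>) (persistence_barcode TYPE('f) k S \<eta>)
    \<le> ereal \<epsilon>"
proof -
  let ?P = "pow_ne S"
  have P: "finite ?P" using simplices_pow_ne[OF S] by (simp add: simplices_def)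
  define \<psi> where "\<psi> l \<sigma> = \<phi> \<sigma> + l * (\<eta> \<sigma> - \<phi> \<sigma>)" for l \<sigma>
  have \<psi>_conv: "\<psi> l \<sigma> = (1 - l) * \<phi> \<sigma> + l * \<eta> \<sigma>" for l \<sigma> by (simp add: \<psi>_def algebra_simps)
  let ?D = "\<lambda>l. persistence_barcode TYPE('f) k S (\<psi> l)"
  have fil: "filtration S (\<psi> l)" if "0 \<le> l" "l \<le> 1" for l
    using \<phi> \<eta> that unfolding filtration_def \<psi>_conv by (auto intro!: add_mono mult_left_mono)
  have dist: "\<bar>\<psi> l \<sigma> - \<psi> m \<sigma>\<bar> \<le> \<bar>m - l\<bar> * \<epsilon>" if "\<sigma> \<in> ?P" for l m \<sigma>
  proof -
    have "\<psi> l \<sigma> - \<psi> m \<sigma> = (m - l) * (\<phi> \<sigma> - \<eta> \<sigma>)" by (simp add: \<psi>_def algebra_simps)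
    then show ?thesis using close[OF that] by (simp add: abs_mult mult_left_mono)
  qed
  \<comment> \<open>The cost is proportional to the length of the parameter interval, so costs of
    adjacent intervals add up. The guards matter because the local condition of
    \<open>Bolzano\<close> also ranges over intervals that leave the unit interval, where \<psi>
    need not be a filtration.\<close>
  define Q where "Q l m \<longleftrightarrow> (0 \<le> l \<longrightarrow> l \<le> m \<longrightarrow> m \<le> 1 \<longrightarrow> bars_close ((m - l) * \<epsilon>) (?D l) (?D m))" for l m
  have "Q 0 1"
  proof (rule Bolzano[of 0 1 Q])
    fix l m n assume Q: "Q l m" "Q m n" "l \<le> m" "m \<le> n"
    show "Q l n"
      unfolding Q_def
    proof (intro impI)
      assume "0 \<le> l" "l \<le> n" "n \<le> 1"
      then have "bars_close ((m - l) * \<epsilon> + (n - m) * \<epsilon>) (?D l) (?D n)"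
        using Q \<open>0 \<le> \<epsilon>\<close> unfolding Q_def by (intro bars_close_trans[of _ _ "?D m"]) auto
      then show "bars_close ((n - l) * \<epsilon>) (?D l) (?D n)" by (simp add: algebra_simps)
    qed
  next
    fix x :: real assume x: "0 \<le> x" "x \<le> 1"
    \<comment> \<open>There are finitely many pairs of simplices, and by continuity each strict
      inequality at \<open>x\<close> persists nearby. Ties at \<open>x\<close> are not constrained,
      which suits \<open>compatible_order_exists\<close>.\<close>
    have "\<forall>\<^sub>F m in nhds x. \<forall>p\<in>?P \<times> ?P. \<psi> x (fst p) < \<psi> x (snd p) \<longrightarrow> \<psi> m (fst p) < \<psi> m (snd p)"
    proof (rule eventually_ball_finite)
      show "\<forall>p\<in>?P \<times> ?P. \<forall>\<^sub>F m in nhds x. \<psi> x (fst p) < \<psi> x (snd p) \<longrightarrow> \<psi> m (fst p) < \<psi> m (snd p)"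
      proof
        fix p
        have "((\<lambda>m. \<psi> m (snd p) - \<psi> m (fst p)) \<longlongrightarrow> \<psi> x (snd p) - \<psi> x (fst p)) (nhds x)"
          unfolding \<psi>_def by (intro tendsto_intros filterlim_ident)
        from order_tendstoD(1)[OF this, of 0]
        show "\<forall>\<^sub>F m in nhds x. \<psi> x (fst p) < \<psi> x (snd p) \<longrightarrow> \<psi> m (fst p) < \<psi> m (snd p)"
          by (cases "\<psi> x (fst p) < \<psi> x (snd p)") auto
      qed
    qed (use P in simp)
    then obtain d where d: "0 < d" "\<And>m \<sigma> \<tau>. \<bar>m - x\<bar> < d \<Longrightarrow> \<sigma> \<in> ?P \<Longrightarrow> \<tau> \<in> ?P \<Longrightarrow>
        \<psi> x \<sigma> < \<psi> x \<tau> \<Longrightarrow> \<psi> m \<sigma> < \<psi> m \<tau>"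
      unfolding eventually_nhds_metric dist_real_def by fastforce
    have near: "bars_close (\<bar>m - x\<bar> * \<epsilon>) (?D x) (?D m)" if "0 \<le> m" "m \<le> 1" "\<bar>m - x\<bar> < d" for m
      by (rule bars_close_same_order(1)[OF S fil fil]) (use x that d(2) dist in auto)
    show "\<exists>d>0. \<forall>l m. l \<le> x \<and> x \<le> m \<and> m - l < d \<longrightarrow> Q l m"
    proof (intro exI[of _ d] conjI allI impI)
      fix l m assume lm: "l \<le> x \<and> x \<le> m \<and> m - l < d"
      show "Q l m"
        unfolding Q_def
      proof (intro impI)
        assume "0 \<le> l" "l \<le> m" "m \<le> 1"
        \<comment> \<open>Both ends are compared through \<open>x\<close>: ties at \<open>x\<close>
          may be broken in opposite ways on its two sides, so \<open>l\<close> and \<open>m\<close>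
          need not admit a common order.\<close>
        then have "bars_close (\<bar>l - x\<bar> * \<epsilon>) (?D x) (?D l)" "bars_close (\<bar>m - x\<bar> * \<epsilon>) (?D x) (?D m)"
          using lm x by (intro near; linarith)+
        from bars_close_trans[OF bars_close_sym[OF this(1)] this(2)]
        have "bars_close (\<bar>l - x\<bar> * \<epsilon> + \<bar>m - x\<bar> * \<epsilon>) (?D l) (?D m)"
          using \<open>0 \<le> \<epsilon>\<close> by simp
        then show "bars_close ((m - l) * \<epsilon>) (?D l) (?D m)" using lm by (simp add: algebra_simps)
      qed
    qed (rule d(1))
  qed simp
  moreover have "\<psi> 0 = \<phi>" "\<psi> 1 = \<eta>" by (auto simp: \<psi>_def)
  ultimately have "bars_close \<epsilon> (persistence_barcode TYPE('f) k S \<phi>) (persistence_barcode TYPE('f) k S \<eta>)"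
    by (simp add: Q_def)
  moreover have "proper_bar I" if "I \<in># persistence_barcode TYPE('f) k S \<phi> + persistence_barcode TYPE('f) k S \<eta>" for I
  proof -
    have "I \<in># persistence_barcode TYPE('f) k S \<phi> \<or> I \<in># persistence_barcode TYPE('f) k S \<eta>"
      using that by simp
    then show ?thesis
      using bars_close_same_order(2)[OF S \<phi> \<phi>, of 0] bars_close_same_order(2)[OF S \<eta> \<eta>, of 0]
      by (metis abs_zero diff_self order_refl)
  qed
  ultimately show ?thesis using bottleneck_dist_le \<open>0 \<le> \<epsilon>\<close> by blast
qed

section \<open>Dominated vertices\<close>

lemma oriented_simplex_Cons:
  assumes "distinct (v # vs)"
  shows "oriented_simplex (v # vs) (v # ws) = oriented_simplex vs ws"
proof (cases "mset ws = mset vs")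
  case True
  then obtain p where p: "p permutes {..<length vs}" "permute_list p vs = ws"
    using mset_eq_permutation by metis
  obtain q where q: "q permutes {..<length (v # vs)}" "sign q = sign p"
    "permute_list q (v # vs) = v # permute_list p vs"
    using permute_Cons[OF p(1)] by metis
  have "distinct vs" using assms by simp
  then show ?thesis
    using oriented_simplex_permute[OF assms q(1)] oriented_simplex_permute[OF _ p(1)] p(2) q(2,3)
    by metis
qed (simp add: oriented_simplex_def)

lemma oriented_simplex_eq_0: "set ws \<noteq> set vs \<Longrightarrow> oriented_simplex vs ws = 0"
  unfolding oriented_simplex_def by (metis mset_eq_setD)

lemma chains_Cons_oriented_simplex:
  fixes c :: "'a list \<Rightarrow> 'f::field"
  assumes c: "c \<in> chains k K" and vs: "distinct vs" "distinct ws" "set vs = set ws"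
  shows "c (v # ws) = c (v # vs) * oriented_simplex vs ws"
proof -
  obtain p where p: "p permutes {..<length vs}" "permute_list p vs = ws"
    using distinct_permutation[OF vs] by blast
  obtain q where q: "q permutes {..<length (v # vs)}" "sign q = sign p"
    "permute_list q (v # vs) = v # permute_list p vs"
    using permute_Cons[OF p(1)] by metis
  have "c (v # ws) = of_int (sign p) * c (v # vs)"
    using chains_perm[OF c q(1)] unfolding q(2,3) p(2) .
  then show ?thesis using oriented_simplex_permute[OF vs(1) p(1), where 'b = 'f] p(2) by simp
qed

lemma swap_chain_Cons:
  fixes c :: "'a list \<Rightarrow> 'f::field"
  assumes c: "c \<in> chains k K"
  shows "c (x # v # w # vs) = - c (x # w # v # vs)"
proof -
  let ?p = "Transposition.transpose 0 (Suc 0)"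
  have p: "?p permutes {..<length (w # v # vs)}"
    by (rule permutes_swap_id) auto
  have pl: "permute_list ?p (w # v # vs) = v # w # vs"
    by (rule nth_equalityI)
      (auto simp: permute_list_def Transposition.transpose_def nth_Cons' simp del: upt_Suc)
  obtain q where q: "q permutes {..<length (x # w # v # vs)}" "sign q = sign ?p"
    "permute_list q (x # w # v # vs) = x # permute_list ?p (w # v # vs)"
    using permute_Cons[OF p] by metis
  have "c (x # v # w # vs) = of_int (sign ?p) * c (x # w # v # vs)"
    using chains_perm[OF c q(1)] unfolding q(2,3) pl .
  then show ?thesis by (simp add: sign_swap_id)
qed

lemma chains_not_distinct: "c \<in> chains k K \<Longrightarrow> \<not> distinct vs \<Longrightarrow> c vs = 0"
  using chains_supp by blast

text \<open>The cone operator with apex \<open>a\<close> on the link of \<open>z\<close>: each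
  simplex of \<open>c\<close> through \<open>z\<close> but not \<open>a\<close> is extended by
  \<open>a\<close> in second position. \<open>T\<close> lists the faces of the link that are coned
  off, with the empty face possible when \<open>k\<close> is 0.\<close>

lemma dominated_vertex_chain:
  fixes c :: "'a list \<Rightarrow> 'f::field"
  assumes K: "simplicial_complex K" and "z \<noteq> a"
    and dom: "\<And>\<sigma>. \<sigma> \<in> K \<Longrightarrow> z \<in> \<sigma> \<Longrightarrow> insert a \<sigma> \<in> K" and c: "c \<in> chains k K"
  shows "\<exists>h\<in>chains (Suc k) K. (\<forall>u. a \<notin> set u \<longrightarrow> h (z # a # u) = c (z # u)) \<and>
    (\<forall>vs. \<not> {z, a} \<subseteq> set vs \<longrightarrow> h vs = 0)"
proof -
  define T where "T = {\<tau>. \<tau> \<subseteq> \<Union>K - {z, a} \<and> card \<tau> = k \<and> insert z \<tau> \<in> K}"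
  have finT: "finite T"
    by (rule finite_subset[of _ "Pow (\<Union>K)"]) (use simplicial_complexD(1)[OF K] in \<open>auto simp: T_def\<close>)
  have T: "finite \<tau>" "z \<notin> \<tau>" "a \<notin> \<tau>" "card \<tau> = k" "insert z \<tau> \<in> K" if "\<tau> \<in> T" for \<tau>
    using that simplicial_complexD(1)[OF K] by (auto simp: T_def intro: finite_subset)
  let ?l = "\<lambda>\<tau>. z # a # simplex_list \<tau>"
  define h :: "'a list \<Rightarrow> 'f" where
    "h vs = (\<Sum>\<tau>\<in>T. c (z # simplex_list \<tau>) * oriented_simplex (?l \<tau>) vs)" for vs
  have l: "distinct (?l \<tau>)" "length (?l \<tau>) = Suc (Suc k)" "set (?l \<tau>) = insert a (insert z \<tau>)"
    if "\<tau> \<in> T" for \<tau>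
    using simplex_list[OF T(1)[OF that]] T[OF that] \<open>z \<noteq> a\<close> by auto
  have "h \<in> chains (Suc k) K"
    unfolding h_def
  proof (rule chains_linear_combination)
    fix \<tau> assume \<tau>: "\<tau> \<in> T"
    then have "set (?l \<tau>) \<in> K" using l(3) T(5) dom by simp
    then show "oriented_simplex (?l \<tau>) \<in> chains (Suc k) K"
      using l[OF \<tau>] by (intro oriented_simplex_chains)
  qed
  moreover have "h (z # a # u) = c (z # u)" if "a \<notin> set u" for u
  proof -
    have h: "h (z # a # u) = (\<Sum>\<tau>\<in>T. c (z # simplex_list \<tau>) * oriented_simplex (simplex_list \<tau>) u)"
      unfolding h_def
    proof (rule sum.cong[OF refl])
      fix \<tau> assume "\<tau> \<in> T"
      note d = l(1)[OF this]
      have "distinct (a # simplex_list \<tau>)" using d by simp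
      then show "c (z # simplex_list \<tau>) * oriented_simplex (?l \<tau>) (z # a # u) =
          c (z # simplex_list \<tau>) * oriented_simplex (simplex_list \<tau>) u"
        using oriented_simplex_Cons[OF d] oriented_simplex_Cons by metis
    qed
    have set: "set (simplex_list \<tau>) = \<tau>" if "\<tau> \<in> T" for \<tau> using simplex_list T(1)[OF that] by blast
    show ?thesis
    proof (cases "distinct u \<and> set u \<in> T")
      case True
      then have u: "distinct u" "set u \<in> T" by auto
      have "(\<Sum>\<tau>\<in>T - {set u}. c (z # simplex_list \<tau>) * oriented_simplex (simplex_list \<tau>) u) = 0"
      proof (intro sum.neutral ballI)
        fix \<tau> assume "\<tau> \<in> T - {set u}"
        then have "set u \<noteq> set (simplex_list \<tau>)" using set by auto
        then show "c (z # simplex_list \<tau>) * oriented_simplex (simplex_list \<tau>) u = 0"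
          by (simp add: oriented_simplex_eq_0)
      qed
      then have "h (z # a # u) = c (z # simplex_list (set u)) * oriented_simplex (simplex_list (set u)) u"
        unfolding h using u(2) finT by (simp add: sum.remove[of T "set u"])
      also have "\<dots> = c (z # u)"
        using chains_Cons_oriented_simplex[OF c, of "simplex_list (set u)" u z]
          simplex_list[of "set u"] u(1) by simp
      finally show ?thesis .
    next
      case False
      have "c (z # u) = 0"
      proof (rule ccontr)
        assume "c (z # u) \<noteq> 0"
        then have s: "distinct (z # u)" "length (z # u) = Suc k" "set (z # u) \<in> K"
          using chains_supp[OF c] by blast+
        then have "set u \<in> T" using that distinct_card[of u] by (auto simp: T_def)
        then show False using False s by simp
      qed
      moreover have "oriented_simplex (simplex_list \<tau>) u = (0 :: 'f)" if "\<tau> \<in> T" for \<tau>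
      proof (rule ccontr)
        assume "oriented_simplex (simplex_list \<tau>) u \<noteq> (0 :: 'f)"
        then have "mset u = mset (simplex_list \<tau>)" by (auto simp: oriented_simplex_def split: if_splits)
        then have "distinct u" "set u = \<tau>"
          using simplex_list(1)[OF T(1)[OF that]] set[OF that] mset_eq_imp_distinct_iff mset_eq_setD
          by blast+
        then show False using False that by simp
      qed
      ultimately show ?thesis unfolding h by simp
    qed
  qed
  moreover have "h vs = 0" if "\<not> {z, a} \<subseteq> set vs" for vs
  proof -
    have "oriented_simplex (?l \<tau>) vs = (0 :: 'f)" if "\<tau> \<in> T" for \<tau>
      by (rule oriented_simplex_eq_0) (use l(3)[OF that] \<open>\<not> {z, a} \<subseteq> set vs\<close> in auto)
    then show ?thesis unfolding h_def by simp
  qed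
  ultimately show ?thesis by blast
qed

text \<open>
  The chains through \<open>z\<close> modulo those avoiding \<open>z\<close> are the augmented chains of the link of \<open>z\<close>, which
  is a cone with apex \<open>a\<close> and hence acyclic.
\<close>

lemma dominated_vertex:
  fixes c :: "'a list \<Rightarrow> 'f::field"
  assumes K: "simplicial_complex K" and "z \<noteq> a"
    and dom: "\<And>\<sigma>. \<sigma> \<in> K \<Longrightarrow> z \<in> \<sigma> \<Longrightarrow> insert a \<sigma> \<in> K" and c: "c \<in> chains k K"
    and bc: "\<And>u. boundary c (z # u) = 0"
  shows "\<exists>h\<in>chains (Suc k) K. (\<lambda>vs. c vs + boundary h vs) \<in> chains k {\<sigma>\<in>K. z \<notin> \<sigma>}"
proof -
  obtain h where h: "h \<in> chains (Suc k) K" "\<And>u. a \<notin> set u \<Longrightarrow> h (z # a # u) = c (z # u)"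
    "\<And>vs. \<not> {z, a} \<subseteq> set vs \<Longrightarrow> h vs = 0"
    using dominated_vertex_chain[OF K \<open>z \<noteq> a\<close> dom c] by blast
  let ?d = "\<lambda>vs. c vs + boundary h vs"
  let ?S = "insert a (\<Union>K)"
  have fin: "finite ?S" using simplicial_complexD(1)[OF K] by simp
  have d: "?d \<in> chains k K"
    by (rule chains_lin(1)[OF c boundary_chains[OF h(1) simplicial_complexD[OF K]]])
  have bh: "boundary h (z # u) = (\<Sum>v\<in>?S. h (v # z # u))" for u
    using boundary_alt[OF h(1) fin, of "z # u"] by (simp add: subset_insertI)
  \<comment> \<open>Since \<open>h\<close> lives on simplices containing \<open>z\<close> and
    \<open>a\<close>, only the summand with \<open>a\<close> in front survives, and one swap turns
    it into \<open>- c (z # u)\<close>.\<close>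
  have free: "?d (z # u) = 0" if "a \<notin> set u" for u
  proof -
    have "(\<Sum>v\<in>?S - {a}. h (v # z # u)) = 0"
      by (intro sum.neutral ballI h(3)) (use that \<open>z \<noteq> a\<close> in auto)
    then have "boundary h (z # u) = h (a # z # u)"
      unfolding bh using fin by (simp add: sum.remove[of ?S a])
    also have "\<dots> = - c (z # u)" using swap_chain[OF h(1), of a z u] h(2)[OF that] by simp
    finally show ?thesis by simp
  qed
  \<comment> \<open>After reordering, the sum is minus the boundary of \<open>c\<close> at
    \<open>z # u\<close> with the term for \<open>a\<close> missing. That boundary vanishes by
    \<open>bc\<close>, so the missing term is what remains.\<close>
  have apex: "?d (z # a # u) = 0" if "a \<notin> set u" for u
  proof -
    have "boundary h (z # a # u) = h (a # z # a # u) + (\<Sum>v\<in>?S - {a}. h (v # z # a # u))"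
      unfolding bh using fin by (simp add: sum.remove[of ?S a])
    also have "h (a # z # a # u) = 0" by (rule chains_not_distinct[OF h(1)]) auto
    also have "(\<Sum>v\<in>?S - {a}. h (v # z # a # u)) = (\<Sum>v\<in>?S - {a}. - c (v # z # u))"
    proof (rule sum.cong[OF refl])
      fix v assume "v \<in> ?S - {a}"
      then have "h (z # a # v # u) = c (z # v # u)" using that by (intro h(2)) auto
      then show "h (v # z # a # u) = - c (v # z # u)"
        using swap_chain[OF h(1), of v z "a # u"] swap_chain_Cons[OF h(1), of z v a u]
          swap_chain[OF c, of v z u] by simp
    qed
    also have "\<dots> = c (a # z # u) - boundary c (z # u)"
      using boundary_alt[OF c fin, of "z # u"] fin
      by (simp add: subset_insertI sum_negf sum.remove[of ?S a])
    also have "\<dots> = - c (z # a # u)" using bc swap_chain[OF c, of a z u] by simp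
    finally show ?thesis by simp
  qed
  \<comment> \<open>Any simplex through \<open>z\<close> can be reordered to start with
    \<open>z\<close> if it avoids \<open>a\<close>, and with \<open>z\<close>, \<open>a\<close>
    otherwise; by alternation the two cases above suffice.\<close>
  have "?d vs = 0" if z: "z \<in> set vs" for vs
  proof (cases "distinct vs")
    case True
    let ?u = "remove1 z vs"
    have u: "distinct ?u" "set ?u = set vs - {z}" using True by auto
    show ?thesis
    proof (cases "a \<in> set ?u")
      case False
      show ?thesis
        by (rule chains_eq_0_permuted[OF d _ _ free[OF False]]) (use u z in auto)
    next
      case aT: True
      let ?w = "remove1 a ?u"
      have w: "distinct ?w" "set ?w = set vs - {z} - {a}" using u by auto
      have "a \<notin> set ?w" using w by auto
      show ?thesis
        by (rule chains_eq_0_permuted[OF d _ _ apex[OF \<open>a \<notin> set ?w\<close>]]) (use u w z aT \<open>z \<noteq> a\<close> in auto)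
    qed
  qed (rule chains_not_distinct[OF d])
  moreover have "set vs \<in> K" if "?d vs \<noteq> 0" for vs using chains_supp[OF d that] by blast
  ultimately have "?d \<in> chains k {\<sigma>\<in>K. z \<notin> \<sigma>}" by (intro chains_restrict[OF d]) blast
  then show ?thesis using h(1) by blast
qed

lemma simplicial_complex_avoiding:
  "simplicial_complex K \<Longrightarrow> simplicial_complex {\<sigma>\<in>K. \<sigma> \<inter> W = {}}"
  unfolding simplicial_complex_def by (auto intro: finite_subset[rotated])

lemma boundary_add:
  fixes c :: "'a list \<Rightarrow> 'f::field"
  assumes "simplicial_complex K" "c \<in> chains m K" "c' \<in> chains n K"
  shows "boundary (\<lambda>vs. c vs + c' vs) = (\<lambda>vs. boundary c vs + boundary c' vs)"
  using boundary_add_smult[OF simplicial_complexD(1)[OF assms(1)] assms(2,3), of 1] by simp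

lemma boundary_boundary_chains:
  "simplicial_complex K \<Longrightarrow> c \<in> chains (Suc k) K \<Longrightarrow> boundary (boundary c) = (\<lambda>_. 0)"
  by (rule ext, rule boundary_boundary[OF _ simplicial_complexD])

text \<open>The two conclusions say that the inclusion of \<open>L\<close> into \<open>K\<close> is
  onto and one-to-one on homology. Vertices are deleted one by one; each apex lies outside all of
  \<open>W\<close>, so it survives the deletions and still dominates.\<close>

lemma dominated_vertices:
  fixes K :: "'a set set" and k :: nat
  assumes K: "simplicial_complex K" and "finite W"
    and dom: "\<And>w. w \<in> W \<Longrightarrow> \<exists>a. a \<notin> W \<and> (\<forall>\<sigma>\<in>K. w \<in> \<sigma> \<longrightarrow> insert a \<sigma> \<in> K)"
  defines "L \<equiv> {\<sigma>\<in>K. \<sigma> \<inter> W = {}}"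
  shows "\<And>x. (x :: 'a list \<Rightarrow> 'f::field) \<in> cycles k K \<Longrightarrow>
      \<exists>h\<in>chains (Suc k) K. (\<lambda>vs. x vs + boundary h vs) \<in> cycles k L"
    and "\<And>x. (x :: 'a list \<Rightarrow> 'f) \<in> cycles k L \<Longrightarrow> x \<in> boundaries k K \<Longrightarrow> x \<in> boundaries k L"
proof -
  have "(\<forall>x \<in> cycles k K. \<exists>h\<in>chains (Suc k) K.
        (\<lambda>vs. (x :: 'a list \<Rightarrow> 'f) vs + boundary h vs) \<in> cycles k {\<sigma>\<in>K. \<sigma> \<inter> W = {}}) \<and>
      (\<forall>x \<in> cycles k {\<sigma>\<in>K. \<sigma> \<inter> W = {}}. (x :: 'a list \<Rightarrow> 'f) \<in> boundaries k K \<longrightarrow>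
        x \<in> boundaries k {\<sigma>\<in>K. \<sigma> \<inter> W = {}})"
    using \<open>finite W\<close> dom
  proof (induction W rule: finite_induct)
    case empty
    have "(\<lambda>vs. x vs + boundary (\<lambda>_. 0) vs) = x" for x :: "'a list \<Rightarrow> 'f"
      by (rule ext) (simp add: boundary_def)
    then show ?case using chains_0[of "Suc k" K, where 'b = 'f] by (auto intro!: bexI[of _ "\<lambda>_. 0"])
  next
    case (insert w W)
    let ?M = "{\<sigma>\<in>K. \<sigma> \<inter> W = {}}" and ?L = "{\<sigma>\<in>K. \<sigma> \<inter> insert w W = {}}"
    have M: "simplicial_complex ?M" by (rule simplicial_complex_avoiding[OF K])
    have M_eq: "{\<sigma>\<in>?M. w \<notin> \<sigma>} = ?L" by auto
    have MK: "chains j ?M \<subseteq> (chains j K :: ('a list \<Rightarrow> 'f) set)" for j by (rule chains_mono) auto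
    obtain a where a: "a \<notin> insert w W" "\<And>\<sigma>. \<sigma> \<in> K \<Longrightarrow> w \<in> \<sigma> \<Longrightarrow> insert a \<sigma> \<in> K"
      using insert.prems[of w] by auto
    have wa: "w \<noteq> a" using a(1) by auto
    have domM: "insert a \<sigma> \<in> ?M" if "\<sigma> \<in> ?M" "w \<in> \<sigma>" for \<sigma> using that a by auto
    have "\<exists>a. a \<notin> W \<and> (\<forall>\<sigma>\<in>K. v \<in> \<sigma> \<longrightarrow> insert a \<sigma> \<in> K)" if "v \<in> W" for v
      using insert.prems[of v] that by auto
    note IH = insert.IH[OF this]
    show ?case
    proof (intro conjI ballI impI)
      fix x :: "'a list \<Rightarrow> 'f" assume "x \<in> cycles k K"
      then obtain h where h: "h \<in> chains (Suc k) K" "(\<lambda>vs. x vs + boundary h vs) \<in> cycles k ?M"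
        using IH by blast
      let ?y = "\<lambda>vs. x vs + boundary h vs"
      have y: "?y \<in> chains k ?M" "boundary ?y = (\<lambda>_. 0)" using h(2) by (auto simp: cycles_def)
      obtain g where g: "g \<in> chains (Suc k) ?M" "(\<lambda>vs. ?y vs + boundary g vs) \<in> chains k ?L"
        using dominated_vertex[OF M wa domM y(1)] y(2) unfolding M_eq by auto
      have bg: "boundary g \<in> chains k ?M" by (rule boundary_chains[OF g(1) simplicial_complexD[OF M]])
      have "boundary (\<lambda>vs. ?y vs + boundary g vs) = (\<lambda>_. 0)"
        using boundary_add[OF M y(1) bg] boundary_boundary_chains[OF M g(1)] y(2) by simp
      moreover have gK: "g \<in> chains (Suc k) K" using g(1) MK by blast
      have "(\<lambda>vs. ?y vs + boundary g vs) = (\<lambda>vs. x vs + boundary (\<lambda>us. h us + g us) vs)"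
        using boundary_add[OF K h(1) gK] by (simp add: add.assoc)
      ultimately show "\<exists>h\<in>chains (Suc k) K. (\<lambda>vs. x vs + boundary h vs) \<in> cycles k ?L"
        using g(2) chains_lin(1)[OF h(1) gK] by (auto simp: cycles_def intro!: bexI[of _ "\<lambda>us. h us + g us"])
    next
      fix x :: "'a list \<Rightarrow> 'f" assume x: "x \<in> cycles k ?L" and "x \<in> boundaries k K"
      have LM: "cycles k ?L \<subseteq> (cycles k ?M :: ('a list \<Rightarrow> 'f) set)" by (rule cycles_mono) auto
      then have "x \<in> boundaries k ?M" using IH x \<open>x \<in> boundaries k K\<close> by blast
      then obtain c where c: "c \<in> chains (Suc k) ?M" "x = boundary c" by (auto simp: boundaries_def)
      \<comment> \<open>The retraction is applied one degree higher, to the filling chain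
        \<open>c\<close>. It is not a cycle, but its boundary \<open>x\<close> avoids
        \<open>w\<close>, and that is all \<open>dominated_vertex\<close> asks for.\<close>
      have "boundary c (w # u) = 0" for u
      proof (rule ccontr)
        assume "boundary c (w # u) \<noteq> 0"
        moreover have "boundary c \<in> chains k ?L" using x c(2) by (simp add: cycles_def)
        ultimately have "set (w # u) \<in> ?L" using chains_supp by blast
        then show False by simp
      qed
      then obtain h where h: "h \<in> chains (Suc (Suc k)) ?M" "(\<lambda>vs. c vs + boundary h vs) \<in> chains (Suc k) ?L"
        using dominated_vertex[OF M wa domM c(1)] unfolding M_eq by auto
      have bh: "boundary h \<in> chains (Suc k) ?M" by (rule boundary_chains[OF h(1) simplicial_complexD[OF M]])
      have "boundary (\<lambda>vs. c vs + boundary h vs) = x"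
        using boundary_add[OF M c(1) bh] boundary_boundary_chains[OF M h(1)] c(2) by simp
      then show "x \<in> boundaries k ?L" using h(2) unfolding boundaries_def by blast
    qed
  qed
  then show "\<And>x. (x :: 'a list \<Rightarrow> 'f::field) \<in> cycles k K \<Longrightarrow>
      \<exists>h\<in>chains (Suc k) K. (\<lambda>vs. x vs + boundary h vs) \<in> cycles k L"
    "\<And>x. (x :: 'a list \<Rightarrow> 'f) \<in> cycles k L \<Longrightarrow> x \<in> boundaries k K \<Longrightarrow> x \<in> boundaries k L"
    unfolding L_def by blast+
qed

text \<open>For \<open>g\<close> bijective from \<open>B\<close> onto the old vertices this is the
  chain map of the inverse of \<open>g\<close>. Functions on lists pull back by composition, so no
  sum over fibres appears; lists outside \<open>B\<close> get the value 0.\<close>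

definition relabel :: "('b \<Rightarrow> 'a) \<Rightarrow> 'b set \<Rightarrow> ('a list \<Rightarrow> 'f) \<Rightarrow> 'b list \<Rightarrow> 'f::field" where
  "relabel g B x = (\<lambda>ws. if set ws \<subseteq> B then x (map g ws) else 0)"

lemma relabel_lin: "relabel g B (\<lambda>vs. x vs + q * y vs) = (\<lambda>ws. relabel g B x ws + q * relabel g B y ws)"
  by (auto simp: relabel_def)

lemma relabel_chains:
  fixes g :: "'b \<Rightarrow> 'a" and x :: "'a list \<Rightarrow> 'f::field"
  assumes x: "x \<in> chains k K" and L: "\<And>\<sigma>. \<sigma> \<subseteq> B \<Longrightarrow> g ` \<sigma> \<in> K \<Longrightarrow> finite \<sigma> \<Longrightarrow> \<sigma> \<in> L"
  shows "relabel g B x \<in> chains k L"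
proof (rule chainsI)
  fix ws assume "relabel g B x ws \<noteq> 0"
  then have "set ws \<subseteq> B" "x (map g ws) \<noteq> 0" by (auto simp: relabel_def split: if_splits)
  then show "distinct ws \<and> length ws = Suc k \<and> set ws \<in> L"
    using chains_supp[OF x, of "map g ws"] L[of "set ws"] by (auto simp: distinct_map)
next
  fix ws p assume p: "p permutes {..<length (ws :: 'b list)}"
  then show "relabel g B x (permute_list p ws) = of_int (sign p) * relabel g B x ws"
    using chains_perm[OF x, of p "map g ws"] by (simp add: relabel_def permute_list_map)
qed

lemma relabel_boundary:
  fixes x :: "'a list \<Rightarrow> 'f::field"
  assumes x: "x \<in> chains k K" and g: "bij_betw g B A" and fin: "finite A" and K: "\<Union>K \<subseteq> A"
  shows "boundary (relabel g B x) = relabel g B (boundary x)"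
proof
  fix ws
  have finB: "finite B" using g fin bij_betw_finite by blast
  have "boundary (relabel g B x) ws = (if ws = [] then 0 else \<Sum>v\<in>B. relabel g B x (v # ws))"
    by (rule boundary_eq_sum[OF finB]) (auto simp: relabel_def split: if_splits)
  also have "\<dots> = (if ws = [] \<or> \<not> set ws \<subseteq> B then 0 else \<Sum>v\<in>B. x (g v # map g ws))"
    by (auto simp: relabel_def intro!: sum.cong sum.neutral)
  also have "\<dots> = relabel g B (boundary x) ws"
    using boundary_alt[OF x fin K, of "map g ws"] sum.reindex_bij_betw[OF g, of "\<lambda>v. x (v # map g ws)"]
    by (auto simp: relabel_def)
  finally show "boundary (relabel g B x) ws = relabel g B (boundary x) ws" .
qed

lemma relabel_relabel:
  assumes x: "x \<in> chains k K" and "\<Union>K \<subseteq> A" and g: "\<And>v. v \<in> A \<Longrightarrow> s v \<in> B \<and> g (s v) = v"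
  shows "relabel s A (relabel g B x) = x"
proof
  fix vs
  show "relabel s A (relabel g B x) vs = x vs"
  proof (cases "set vs \<subseteq> A")
    case True
    then have "map g (map s vs) = vs" "set (map s vs) \<subseteq> B"
      using g by (auto intro!: map_idI simp: subset_iff)
    then show ?thesis using True by (simp add: relabel_def)
  next
    case False
    then have "x vs = 0" using chains_supp[OF x, of vs] assms(2) by auto
    then show ?thesis using False by (simp add: relabel_def)
  qed
qed

lemma cycle_coordinates_sublevel:
  fixes S :: "'a set"
  assumes S: "finite S" and \<phi>: "filtration S \<phi>"
  shows "\<exists>Is (\<Lambda> :: real \<Rightarrow> ('a list \<Rightarrow> 'f::field) \<Rightarrow> nat \<Rightarrow> 'f). cycle_coordinates k (sublevel S \<phi>) Is \<Lambda> \<and>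
    (\<forall>b d. (b, d) \<in> set Is \<longrightarrow> 0 \<le> b \<and> ereal b < d)"
proof -
  let ?P = "pow_ne S"
  obtain r where r: "complex_order r ?P"
    "\<And>\<sigma> \<tau>. \<sigma> \<in> ?P \<Longrightarrow> \<tau> \<in> ?P \<Longrightarrow> r \<sigma> \<le> r \<tau> \<Longrightarrow> \<phi> \<sigma> \<le> \<phi> \<tau>"
    using compatible_order_exists[OF S \<phi>, of \<phi>] by blast
  then obtain c :: "'a set \<Rightarrow> 'a list \<Rightarrow> 'f" and b where nf: "normal_form r ?P c b"
    using normal_form_exists by blast
  have "inj_on r ?P" using r(1) by (simp add: complex_order_def)
  then interpret filtered_normal_form S \<phi> r c b
    by unfold_locales (use S \<phi> nf r(2) in auto)
  let ?A = "{\<sigma> \<in> positive_simplices k P b. ereal (\<phi> \<sigma>) < death \<phi> P b \<sigma>}"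
  have "finite ?A" using finite_P by (simp add: positive_simplices_def)
  then obtain ps where ps: "set ps = ?A" "distinct ps" using finite_distinct_list by blast
  have "0 \<le> \<phi> \<sigma>" if "\<sigma> \<in> P" for \<sigma> using filtration that by (simp add: filtration_def)
  then have "0 \<le> x \<and> ereal x < y" if "(x, y) \<in> set (map (\<lambda>\<sigma>. (\<phi> \<sigma>, death \<phi> P b \<sigma>)) ps)" for x y
    using that ps by (auto simp: positive_simplices_def)
  then show ?thesis using cycle_coordinates_exist[OF ps(2,1)] by blast
qed

text \<open>
  Points of \<open>S\<close> with the same image under \<open>\<pi>\<close> dominate each other, so only the image of a section of
  \<open>\<pi>\<close> matters.
\<close>

lemma cycle_coordinates_pullback:
  fixes \<pi> :: "'b \<Rightarrow> 'a" and \<Lambda> :: "real \<Rightarrow> ('b list \<Rightarrow> 'f::field) \<Rightarrow> nat \<Rightarrow> 'f"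
  assumes S: "finite S" and X: "\<pi> ` S = X" and \<phi>: "filtration X \<phi>"
    and \<Lambda>: "cycle_coordinates k (sublevel S (\<lambda>\<sigma>. \<phi> (\<pi> ` \<sigma>))) Is \<Lambda>"
  shows "\<exists>\<Lambda>' :: real \<Rightarrow> ('a list \<Rightarrow> 'f) \<Rightarrow> nat \<Rightarrow> 'f. cycle_coordinates k (sublevel X \<phi>) Is \<Lambda>'"
proof -
  let ?\<phi> = "\<lambda>\<sigma>. \<phi> (\<pi> ` \<sigma>)"
  let ?K = "sublevel X \<phi>" and ?K' = "sublevel S ?\<phi>"
  define s where "s = inv_into S \<pi>"
  have s: "s v \<in> S" "\<pi> (s v) = v" if "v \<in> X" for v
    using that X by (auto simp: s_def inv_into_into f_inv_into_f)
  let ?B = "s ` X" and ?W = "S - s ` X"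
  let ?L = "\<lambda>t. {\<sigma>\<in>?K' t. \<sigma> \<inter> ?W = {}}"
  have finX: "finite X" using S X by blast
  have pow: "\<pi> ` \<sigma> \<in> pow_ne X" if "\<sigma> \<in> pow_ne S" for \<sigma>
    using that X by (auto simp: pow_ne_def Fpow_def)
  have \<phi>': "filtration S ?\<phi>"
    using \<phi> pow unfolding filtration_def by (simp add: image_mono)
  have cx: "simplicial_complex (?K t)" and cx': "simplicial_complex (?K' t)" for t
    by (rule sublevel_complex[OF finX \<phi>], rule sublevel_complex[OF S \<phi>'])
  have VX: "\<Union>(?K t) \<subseteq> X" and VB: "\<Union>(?L t) \<subseteq> ?B" for t
    by (auto simp: sublevel_def pow_ne_def Fpow_def)
  \<comment> \<open>Adding the chosen point of the fibre through \<open>w\<close> leaves the image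
    under \<pi> unchanged, hence also the filtration value.\<close>
  have dom: "\<exists>a. a \<notin> ?W \<and> (\<forall>\<sigma>\<in>?K' t. w \<in> \<sigma> \<longrightarrow> insert a \<sigma> \<in> ?K' t)" if w: "w \<in> ?W" for w t
  proof (intro exI[of _ "s (\<pi> w)"] conjI ballI impI)
    have "\<pi> w \<in> X" using w X by blast
    then show "s (\<pi> w) \<notin> ?W" by blast
    fix \<sigma> assume \<sigma>: "\<sigma> \<in> ?K' t" "w \<in> \<sigma>"
    then have "\<pi> ` insert (s (\<pi> w)) \<sigma> = \<pi> ` \<sigma>" using s(2)[OF \<open>\<pi> w \<in> X\<close>] by auto
    then show "insert (s (\<pi> w)) \<sigma> \<in> ?K' t"
      using \<sigma> s(1)[OF \<open>\<pi> w \<in> X\<close>] by (simp add: sublevel_def pow_ne_def Fpow_def)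
  qed
  have finW: "finite ?W" using S by simp
  have retract: "\<exists>h\<in>chains (Suc k) (?K' t). (\<lambda>vs. y vs + boundary h vs) \<in> cycles k (?L t)"
    if "y \<in> cycles k (?K' t)" for y :: "'b list \<Rightarrow> 'f" and t
    by (rule dominated_vertices(1)[OF cx' finW _ that]) (rule dom)
  have bound: "y \<in> boundaries k (?L t)" if "y \<in> cycles k (?L t)" "y \<in> boundaries k (?K' t)"
    for y :: "'b list \<Rightarrow> 'f" and t
    by (rule dominated_vertices(2)[OF cx' finW _ that]) (rule dom)
  have bij: "bij_betw \<pi> ?B X" "bij_betw s X ?B"
    using s(2) by (auto intro: bij_betw_byWitness[of _ s] bij_betw_byWitness[of _ \<pi>])
  let ?up = "relabel \<pi> ?B :: ('a list \<Rightarrow> 'f) \<Rightarrow> 'b list \<Rightarrow> 'f"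
  let ?down = "relabel s X :: ('b list \<Rightarrow> 'f) \<Rightarrow> 'a list \<Rightarrow> 'f"
  have up: "?up x \<in> chains j (?L t)" if "x \<in> chains j (?K t)" for x j t
  proof (rule relabel_chains[OF that])
    fix \<sigma> assume \<sigma>: "\<sigma> \<subseteq> ?B" "\<pi> ` \<sigma> \<in> ?K t" "finite \<sigma>"
    then have "\<sigma> \<subseteq> S" using s(1) by blast
    then show "\<sigma> \<in> ?L t" using \<sigma> by (auto simp: sublevel_def pow_ne_def Fpow_def)
  qed
  have down: "?down y \<in> chains j (?K t)" if "y \<in> chains j (?L t)" for y j t
  proof (rule relabel_chains[OF that])
    fix \<sigma> assume \<sigma>: "\<sigma> \<subseteq> X" "s ` \<sigma> \<in> ?L t" "finite \<sigma>"
    have "\<pi> ` s ` \<sigma> = \<sigma>" using \<sigma>(1) s(2) by (force simp: image_iff)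
    then show "\<sigma> \<in> ?K t" using \<sigma> by (auto simp: sublevel_def pow_ne_def Fpow_def)
  qed
  have finB: "finite ?B" using finX by simp
  have du: "?down (?up x) = x" if "x \<in> chains j (?K t)" for x j t
    by (rule relabel_relabel[OF that VX]) (use s in auto)
  have ud: "?up (?down y) = y" if "y \<in> chains j (?L t)" for y j t
    by (rule relabel_relabel[OF that VB]) (use s in auto)
  have bup: "boundary (?up x) = ?up (boundary x)" if "x \<in> chains j (?K t)" for x j t
    by (rule relabel_boundary[OF that bij(1) finX VX])
  have bdown: "boundary (?down y) = ?down (boundary y)" if "y \<in> chains j (?L t)" for y j t
    by (rule relabel_boundary[OF that bij(2) finB VB])
  have up0: "?up (\<lambda>_. 0) = (\<lambda>_. 0)" "?down (\<lambda>_. 0) = (\<lambda>_. 0)" by (auto simp: relabel_def)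
  have upc: "?up x \<in> cycles k (?L t)" if "x \<in> cycles k (?K t)" for x t
  proof -
    have x: "x \<in> chains k (?K t)" "boundary x = (\<lambda>_. 0)" using that by (simp_all add: cycles_def)
    show ?thesis unfolding cycles_def using up[OF x(1)] bup[OF x(1)] x(2) up0(1) by simp
  qed
  have downc: "?down y \<in> cycles k (?K t)" if "y \<in> cycles k (?L t)" for y t
  proof -
    have y: "y \<in> chains k (?L t)" "boundary y = (\<lambda>_. 0)" using that by (simp_all add: cycles_def)
    show ?thesis unfolding cycles_def using down[OF y(1)] bdown[OF y(1)] y(2) up0(2) by simp
  qed
  have Lc: "cycles k (?L t) \<subseteq> (cycles k (?K' t) :: ('b list \<Rightarrow> 'f) set)"
    and Lb: "boundaries k (?L t) \<subseteq> (boundaries k (?K' t) :: ('b list \<Rightarrow> 'f) set)" for t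
    unfolding boundaries_def by (intro cycles_mono image_mono chains_mono; auto)+
  have lin: "\<Lambda> t (\<lambda>vs. x vs + q * y vs) = (\<lambda>i. \<Lambda> t x i + q * \<Lambda> t y i)"
    if "0 \<le> t" "x \<in> cycles k (?K' t)" "y \<in> cycles k (?K' t)" for t x y q
    using \<Lambda> that unfolding cycle_coordinates_def by blast
  have img: "\<Lambda> t ` cycles k (?K' t) = carrier (interval_sum Is t :: ('f, _) module)" if "0 \<le> t" for t
    using \<Lambda> that unfolding cycle_coordinates_def by blast
  have ker: "\<Lambda> t x = (\<lambda>_. 0) \<longleftrightarrow> x \<in> boundaries k (?K' t)" if "0 \<le> t" "x \<in> cycles k (?K' t)" for t x
    using \<Lambda> that unfolding cycle_coordinates_def by blast
  have nat: "\<Lambda> t x = interval_sum_map Is s t (\<Lambda> s x)" if "0 \<le> s" "s \<le> t" "x \<in> cycles k (?K' s)" for s t x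
    using \<Lambda> that unfolding cycle_coordinates_def by blast
  \<comment> \<open>Coordinates on \<open>X\<close> are the old ones after transport to the section.
    They remain onto because every cycle is homologous to one on the section
    (\<open>retract\<close>); the kernel is right because bounding in the large complex implies
    bounding on the section (\<open>bound\<close>).\<close>
  have "cycle_coordinates k ?K Is (\<lambda>t x. \<Lambda> t (?up x))"
    unfolding cycle_coordinates_def
  proof (intro conjI allI ballI impI)
    fix t :: real assume t: "0 \<le> t"
    have upc': "?up x \<in> cycles k (?K' t)" if "x \<in> cycles k (?K t)" for x
      by (rule subsetD[OF Lc upc[OF that]])
    show "\<Lambda> t (?up (\<lambda>vs. x vs + q * y vs)) = (\<lambda>i. \<Lambda> t (?up x) i + q * \<Lambda> t (?up y) i)"
      if "x \<in> cycles k (?K t)" "y \<in> cycles k (?K t)" for x y q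
      unfolding relabel_lin by (rule lin[OF t upc'[OF that(1)] upc'[OF that(2)]])
    show "(\<lambda>x. \<Lambda> t (?up x)) ` cycles k (?K t) = carrier (interval_sum Is t)"
    proof
      show "(\<lambda>x. \<Lambda> t (?up x)) ` cycles k (?K t) \<subseteq> carrier (interval_sum Is t)"
        using upc' img[OF t] by blast
      show "carrier (interval_sum Is t) \<subseteq> (\<lambda>x. \<Lambda> t (?up x)) ` cycles k (?K t)"
      proof
        fix d :: "nat \<Rightarrow> 'f" assume "d \<in> carrier (interval_sum Is t)"
        then have "d \<in> \<Lambda> t ` cycles k (?K' t)" by (simp only: img[OF t])
        then obtain y where y: "y \<in> cycles k (?K' t)" "\<Lambda> t y = d" by (elim imageE) simp
        from retract[OF y(1)] obtain h where h: "h \<in> chains (Suc k) (?K' t)" "(\<lambda>vs. y vs + boundary h vs) \<in> cycles k (?L t)"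
          by (elim bexE)
        let ?y = "\<lambda>vs. y vs + boundary h vs"
        have b: "boundary h \<in> boundaries k (?K' t)" using h(1) by (simp add: boundaries_def)
        have bc: "boundary h \<in> cycles k (?K' t)" by (rule subsetD[OF homology_cosets(8)[OF cx'] b])
        have "\<Lambda> t ?y = d" using lin[OF t y(1) bc, of 1] ker[OF t bc] b y(2) by simp
        moreover have "?y \<in> chains k (?L t)" using h(2) by (simp add: cycles_def)
        from ud[OF this] have "?up (?down ?y) = ?y" .
        ultimately show "d \<in> (\<lambda>x. \<Lambda> t (?up x)) ` cycles k (?K t)"
          using downc[OF h(2)] by (metis (no_types, lifting) image_eqI)
      qed
    qed
    show "\<Lambda> t (?up x) = (\<lambda>_. 0) \<longleftrightarrow> x \<in> boundaries k (?K t)" if x: "x \<in> cycles k (?K t)" for x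
    proof
      assume "\<Lambda> t (?up x) = (\<lambda>_. 0)"
      then have "?up x \<in> boundaries k (?K' t)" using ker[OF t upc'[OF x]] by blast
      then have "?up x \<in> boundaries k (?L t)" by (rule bound[OF upc[OF x]])
      then obtain c where c: "c \<in> chains (Suc k) (?L t)" "?up x = boundary c" by (auto simp: boundaries_def)
      have "x \<in> chains k (?K t)" using x by (simp add: cycles_def)
      from du[OF this] have "x = ?down (?up x)" by (rule sym)
      also have "\<dots> = boundary (?down c)" unfolding c(2) bdown[OF c(1)] ..
      finally show "x \<in> boundaries k (?K t)" using down[OF c(1)] unfolding boundaries_def by blast
    next
      assume "x \<in> boundaries k (?K t)"
      then obtain c where c: "c \<in> chains (Suc k) (?K t)" "x = boundary c" by (auto simp: boundaries_def)
      have "?up x = boundary (?up c)" unfolding c(2) by (rule bup[OF c(1), symmetric])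
      then have "?up x \<in> boundaries k (?L t)"
        unfolding boundaries_def using up[OF c(1)] by (rule image_eqI)
      then have "?up x \<in> boundaries k (?K' t)" by (rule subsetD[OF Lb])
      then show "\<Lambda> t (?up x) = (\<lambda>_. 0)" using ker[OF t upc'[OF x]] by (rule iffD2[rotated])
    qed
  next
    fix q t :: real and x :: "'a list \<Rightarrow> 'f" assume "0 \<le> q" "q \<le> t" "x \<in> cycles k (?K q)"
    then show "\<Lambda> t (?up x) = interval_sum_map Is q t (\<Lambda> q (?up x))"
      by (intro nat subsetD[OF Lc upc])
  qed
  then show ?thesis by blast
qed

text \<open>One list \<open>Is\<close> carries coordinates for both filtrations, and uniqueness of
  barcodes identifies each side with \<open>mset Is\<close>.\<close>

lemma persistence_barcode_pullback:
  fixes \<pi> :: "'b \<Rightarrow> 'a"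
  assumes S: "finite S" and X: "\<pi> ` S = X" and \<phi>: "filtration X \<phi>"
  shows "filtration S (\<lambda>\<sigma>. \<phi> (\<pi> ` \<sigma>))"
    and "persistence_barcode TYPE('f::field) k S (\<lambda>\<sigma>. \<phi> (\<pi> ` \<sigma>)) = persistence_barcode TYPE('f) k X \<phi>"
proof -
  have "\<pi> ` \<sigma> \<in> pow_ne X" if "\<sigma> \<in> pow_ne S" for \<sigma>
    using that X by (auto simp: pow_ne_def Fpow_def)
  then show \<phi>': "filtration S (\<lambda>\<sigma>. \<phi> (\<pi> ` \<sigma>))"
    using \<phi> unfolding filtration_def by (simp add: image_mono)
  have finX: "finite X" using S X by blast
  obtain Is and \<Lambda> :: "real \<Rightarrow> ('b list \<Rightarrow> 'f) \<Rightarrow> nat \<Rightarrow> 'f" where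
    \<Lambda>: "cycle_coordinates k (sublevel S (\<lambda>\<sigma>. \<phi> (\<pi> ` \<sigma>))) Is \<Lambda>"
    and bars: "\<And>b d. (b, d) \<in> set Is \<Longrightarrow> 0 \<le> b \<and> ereal b < d"
    using cycle_coordinates_sublevel[OF S \<phi>'] by blast
  obtain \<Lambda>' :: "real \<Rightarrow> ('a list \<Rightarrow> 'f) \<Rightarrow> nat \<Rightarrow> 'f" where
    \<Lambda>': "cycle_coordinates k (sublevel X \<phi>) Is \<Lambda>'"
    using cycle_coordinates_pullback[OF S X \<phi> \<Lambda>] by blast
  have "persistence_barcode TYPE('f) k S (\<lambda>\<sigma>. \<phi> (\<pi> ` \<sigma>)) = mset Is"
    unfolding persistence_barcode_def
    by (intro barcode_eqI persistent_homology S \<phi>' is_barcode_cycle_coordinates[OF S \<phi>' _ \<Lambda>] bars)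
  moreover have "persistence_barcode TYPE('f) k X \<phi> = mset Is"
    unfolding persistence_barcode_def
    by (intro barcode_eqI persistent_homology finX \<phi> is_barcode_cycle_coordinates[OF finX \<phi> _ \<Lambda>'] bars)
  ultimately show "persistence_barcode TYPE('f::field) k S (\<lambda>\<sigma>. \<phi> (\<pi> ` \<sigma>)) = persistence_barcode TYPE('f) k X \<phi>"
    by simp
qed

section \<open>Gromov-Hausdorff distance\<close>

lemma hausdorff_dist_le:
  assumes "A \<in> pow_ne UNIV" "B \<in> pow_ne UNIV"
    and "\<And>a. a \<in> A \<Longrightarrow> \<exists>b\<in>B. d a b \<le> \<delta>" "\<And>b. b \<in> B \<Longrightarrow> \<exists>a\<in>A. d a b \<le> \<delta>"
  shows "hausdorff_dist d A B \<le> \<delta>"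
proof -
  have fin: "finite A" "A \<noteq> {}" "finite B" "B \<noteq> {}" using assms(1,2) by (auto simp: pow_ne_def Fpow_def)
  have "(MIN b\<in>B. d a b) \<le> \<delta>" if "a \<in> A" for a
    using assms(3)[OF that] fin by (subst Min_le_iff) auto
  moreover have "(MIN a\<in>A. d a b) \<le> \<delta>" if "b \<in> B" for b
    using assms(4)[OF that] fin by (subst Min_le_iff) auto
  ultimately show ?thesis unfolding hausdorff_dist_def using fin by simp
qed

lemma distortion_ge:
  assumes "finite R" "p \<in> R" "q \<in> R"
  shows "\<bar>mdist X (fst p) (fst q) - mdist Y (snd p) (snd q)\<bar> \<le> distortion X Y R"
proof -
  let ?f = "\<lambda>p q. \<bar>mdist X (fst p) (fst q) - mdist Y (snd p) (snd q)\<bar>"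
  have "?f p q \<le> (MAX q\<in>R. ?f p q)" using assms by (intro Max_ge) auto
  also have "\<dots> \<le> (MAX p\<in>R. MAX q\<in>R. ?f p q)" using assms by (intro Max_ge) auto
  finally show ?thesis unfolding distortion_def by (simp add: case_prod_unfold)
qed

lemma linf_dist_le: "(\<And>i j. \<bar>A $ i $ j - B $ i $ j\<bar> \<le> \<delta>) \<Longrightarrow> linf_dist A B \<le> \<delta>"
  unfolding linf_dist_def by (subst Max_le_iff) auto

text \<open>Tuples in an image lift. With \<open>f\<close> either projection, the curvature sets on
  both sides become indexed by the same tuples in \<sigma>.\<close>

lemma curvature_set_submetric_image:
  fixes f :: "'c \<Rightarrow> 'a"
  assumes "f ` \<sigma> \<subseteq> mspace X"
  shows "(curvature_set (submetric X (f ` \<sigma>)) :: (real^'n^'n) set) =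
    (\<lambda>z. \<chi> i j. mdist X (f (z i)) (f (z j))) ` {z. range z \<subseteq> \<sigma>}"
proof (intro equalityI subsetI)
  fix M :: "real^'n^'n" assume "M \<in> curvature_set (submetric X (f ` \<sigma>))"
  then obtain x :: "'n \<Rightarrow> 'a" where x: "M = (\<chi> i j. mdist X (x i) (x j))" "range x \<subseteq> f ` \<sigma>"
    unfolding curvature_set_def by auto
  have "\<exists>p\<in>\<sigma>. x i = f p" for i
  proof -
    have "x i \<in> f ` \<sigma>" using x(2) by (rule subsetD) simp
    then show ?thesis by (rule imageE) blast
  qed
  then obtain z where z: "\<And>i. z i \<in> \<sigma>" "\<And>i. x i = f (z i)" by metis
  then show "M \<in> (\<lambda>z. \<chi> i j. mdist X (f (z i)) (f (z j))) ` {z. range z \<subseteq> \<sigma>}"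
    unfolding x(1) z(2) by (intro image_eqI[of _ _ z]) auto
next
  fix M :: "real^'n^'n" assume "M \<in> (\<lambda>z. \<chi> i j. mdist X (f (z i)) (f (z j))) ` {z. range z \<subseteq> \<sigma>}"
  then obtain z :: "'n \<Rightarrow> 'c" where z: "M = (\<chi> i j. mdist X (f (z i)) (f (z j)))" "range z \<subseteq> \<sigma>"
    by auto
  then have "range (\<lambda>i. f (z i)) \<subseteq> f ` \<sigma> \<inter> mspace X" using assms by auto
  then show "M \<in> curvature_set (submetric X (f ` \<sigma>))"
    unfolding curvature_set_def z(1) by (auto intro!: exI[of _ "\<lambda>i. f (z i)"])
qed

text \<open>A tuple of pairs in \<sigma> yields one matrix in each curvature set, and corresponding
  entries differ by at most the distortion; so each matrix has a near partner on the other
  side.\<close>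

lemma hausdorff_dist_curvature_set_le:
  assumes R: "R \<subseteq> mspace X \<times> mspace Y" "finite R" and \<sigma>: "\<sigma> \<in> pow_ne R"
  shows "hausdorff_dist linf_dist (curvature_set (submetric X (fst ` \<sigma>)) :: (real^'n^'n) set)
     (curvature_set (submetric Y (snd ` \<sigma>))) \<le> distortion X Y R"
proof -
  have \<sigma>R: "\<sigma> \<subseteq> R" and pow: "fst ` \<sigma> \<in> pow_ne (mspace X)" "snd ` \<sigma> \<in> pow_ne (mspace Y)"
    using \<sigma> R by (auto simp: pow_ne_def Fpow_def)
  let ?A = "\<lambda>z. (\<chi> i j. mdist X (fst (z i)) (fst (z j))) :: real^'n^'n"
  let ?B = "\<lambda>z. (\<chi> i j. mdist Y (snd (z i)) (snd (z j))) :: real^'n^'n"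
  have A: "curvature_set (submetric X (fst ` \<sigma>)) = ?A ` {z. range z \<subseteq> \<sigma>}"
    and B: "curvature_set (submetric Y (snd ` \<sigma>)) = ?B ` {z. range z \<subseteq> \<sigma>}"
    using pow by (auto simp: pow_ne_def Fpow_def intro!: curvature_set_submetric_image)
  have near: "linf_dist (?A z) (?B z) \<le> distortion X Y R" if "range z \<subseteq> \<sigma>" for z
  proof (rule linf_dist_le)
    fix i j
    have "z i \<in> R" "z j \<in> R" using that \<sigma>R by auto
    then show "\<bar>?A z $ i $ j - ?B z $ i $ j\<bar> \<le> distortion X Y R"
      using distortion_ge[OF R(2), of "z i" "z j"] by simp
  qed
  show ?thesis
  proof (rule hausdorff_dist_le[OF curvature_set_submetric[OF pow(1)] curvature_set_submetric[OF pow(2)]])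
    fix M :: "real^'n^'n" assume "M \<in> curvature_set (submetric X (fst ` \<sigma>))"
    then obtain z where "range z \<subseteq> \<sigma>" "M = ?A z" unfolding A by auto
    then show "\<exists>N\<in>curvature_set (submetric Y (snd ` \<sigma>)). linf_dist M N \<le> distortion X Y R"
      unfolding B using near[of z] by (intro bexI[of _ "?B z"]) simp_all
  next
    fix N :: "real^'n^'n" assume "N \<in> curvature_set (submetric Y (snd ` \<sigma>))"
    then obtain z where "range z \<subseteq> \<sigma>" "N = ?B z" unfolding B by auto
    then show "\<exists>M\<in>curvature_set (submetric X (fst ` \<sigma>)). linf_dist M N \<le> distortion X Y R"
      unfolding A using near[of z] by (intro bexI[of _ "?A z"]) simp_all
  qed
qed

lemma gromov_hausdorff_attained:
  assumes "finite_metric_space X" "finite_metric_space Y"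
  obtains R where "correspondence (mspace X) (mspace Y) R" "gromov_hausdorff X Y = distortion X Y R / 2"
proof -
  let ?C = "{R. correspondence (mspace X) (mspace Y) R}"
  have "?C \<subseteq> Pow (mspace X \<times> mspace Y)" by (auto simp: correspondence_def)
  then have "finite ?C" by (rule finite_subset) (use assms in \<open>simp add: finite_metric_space_def\<close>)
  moreover have "mspace X \<times> mspace Y \<in> ?C" using assms by (auto simp: correspondence_def finite_metric_space_def)
  ultimately have "(MIN R\<in>?C. distortion X Y R) \<in> distortion X Y ` ?C" by (intro Min_in) auto
  then show ?thesis using that unfolding gromov_hausdorff_def by auto
qed

theorem theorem4p7:
  fixes \<nu> :: "(real^'n^'n) set \<Rightarrow> real"
    and L :: real
    and X :: "'a metric"
    and Y :: "'b metric"
    and k :: nat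
  assumes "L > 0"
    and "valuation \<nu>"
    and "stable_valuation L \<nu>"
    and "finite_metric_space X"
    and "finite_metric_space Y"
  shows "bottleneck_dist (dgm TYPE('f::field) k (induced_filtration \<nu>) X)
                         (dgm TYPE('f::field) k (induced_filtration \<nu>) Y)
         \<le> ereal (2 * L * gromov_hausdorff X Y)"
proof -
  obtain R where R: "correspondence (mspace X) (mspace Y) R"
    and GH: "gromov_hausdorff X Y = distortion X Y R / 2"
    using gromov_hausdorff_attained[OF assms(4,5)] by blast
  have sub: "R \<subseteq> mspace X \<times> mspace Y" and proj: "fst ` R = mspace X" "snd ` R = mspace Y"
    using R by (auto simp: correspondence_def)
  have fin: "finite R"
    by (rule finite_subset[OF sub]) (use assms(4,5) in \<open>simp add: finite_metric_space_def\<close>)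
  let ?\<phi> = "induced_filtration \<nu> X" and ?\<psi> = "induced_filtration \<nu> Y"
  note pbX = persistence_barcode_pullback[OF fin proj(1) filtration_induced_filtration[OF assms(2)]]
  note pbY = persistence_barcode_pullback[OF fin proj(2) filtration_induced_filtration[OF assms(2)]]
  \<comment> \<open>Comparing a pair of \<open>R\<close> with itself shows that the distortion is
    nonnegative, as the stability bound requires of its \<epsilon>.\<close>
  have "R \<noteq> {}" using proj(1) assms(4) unfolding finite_metric_space_def by (metis image_is_empty)
  then obtain p where "p \<in> R" by blast
  then have "0 \<le> distortion X Y R" using distortion_ge[OF fin, of p p X Y] by linarith
  moreover have "\<bar>?\<phi> (fst ` \<sigma>) - ?\<psi> (snd ` \<sigma>)\<bar> \<le> L * distortion X Y R" if \<sigma>: "\<sigma> \<in> pow_ne R" for \<sigma>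
  proof -
    have "fst ` \<sigma> \<in> pow_ne (mspace X)" "snd ` \<sigma> \<in> pow_ne (mspace Y)"
      using \<sigma> sub by (auto simp: pow_ne_def Fpow_def)
    from this[THEN curvature_set_submetric] have "\<bar>?\<phi> (fst ` \<sigma>) - ?\<psi> (snd ` \<sigma>)\<bar> \<le> L * hausdorff_dist linf_dist
        (curvature_set (submetric X (fst ` \<sigma>)) :: (real^'n^'n) set) (curvature_set (submetric Y (snd ` \<sigma>)))"
      unfolding induced_filtration_def by (rule assms(3)[unfolded stable_valuation_def, rule_format])
    also have "\<dots> \<le> L * distortion X Y R"
      using hausdorff_dist_curvature_set_le[OF sub fin \<sigma>] assms(1) by (intro mult_left_mono) auto
    finally show ?thesis .
  qed
  ultimately have "bottleneck_dist
      (persistence_barcode TYPE('f) k R (\<lambda>\<sigma>. ?\<phi> (fst ` \<sigma>)))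
      (persistence_barcode TYPE('f) k R (\<lambda>\<sigma>. ?\<psi> (snd ` \<sigma>))) \<le> ereal (L * distortion X Y R)"
    using assms(1) by (intro persistence_barcode_stable[OF fin pbX(1) pbY(1)]) auto
  then show ?thesis unfolding dgm_eq_persistence_barcode pbX(2) pbY(2) GH by simp
qed

end
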